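(* For a periodic tiling $T$ in $\mathbb{R}^2$ with positive space group $\Gamma_+$ and rotational hull $\Omega_r$, the fundamental group $\pi_1(\Omega_r)$ is an extension $$\mathbb{Z}\to\pi_1(\Omega_r)\to\Gamma_+ .$$ For a periodic tiling $T$ in $\mathbb{R}^d$ with $d\geqslant3$, the fundamental group $\pi_1(\Omega_r)$ is an extension $$\mathbb{Z}/2\to\pi_1(\Omega_r)\to\Gamma_+ .$$
   Context: A tiling of $\mathbb{R}^d$ is a cover of $\mathbb{R}^d$ by compact $d$-dimensional polyhedral subsets (tiles), possibly labelled, meeting full face to full face and only on boundaries, each tile being a translate of one of a finite set of prototiles. $T$ is periodic if its translational symmetries form a full-rank lattice $\cong\mathbb{Z}^d$. The positive space group $\Gamma_+$ is the group of all orientation preserving isometries of $\mathbb{R}^d$ preserving $T$. The rotational hull $\Omega_r$ of $T$ is the space of tilings all of whose finite patches (finite sets of tiles) appear in $T$ up to orientation preserving isometry, with the topology in which two tilings are close if they agree on a large ball about the origin after a small translation followed by a small rotation of either. An extension $A\to B\to C$ means a short exact sequence of groups. *)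

theory Defs
  imports "HOL-Analysis.Analysis" "HOL-Algebra.Elementary_Groups"
begin

section \<open>Polyhedral tiles and their faces\<close>

text \<open>
  A polyhedral set need be neither convex nor connected: it is a finite union of
  full-dimensional convex polytopes.
\<close>

definition polyhedral_body :: "(real ^ 'n) set \<Rightarrow> bool" where
  "polyhedral_body P \<longleftrightarrow>
     (\<exists>F. finite F \<and> F \<noteq> {} \<and> (\<forall>p\<in>F. polytope p \<and> aff_dim p = int CARD('n)) \<and> P = \<Union>F)"

text \<open>
  The library's \<open>face_of\<close> is about convex sets. For general polyhedral sets, two points are
  locally similar if small neighbourhoods of them in the set differ by a translation. The open
  faces are the connected components of the local similarity classes, and the faces are the
  closures of the open faces. For a full-dimensional convex polytope the open faces in the frontier
  are the relative interiors of the proper nonempty faces, so these are the usual faces.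
\<close>

definition locally_similar :: "(real ^ 'n) set \<Rightarrow> real ^ 'n \<Rightarrow> real ^ 'n \<Rightarrow> bool" where
  "locally_similar P x y \<longleftrightarrow> (\<exists>e>0. \<forall>v. norm v < e \<longrightarrow> (x + v \<in> P \<longleftrightarrow> y + v \<in> P))"

definition proper_faces :: "(real ^ 'n) set \<Rightarrow> (real ^ 'n) set set" where
  "proper_faces P =
     {closure (connected_component_set {y. locally_similar P x y} x) | x. x \<in> frontier P}"

section \<open>Tilings\<close>

text \<open>
  A tile is a pair of a support and a label; for unlabelled tilings take \<open>unit\<close> as the type of
  labels. Isometries move the support and keep the label.
\<close>

type_synonym ('n, 'l) tile = "(real ^ 'n) set \<times> 'l"

definition move_tile :: "(real ^ 'n \<Rightarrow> real ^ 'n) \<Rightarrow> ('n, 'l) tile \<Rightarrow> ('n, 'l) tile" where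
  "move_tile g t = (g ` fst t, snd t)"

definition move :: "(real ^ 'n \<Rightarrow> real ^ 'n) \<Rightarrow> ('n, 'l) tile set \<Rightarrow> ('n, 'l) tile set" where
  "move g S = move_tile g ` S"

definition tiling :: "('n::finite, 'l) tile set \<Rightarrow> bool" where
  "tiling T \<longleftrightarrow>
     (\<forall>t\<in>T. polyhedral_body (fst t)) \<and>
     (\<Union>t\<in>T. fst t) = UNIV \<and>
     (\<forall>t\<in>T. \<forall>t'\<in>T. t \<noteq> t' \<longrightarrow>
        fst t \<inter> fst t' \<subseteq> frontier (fst t) \<inter> frontier (fst t') \<and>
        fst t \<inter> fst t' = \<Union>(proper_faces (fst t) \<inter> proper_faces (fst t'))) \<and>
     (\<exists>P. finite P \<and> (\<forall>t\<in>T. \<exists>p\<in>P. \<exists>v. t = move_tile (\<lambda>x. x + v) p))"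

definition full_rank_lattice :: "(real ^ 'n) set \<Rightarrow> bool" where
  "full_rank_lattice L \<longleftrightarrow>
     (\<exists>B. independent B \<and> span B = UNIV \<and>
          L = {\<Sum>b\<in>B. of_int (c b) *\<^sub>R b | c :: real ^ 'n \<Rightarrow> int. True})"

definition periodic_tiling :: "('n::finite, 'l) tile set \<Rightarrow> bool" where
  "periodic_tiling T \<longleftrightarrow> tiling T \<and> full_rank_lattice {v. move (\<lambda>x. x + v) T = T}"

section \<open>Isometries and the positive space group\<close>

text \<open>The map \<open>\<lambda>x. g x - g 0\<close> is the linear part of the isometry \<open>g\<close>.\<close>

definition pos_isometry :: "(real ^ 'n \<Rightarrow> real ^ 'n) \<Rightarrow> bool" where
  "pos_isometry g \<longleftrightarrow>
     (\<forall>x y. dist (g x) (g y) = dist x y) \<and> det (matrix (\<lambda>x. g x - g 0)) > 0"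

definition positive_space_group :: "('n, 'l) tile set \<Rightarrow> (real ^ 'n \<Rightarrow> real ^ 'n) monoid" where
  "positive_space_group T =
     \<lparr>carrier = {g. pos_isometry g \<and> move g T = T}, monoid.mult = (\<circ>), one = id\<rparr>"

section \<open>The rotational hull\<close>

definition rotational_hull :: "('n::finite, 'l) tile set \<Rightarrow> ('n, 'l) tile set set" where
  "rotational_hull T =
     {S. tiling S \<and> (\<forall>P. finite P \<and> P \<subseteq> S \<longrightarrow> (\<exists>g. pos_isometry g \<and> move g P \<subseteq> T))}"

definition agree_on :: "(real ^ 'n) set \<Rightarrow> ('n, 'l) tile set \<Rightarrow> ('n, 'l) tile set \<Rightarrow> bool" where
  "agree_on A S S' \<longleftrightarrow> {t\<in>S. fst t \<inter> A \<noteq> {}} = {t\<in>S'. fst t \<inter> A \<noteq> {}}"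

definition small_motion :: "real \<Rightarrow> (real ^ 'n \<Rightarrow> real ^ 'n) \<Rightarrow> bool" where
  "small_motion \<epsilon> g \<longleftrightarrow>
     (\<exists>v R. norm v < \<epsilon> \<and> orthogonal_transformation R \<and> det (matrix R) = 1 \<and>
            onorm (\<lambda>x. R x - x) < \<epsilon> \<and> g = (\<lambda>x. R (x + v)))"

definition close_tilings :: "real \<Rightarrow> ('n::finite, 'l) tile set \<Rightarrow> ('n, 'l) tile set \<Rightarrow> bool" where
  "close_tilings \<epsilon> S S' \<longleftrightarrow>
     (\<exists>g h. small_motion \<epsilon> g \<and> small_motion \<epsilon> h \<and> agree_on (ball 0 (1 / \<epsilon>)) (move g S) (move h S'))"

definition hull_topology :: "('n::finite, 'l) tile set \<Rightarrow> ('n, 'l) tile set topology" where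
  "hull_topology T = topology (\<lambda>U. U \<subseteq> rotational_hull T \<and>
     (\<forall>S\<in>U. \<exists>\<epsilon>>0. \<forall>S'\<in>rotational_hull T. close_tilings \<epsilon> S S' \<longrightarrow> S' \<in> U))"

lemma small_motion_mono: "small_motion \<epsilon> g \<Longrightarrow> \<epsilon> \<le> \<delta> \<Longrightarrow> small_motion \<delta> g"
  unfolding small_motion_def
  by (elim exE conjE, intro exI conjI) (assumption | erule order_less_le_trans)+

lemma agree_on_subset: "agree_on A S S' \<Longrightarrow> B \<subseteq> A \<Longrightarrow> agree_on B S S'"
  unfolding agree_on_def by blast

lemma close_tilings_mono:
  assumes "close_tilings \<epsilon> S S'" "0 < \<epsilon>" "\<epsilon> \<le> \<delta>"
  shows "close_tilings \<delta> S S'"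
proof -
  have "ball 0 (1 / \<delta>) \<subseteq> ball (0 :: real ^ 'a) (1 / \<epsilon>)"
    using assms by (intro subset_ball) (simp add: frac_le)
  with assms show ?thesis
    unfolding close_tilings_def by (meson agree_on_subset small_motion_mono)
qed

lemma openin_hull_topology:
  "openin (hull_topology T) U \<longleftrightarrow> U \<subseteq> rotational_hull T \<and>
     (\<forall>S\<in>U. \<exists>\<epsilon>>0. \<forall>S'\<in>rotational_hull T. close_tilings \<epsilon> S S' \<longrightarrow> S' \<in> U)"
proof -
  let ?L = "\<lambda>U. U \<subseteq> rotational_hull T \<and>
     (\<forall>S\<in>U. \<exists>\<epsilon>>0. \<forall>S'\<in>rotational_hull T. close_tilings \<epsilon> S S' \<longrightarrow> S' \<in> U)"
  have "?L (U \<inter> V)" if U: "?L U" and V: "?L V" for U V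
  proof (intro conjI ballI)
    show "U \<inter> V \<subseteq> rotational_hull T" using U by blast
    fix S assume S: "S \<in> U \<inter> V"
    obtain a where a: "a > 0" "\<forall>S'\<in>rotational_hull T. close_tilings a S S' \<longrightarrow> S' \<in> U"
      using S U by blast
    obtain b where b: "b > 0" "\<forall>S'\<in>rotational_hull T. close_tilings b S S' \<longrightarrow> S' \<in> V"
      using S V by blast
    show "\<exists>\<epsilon>>0. \<forall>S'\<in>rotational_hull T. close_tilings \<epsilon> S S' \<longrightarrow> S' \<in> U \<inter> V"
    proof (intro exI conjI ballI impI)
      show "0 < min a b" using a b by simp
      fix S' assume "S' \<in> rotational_hull T" "close_tilings (min a b) S S'"
      then show "S' \<in> U \<inter> V"
        using a b close_tilings_mono[of "min a b" S S' a] close_tilings_mono[of "min a b" S S' b]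
        by auto
    qed
  qed
  moreover have "?L (\<Union>K)" if "\<forall>U\<in>K. ?L U" for K
    using that by (intro conjI ballI) (blast, meson UnionE UnionI)
  ultimately have "istopology ?L"
    unfolding istopology_def by blast
  then show ?thesis
    unfolding hull_topology_def by simp
qed

lemma topspace_hull_topology: "topspace (hull_topology T) = rotational_hull T"
proof -
  have "openin (hull_topology T) (rotational_hull T)"
    unfolding openin_hull_topology by (auto intro: exI[of _ 1])
  then show ?thesis
    by (metis openin_hull_topology openin_subset openin_topspace subset_antisym)
qed

section \<open>The fundamental group and group extensions\<close>

text \<open>
  The library's \<open>homotopic_paths\<close> and \<open>joinpaths\<close> are restricted to topological type classes; these
  are the same definitions for loops in an abstract topology.
\<close>

definition loops_at :: "'a topology \<Rightarrow> 'a \<Rightarrow> (real \<Rightarrow> 'a) set" where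
  "loops_at X x0 = {p. pathin X p \<and> p 0 = x0 \<and> p 1 = x0}"

definition loop_homotopic :: "'a topology \<Rightarrow> 'a \<Rightarrow> (real \<Rightarrow> 'a) \<Rightarrow> (real \<Rightarrow> 'a) \<Rightarrow> bool" where
  "loop_homotopic X x0 p q \<longleftrightarrow>
     homotopic_with (\<lambda>r. r 0 = x0 \<and> r 1 = x0) (top_of_set {0..1}) X p q"

definition loop_join :: "(real \<Rightarrow> 'a) \<Rightarrow> (real \<Rightarrow> 'a) \<Rightarrow> real \<Rightarrow> 'a" where
  "loop_join p q = (\<lambda>t. if t \<le> 1 / 2 then p (2 * t) else q (2 * t - 1))"

definition loop_class :: "'a topology \<Rightarrow> 'a \<Rightarrow> (real \<Rightarrow> 'a) \<Rightarrow> (real \<Rightarrow> 'a) set" where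
  "loop_class X x0 p = {q. loop_homotopic X x0 p q}"

definition fundamental_group :: "'a topology \<Rightarrow> 'a \<Rightarrow> (real \<Rightarrow> 'a) set monoid" where
  "fundamental_group X x0 =
     \<lparr>carrier = loop_class X x0 ` loops_at X x0,
      monoid.mult = (\<lambda>a b. {r. \<exists>p\<in>a. \<exists>q\<in>b. loop_homotopic X x0 (loop_join p q) r}),
      one = loop_class X x0 (\<lambda>_. x0)\<rparr>"

text \<open>
  \<open>B\<close> is an extension \<open>A \<rightarrow> B \<rightarrow> C\<close>. The library's \<open>short_exact_sequence\<close> requires the elements of all
  groups to have the same type.
\<close>

definition group_extension ::
  "('a, 'r) monoid_scheme \<Rightarrow> ('b, 's) monoid_scheme \<Rightarrow> ('c, 't) monoid_scheme \<Rightarrow> bool" where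
  "group_extension A B C \<longleftrightarrow>
     group A \<and> group B \<and> group C \<and>
     (\<exists>f g. f \<in> mon A B \<and> g \<in> epi B C \<and> f ` carrier A = kernel B C g)"

end

theory Submission
  imports Defs
begin

text \<open>
  By periodicity and local finiteness a tiling in the orbit of \<open>T\<close> under \<open>SE(d)\<close>, the group of
  orientation preserving isometries, is determined by its restriction to a ball of fixed radius.
  Hence \<open>\<Omega>\<^sub>r\<close> is the orbit \<open>SE(d) / \<Gamma>\<^sub>+\<close> with the quotient topology, and \<open>\<Gamma>\<^sub>+\<close> is discrete.
  Lifting loops to \<open>SE(d)\<close> maps \<open>\<pi>\<^sub>1(\<Omega>\<^sub>r)\<close> onto \<open>\<Gamma>\<^sub>+\<close> with kernel \<open>\<pi>\<^sub>1(SE(d)) = \<pi>\<^sub>1(SO(d))\<close>.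
  Pushing the images of the basis vectors along spheres, one axis after the other, deforms every loop
  in \<open>SO(d)\<close> into a number of full turns of a coordinate plane. For \<open>d = 2\<close> this number is the
  winding number. For \<open>d \<ge> 3\<close> a turn can be reversed through a third axis, so only its parity
  matters, and the parity is detected by the spin covering.
\<close>

section \<open>Quotients of topological groups by discrete subgroups\<close>

text \<open>Two obstacles shape the proof. Rigidity has to survive rotations: agreement of
  \<open>move (act g) T\<close> with \<open>T\<close> on one ball gives no immediate relation
  between the period lattices of the two tilings. It comes from local finiteness. Only finitely many
  short translations carry a fixed tile to a tile, so one radius decides whether a short vector is a
  period, and the rotated basis vectors pass this test. Secondly, the hull is an abstract topology,
  so its covering is pulled back along each map from an interval or a square before anything is
  lifted, and loops are studied through their lifts in the group.

  The locale serves twice: for the hull as a quotient of the rigid motions, and for the rotations as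
  the quotient of the spin group by a group of two elements, where path lifting shows that a full
  turn is essential. The spin group is realised by real matrices indexed by sets of axes. A second
  family of operators, anticommuting with the Clifford generators, leaves only scalars in the common
  commutant and so pins each lift down to its sign.\<close>

locale discrete_quotient = group G for G :: "'e::euclidean_space monoid" (structure) +
  fixes X :: "'b topology" and \<phi> :: "'e \<Rightarrow> 'b" and \<Gamma> :: "'e set"
  assumes continuous_mult: "continuous_on (carrier G \<times> carrier G) (\<lambda>(x, y). x \<otimes> y)"
    and continuous_inv: "continuous_on (carrier G) (\<lambda>x. inv x)"
    and proj_continuous: "continuous_map (top_of_set (carrier G)) X \<phi>"
    and proj_open: "open_map (top_of_set (carrier G)) X \<phi>"
    and proj_onto: "\<phi> ` carrier G = topspace X"
    and subgroup: "subgroup \<Gamma> G"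
    and discrete: "\<exists>W. open W \<and> W \<inter> \<Gamma> = {\<one>}"
    and fibre: "\<lbrakk>g \<in> carrier G; h \<in> carrier G\<rbrakk> \<Longrightarrow> \<phi> g = \<phi> h \<longleftrightarrow> inv g \<otimes> h \<in> \<Gamma>"
begin

lemma deck_closed: "\<gamma> \<in> \<Gamma> \<Longrightarrow> \<gamma> \<in> carrier G"
  using subgroup subgroup.mem_carrier by fastforce

lemma continuous_right_mult: "a \<in> carrier G \<Longrightarrow> continuous_on (carrier G) (\<lambda>x. x \<otimes> a)"
  by (rule continuous_on_compose2[OF continuous_mult, of "carrier G" "\<lambda>x. (x, a)", simplified])
    (auto intro!: continuous_intros)

text \<open>The map \<open>(x, y) \<mapsto> inv x \<otimes> y\<close> sends \<open>(g, g)\<close> to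
  the identity, so some product neighbourhood of \<open>(g, g)\<close> lands in the open set that
  isolates the identity in \<open>\<Gamma>\<close>. By the description of the fibres,
  \<open>\<phi>\<close> is injective on such a neighbourhood.\<close>

lemma separated_neighbourhood:
  assumes "g \<in> carrier G"
  obtains V where "openin (top_of_set (carrier G)) V" "g \<in> V"
    "\<And>v w. \<lbrakk>v \<in> V; w \<in> V; inv v \<otimes> w \<in> \<Gamma>\<rbrakk> \<Longrightarrow> v = w"
proof -
  obtain W where W: "open W" "W \<inter> \<Gamma> = {\<one>}" using discrete by blast
  let ?C = "carrier G \<times> carrier G"
  let ?m = "\<lambda>p. inv (fst p) \<otimes> snd p"
  have "continuous_on ?C ?m"
  proof -
    have "continuous_on ?C (\<lambda>p. (inv (fst p), snd p))"
      by (intro continuous_intros continuous_on_compose2[OF continuous_inv]) auto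
    then show ?thesis
      by (rule continuous_on_compose2[OF continuous_mult, of ?C "\<lambda>p. (inv (fst p), snd p)", simplified]) auto
  qed
  then have "openin (top_of_set ?C) (?C \<inter> ?m -` W)"
    using W by (simp add: continuous_openin_preimage_gen)
  moreover have "(g, g) \<in> ?C \<inter> ?m -` W"
    using assms W by auto
  ultimately obtain A B where AB: "openin (top_of_set (carrier G)) A" "g \<in> A"
    "openin (top_of_set (carrier G)) B" "g \<in> B" "A \<times> B \<subseteq> ?C \<inter> ?m -` W"
    using Times_in_interior_subtopology[of g g "?C \<inter> ?m -` W" "carrier G" "carrier G"] by blast
  show thesis
  proof
    show "openin (top_of_set (carrier G)) (A \<inter> B)" using AB by blast
    show "g \<in> A \<inter> B" using AB by blast
    fix v w assume vw: "v \<in> A \<inter> B" "w \<in> A \<inter> B" "inv v \<otimes> w \<in> \<Gamma>"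
    then have "inv v \<otimes> w \<in> W \<inter> \<Gamma>" "v \<in> carrier G" "w \<in> carrier G" using AB(5) by auto
    then have "inv v \<otimes> w = \<one>" using W by blast
    then show "v = w"
      using \<open>v \<in> carrier G\<close> \<open>w \<in> carrier G\<close> by (metis inv_equality inv_inv inv_closed)
  qed
qed

text \<open>\<open>X\<close> is an abstract topology, so \<open>\<phi>\<close> itself is no instance
  of \<open>covering_space\<close>, but its pullback along a map from a Euclidean set is. Lifts of
  \<open>f\<close> through \<open>\<phi>\<close> are sections of this pullback.\<close>

lemma covering_space_pullback:
  fixes K :: "'k::euclidean_space set"
  assumes f: "continuous_map (top_of_set K) X f"
  shows "covering_space {(k, g). k \<in> K \<and> g \<in> carrier G \<and> f k = \<phi> g} fst K"
proof -
  let ?C = "{(k, g). k \<in> K \<and> g \<in> carrier G \<and> f k = \<phi> g}"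
  have fX: "f k \<in> topspace X" if "k \<in> K" for k
    using f that by (simp add: continuous_map_def Pi_iff)
  have sheets: "\<exists>T. k0 \<in> T \<and> openin (top_of_set K) T \<and>
            (\<exists>v. \<Union>v = ?C \<inter> fst -` T \<and> (\<forall>u\<in>v. openin (top_of_set ?C) u) \<and>
              pairwise disjnt v \<and> (\<forall>u\<in>v. \<exists>q. homeomorphism u T fst q))"
    if k0: "k0 \<in> K" for k0
  proof -
    obtain g0 where g0: "g0 \<in> carrier G" "\<phi> g0 = f k0"
      using fX[OF k0] proj_onto by (metis imageE)
    obtain V where V: "openin (top_of_set (carrier G)) V" "g0 \<in> V"
      and sep: "\<And>v w. \<lbrakk>v \<in> V; w \<in> V; inv v \<otimes> w \<in> \<Gamma>\<rbrakk> \<Longrightarrow> v = w"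
      using separated_neighbourhood[OF g0(1)] by metis
    have VG: "V \<subseteq> carrier G" using V(1) openin_imp_subset by blast
    have inj: "v = w" if "v \<in> V" "w \<in> V" "\<phi> v = \<phi> w" for v w
      using sep that fibre VG by blast
    let ?T = "{k \<in> K. f k \<in> \<phi> ` V}"
    have openT: "openin (top_of_set K) {k \<in> K. f k \<in> \<phi> ` U}"
      if "openin (top_of_set (carrier G)) U" for U
    proof -
      have "openin X (\<phi> ` U)" using proj_open that by (simp add: open_map_def)
      from openin_continuous_map_preimage[OF f this] show ?thesis by simp
    qed
    \<comment> \<open>The sheet of \<open>\<gamma>\<close> consists of the points whose group
      component lies in the right translate of \<open>V\<close> by \<open>\<gamma>\<close>.\<close>
    let ?u = "\<lambda>\<gamma>. {p \<in> ?C. snd p \<otimes> inv \<gamma> \<in> V}"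
    have phi_shift: "\<phi> (g \<otimes> \<gamma>) = \<phi> g" if "g \<in> carrier G" "\<gamma> \<in> \<Gamma>" for g \<gamma>
      using fibre[of g "g \<otimes> \<gamma>"] that deck_closed[OF that(2)] by (simp add: m_assoc[symmetric])
    have invG: "inv \<gamma> \<in> \<Gamma>" if "\<gamma> \<in> \<Gamma>" for \<gamma>
      using subgroup that subgroup.m_inv_closed by fast
    show ?thesis
    proof (intro exI conjI)
      have "f k0 \<in> \<phi> ` V" using V(2) g0(2) by (metis imageI)
      then show "k0 \<in> ?T" using k0 by simp
      show "openin (top_of_set K) ?T" using openT V by blast
      show "\<Union>(?u ` \<Gamma>) = ?C \<inter> fst -` ?T"
      proof (intro subset_antisym subsetI)
        fix p assume "p \<in> \<Union>(?u ` \<Gamma>)"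
        then obtain \<gamma> where g: "\<gamma> \<in> \<Gamma>" "p \<in> ?C" "snd p \<otimes> inv \<gamma> \<in> V" by auto
        then have "\<phi> (snd p) = \<phi> (snd p \<otimes> inv \<gamma>)" using phi_shift invG by auto
        then show "p \<in> ?C \<inter> fst -` ?T" using g by force
      next
        fix p assume p: "p \<in> ?C \<inter> fst -` ?T"
        then obtain v where v: "v \<in> V" "\<phi> v = \<phi> (snd p)" and pg: "snd p \<in> carrier G" by auto
        have vG: "v \<in> carrier G" using v VG by auto
        have gam: "inv v \<otimes> snd p \<in> \<Gamma>" using fibre vG pg v by auto
        moreover have "snd p \<otimes> inv (inv v \<otimes> snd p) = v"
          using vG pg by (simp add: inv_mult_group m_assoc[symmetric])
        ultimately show "p \<in> \<Union>(?u ` \<Gamma>)" using p v by force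
      qed
      show "\<forall>u\<in>?u ` \<Gamma>. openin (top_of_set ?C) u"
      proof
        fix u assume "u \<in> ?u ` \<Gamma>"
        then obtain \<gamma> where g: "\<gamma> \<in> \<Gamma>" "u = ?u \<gamma>" by auto
        have c: "continuous_on ?C (\<lambda>p. snd p \<otimes> inv \<gamma>)"
          using deck_closed[OF invG[OF g(1)]]
          by (intro continuous_on_compose2[OF continuous_right_mult]) (auto intro!: continuous_intros)
        have "openin (top_of_set ?C) (?C \<inter> (\<lambda>p. snd p \<otimes> inv \<gamma>) -` V)"
          by (rule continuous_openin_preimage[OF c _ V(1)]) (use deck_closed[OF invG[OF g(1)]] in auto)
        moreover have "?C \<inter> (\<lambda>p. snd p \<otimes> inv \<gamma>) -` V = u" unfolding g(2) by blast
        ultimately show "openin (top_of_set ?C) u" by simp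
      qed
      show "pairwise disjnt (?u ` \<Gamma>)"
      proof (rule pairwiseI)
        fix a b assume ab: "a \<in> ?u ` \<Gamma>" "b \<in> ?u ` \<Gamma>" "a \<noteq> b"
        then obtain \<gamma> \<delta> where gd: "\<gamma> \<in> \<Gamma>" "\<delta> \<in> \<Gamma>" "a = ?u \<gamma>" "b = ?u \<delta>" by auto
        show "disjnt a b"
        proof (rule ccontr)
          assume "\<not> disjnt a b"
          then obtain p where p: "p \<in> ?C" "snd p \<otimes> inv \<gamma> \<in> V" "snd p \<otimes> inv \<delta> \<in> V"
            unfolding disjnt_def gd by auto
          have pg: "snd p \<in> carrier G" using p by auto
          have c: "\<gamma> \<in> carrier G" "\<delta> \<in> carrier G" using gd deck_closed by auto
          have "inv (snd p \<otimes> inv \<gamma>) \<otimes> (snd p \<otimes> inv \<delta>) = \<gamma> \<otimes> inv \<delta>"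
          proof -
            have "inv (snd p) \<otimes> (snd p \<otimes> inv \<delta>) = inv \<delta>"
              using pg c by (metis m_assoc l_inv l_one inv_closed)
            then show ?thesis using pg c by (simp add: inv_mult_group m_assoc)
          qed
          moreover have "\<gamma> \<otimes> inv \<delta> \<in> \<Gamma>"
            using gd subgroup invG subgroup.m_closed by fast
          ultimately have "snd p \<otimes> inv \<gamma> = snd p \<otimes> inv \<delta>" using sep p by auto
          then have "inv (snd p) \<otimes> snd p \<otimes> inv \<gamma> = inv (snd p) \<otimes> snd p \<otimes> inv \<delta>"
            using pg c by (simp only: m_assoc inv_closed)
          then have "inv \<gamma> = inv \<delta>" using pg c by simp
          then have "\<gamma> = \<delta>" using c by (metis inv_inv)
          then show False using ab gd by simp
        qed
      qed
      show "\<forall>u\<in>?u ` \<Gamma>. \<exists>q. homeomorphism u ?T fst q"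
      proof
        fix u assume "u \<in> ?u ` \<Gamma>"
        then obtain \<gamma> where g: "\<gamma> \<in> \<Gamma>" "u = ?u \<gamma>" by auto
        have gc: "\<gamma> \<in> carrier G" using g deck_closed by auto
        \<comment> \<open>\<open>s\<close> is \<open>f\<close> followed by the inverse of
          \<open>\<phi>\<close> on \<open>V\<close>, continuous because \<open>\<phi>\<close> is
          open. Multiplication by \<open>\<gamma>\<close> turns it into the inverse of
          \<open>fst\<close> on the sheet.\<close>
        define s where "s = (\<lambda>k. THE v. v \<in> V \<and> \<phi> v = f k)"
        have s_eq: "s k = v" if "v \<in> V" "\<phi> v = f k" for k v
          unfolding s_def using that inj by (intro the_equality) auto
        have s: "s k \<in> V" "\<phi> (s k) = f k" if "k \<in> ?T" for k
          using that s_eq by force+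
        have cs: "continuous_on ?T s"
        proof -
          have "openin (top_of_set ?T) (?T \<inter> s -` U)" if "openin (top_of_set (carrier G)) U" for U
          proof -
            have "?T \<inter> s -` U = {k \<in> K. f k \<in> \<phi> ` (V \<inter> U)}"
            proof (intro subset_antisym subsetI)
              fix k assume k: "k \<in> ?T \<inter> s -` U"
              then have "s k \<in> V \<inter> U" "f k = \<phi> (s k)" using s[of k] by auto
              then show "k \<in> {k \<in> K. f k \<in> \<phi> ` (V \<inter> U)}" using k by blast
            next
              fix k assume k: "k \<in> {k \<in> K. f k \<in> \<phi> ` (V \<inter> U)}"
              then obtain v where v: "v \<in> V" "v \<in> U" "\<phi> v = f k" by auto
              then have "s k \<in> U" using s_eq by simp
              then show "k \<in> ?T \<inter> s -` U" using k by blast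
            qed
            moreover have "openin (top_of_set K) {k \<in> K. f k \<in> \<phi> ` (V \<inter> U)}"
              using openT that V by blast
            ultimately have "openin (top_of_set K) (?T \<inter> s -` U)" by simp
            then show ?thesis
              by (rule openin_subset_trans) simp_all
          qed
          moreover have "s \<in> ?T \<rightarrow> carrier G" using s VG by auto
          ultimately show ?thesis using continuous_on_open_gen by blast
        qed
        have "homeomorphism u ?T fst (\<lambda>k. (k, s k \<otimes> \<gamma>))"
          unfolding homeomorphism_def
        proof (intro conjI ballI)
          have uT: "fst p \<in> ?T \<and> s (fst p) = snd p \<otimes> inv \<gamma>" if "p \<in> u" for p
          proof -
            have p: "p \<in> ?C" "snd p \<otimes> inv \<gamma> \<in> V" using that g by auto
            moreover have "\<phi> (snd p \<otimes> inv \<gamma>) = f (fst p)"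
              using p phi_shift invG g by auto
            moreover from this have "f (fst p) \<in> \<phi> ` V" using p(2) by (metis imageI)
            ultimately show ?thesis using s_eq by auto
          qed
          have Tu: "(k, s k \<otimes> \<gamma>) \<in> u" if "k \<in> ?T" for k
          proof -
            have "s k \<in> carrier G" using s(1)[OF that] VG by blast
            then show ?thesis
              using s[OF that] that gc phi_shift[of "s k" \<gamma>] g by (simp add: m_assoc)
          qed
          show "fst ` u = ?T"
          proof (intro subset_antisym subsetI)
            show "k \<in> ?T" if "k \<in> fst ` u" for k using that uT by blast
            show "k \<in> fst ` u" if "k \<in> ?T" for k using Tu[OF that] by (metis fst_conv imageI)
          qed
          show "(\<lambda>k. (k, s k \<otimes> \<gamma>)) (fst p) = p" if "p \<in> u" for p
            using uT[OF that] that g gc by (auto simp: m_assoc)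
          show "continuous_on u fst" by (intro continuous_intros)
          show "fst (k, s k \<otimes> \<gamma>) = k" for k by simp
          show "(\<lambda>k. (k, s k \<otimes> \<gamma>)) ` ?T = u"
          proof
            show "(\<lambda>k. (k, s k \<otimes> \<gamma>)) ` ?T \<subseteq> u" using Tu by auto
            show "u \<subseteq> (\<lambda>k. (k, s k \<otimes> \<gamma>)) ` ?T"
            proof
              fix p assume p: "p \<in> u"
              have "p = (\<lambda>k. (k, s k \<otimes> \<gamma>)) (fst p)"
                using uT[OF p] p g gc by (auto simp: m_assoc)
              then show "p \<in> (\<lambda>k. (k, s k \<otimes> \<gamma>)) ` ?T" using uT[OF p] by blast
            qed
          qed
          show "continuous_on ?T (\<lambda>k. (k, s k \<otimes> \<gamma>))"
            using s VG by (intro continuous_intros continuous_on_compose2[OF continuous_right_mult[OF gc] cs]) auto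
        qed
        then show "\<exists>q. homeomorphism u ?T fst q" by blast
      qed
    qed
  qed
  have "fst ` ?C = K"
  proof
    show "K \<subseteq> fst ` ?C"
    proof
      fix k assume k: "k \<in> K"
      then obtain g where "g \<in> carrier G" "f k = \<phi> g" using fX proj_onto by (metis imageE)
      then have "(k, g) \<in> ?C" using k by simp
      then show "k \<in> fst ` ?C" by force
    qed
  qed auto
  then show ?thesis
    unfolding covering_space_def using sheets by (intro conjI ballI continuous_intros) assumption+
qed

text \<open>A section of the pullback is a lift of the identity of \<open>K\<close>, which exists
  since \<open>K\<close> is simply connected.\<close>

lemma lift_exists:
  fixes K :: "'k::euclidean_space set"
  assumes f: "continuous_map (top_of_set K) X f"
    and K: "simply_connected K" "locally path_connected K"
    and z: "z \<in> K" "a \<in> carrier G" "\<phi> a = f z"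
  obtains g where "continuous_on K g" "g ` K \<subseteq> carrier G" "g z = a" "\<And>k. k \<in> K \<Longrightarrow> \<phi> (g k) = f k"
proof -
  let ?C = "{(k, g). k \<in> K \<and> g \<in> carrier G \<and> f k = \<phi> g}"
  obtain g where g: "continuous_on K g" "g \<in> K \<rightarrow> ?C" "g z = (z, a)" "\<And>y. y \<in> K \<Longrightarrow> fst (g y) = y"
    using covering_space_lift_strong[OF covering_space_pullback[OF f], of "(z, a)" z K "\<lambda>x. x"]
      K z by (auto simp: continuous_on_id)
  show thesis
  proof
    show "continuous_on K (\<lambda>k. snd (g k))" using g by (intro continuous_intros)
    show "(\<lambda>k. snd (g k)) ` K \<subseteq> carrier G" "\<And>k. k \<in> K \<Longrightarrow> \<phi> (snd (g k)) = f k"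
      using g by (auto simp: Pi_iff split_beta)
    show "snd (g z) = a" using g by simp
  qed
qed

lemma lift_unique:
  fixes K :: "'k::euclidean_space set"
  assumes g: "continuous_on K g" "g ` K \<subseteq> carrier G" and h: "continuous_on K h" "h ` K \<subseteq> carrier G"
    and eq: "\<And>k. k \<in> K \<Longrightarrow> \<phi> (g k) = \<phi> (h k)" and K: "connected K" and z: "z \<in> K" "g z = h z" "k \<in> K"
  shows "g k = h k"
proof -
  have f: "continuous_map (top_of_set K) X (\<lambda>k. \<phi> (g k))"
    using continuous_map_compose[OF _ proj_continuous, of "top_of_set K" g] g
    by (auto simp: o_def)
  let ?C = "{(k, h). k \<in> K \<and> h \<in> carrier G \<and> \<phi> (g k) = \<phi> h}"
  have "(k, g k) = (k, h k)"
  proof (rule covering_space_lift_unique[OF covering_space_pullback[OF f],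
        of "\<lambda>k. (k, g k)" z "\<lambda>k. (k, h k)" K "\<lambda>k. k" k])
    show "(z, g z) = (z, h z)" using z by simp
    show "(\<lambda>k. (k, g k)) \<in> K \<rightarrow> ?C" "(\<lambda>k. (k, h k)) \<in> K \<rightarrow> ?C" using g h eq by auto
  qed (use g h K z in \<open>auto intro!: continuous_on_Pair continuous_on_id\<close>)
  then show ?thesis by simp
qed

end

section \<open>Loops and their homotopy classes in an abstract topology\<close>

lemma loop_homotopic_refl: "p \<in> loops_at X x \<Longrightarrow> loop_homotopic X x p p"
  by (simp add: loop_homotopic_def loops_at_def pathin_def)

lemma loop_homotopic_sym: "loop_homotopic X x p q \<Longrightarrow> loop_homotopic X x q p"
  by (simp add: loop_homotopic_def homotopic_with_symD)

lemma loop_homotopic_trans: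
  "\<lbrakk>loop_homotopic X x p q; loop_homotopic X x q r\<rbrakk> \<Longrightarrow> loop_homotopic X x p r"
  unfolding loop_homotopic_def by (rule homotopic_with_trans)

lemma loop_homotopic_imp_loops:
  assumes "loop_homotopic X x p q"
  shows "p \<in> loops_at X x" "q \<in> loops_at X x"
  using homotopic_with_imp_continuous_maps[OF assms[unfolded loop_homotopic_def]]
    homotopic_with_imp_property[OF assms[unfolded loop_homotopic_def]]
  by (auto simp: loops_at_def pathin_def)

text \<open>Loops are functions on all reals, but lifts are controlled only on the unit interval.
  This lemma makes the values elsewhere irrelevant.\<close>

lemma loop_homotopic_eq:
  assumes "p \<in> loops_at X x" and eq: "\<And>t. t \<in> {0..1} \<Longrightarrow> p t = q t"
  shows "loop_homotopic X x p q"
proof -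
  have "continuous_map (top_of_set {0..1}) X p" "p 0 = x" "p 1 = x"
    using assms(1) by (auto simp: loops_at_def pathin_def)
  then show ?thesis
    unfolding loop_homotopic_def
    by (intro homotopic_with_equal) (simp_all add: eq[symmetric])
qed

lemma loop_class_eq_iff:
  assumes "p \<in> loops_at X x"
  shows "loop_class X x p = loop_class X x q \<longleftrightarrow> loop_homotopic X x p q"
proof
  assume "loop_class X x p = loop_class X x q"
  then have "p \<in> loop_class X x q"
    using loop_homotopic_refl[OF assms] by (auto simp: loop_class_def)
  then show "loop_homotopic X x p q" by (simp add: loop_class_def loop_homotopic_sym)
next
  assume pq: "loop_homotopic X x p q"
  show "loop_class X x p = loop_class X x q"
    unfolding loop_class_def
    using loop_homotopic_trans[OF pq] loop_homotopic_trans[OF loop_homotopic_sym[OF pq]]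
    by (intro Collect_cong iffI)
qed

lemma path_join_at: "\<lbrakk>path p; path q; p 1 = q 0\<rbrakk> \<Longrightarrow> path (p +++ q)"
  by (simp add: pathstart_def pathfinish_def)

lemma path_image_join_within:
  "\<lbrakk>p 1 = q 0; path_image p \<subseteq> S; path_image q \<subseteq> S\<rbrakk> \<Longrightarrow> path_image (p +++ q) \<subseteq> S"
  by (simp add: path_image_join pathstart_def pathfinish_def)

section \<open>The fundamental group of the quotient through lifted paths\<close>

context discrete_quotient
begin

text \<open>These are the lifts of loops that start at the identity; the end point in
  \<open>\<Gamma>\<close> records the deck transformation. Their classes under homotopy with fixed
  ends model the fundamental group of \<open>X\<close>, so the group axioms reduce to path algebra
  in \<open>G\<close>.\<close>

definition deck_paths :: "(real \<Rightarrow> 'e) set" where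
  "deck_paths = {c. path c \<and> path_image c \<subseteq> carrier G \<and> c 0 = \<one> \<and> c 1 \<in> \<Gamma>}"

lemma deck_pathsD:
  assumes "c \<in> deck_paths"
  shows "path c" "path_image c \<subseteq> carrier G" "c 0 = \<one>" "c 1 \<in> \<Gamma>" "c 1 \<in> carrier G"
    "t \<in> {0..1} \<Longrightarrow> c t \<in> carrier G"
  using assms deck_closed by (auto simp: deck_paths_def path_image_def)

lemma proj_mult_deck: "\<lbrakk>g \<in> carrier G; \<gamma> \<in> \<Gamma>\<rbrakk> \<Longrightarrow> \<phi> (g \<otimes> \<gamma>) = \<phi> g"
  using fibre[of g "g \<otimes> \<gamma>"] deck_closed by (simp add: m_assoc[symmetric])

lemma proj_deck: "\<gamma> \<in> \<Gamma> \<Longrightarrow> \<phi> \<gamma> = \<phi> \<one>"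
  using proj_mult_deck[of \<one> \<gamma>] deck_closed by simp

lemma proj_eq_base_iff: "g \<in> carrier G \<Longrightarrow> \<phi> g = \<phi> \<one> \<longleftrightarrow> g \<in> \<Gamma>"
  using fibre[of \<one> g] by auto

lemma proj_deck_path_loop:
  assumes "c \<in> deck_paths" shows "\<phi> \<circ> c \<in> loops_at X (\<phi> \<one>)"
proof -
  have "continuous_map (top_of_set {0..1}) (top_of_set (carrier G)) c"
    using deck_pathsD[OF assms] by (auto simp: path_def)
  from continuous_map_compose[OF this proj_continuous] show ?thesis
    using deck_pathsD[OF assms] proj_deck by (simp add: loops_at_def pathin_def)
qed

lemma loop_lifts:
  assumes "p \<in> loops_at X (\<phi> \<one>)"
  obtains c where "c \<in> deck_paths" "\<And>t. t \<in> {0..1} \<Longrightarrow> \<phi> (c t) = p t"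
proof -
  have p: "continuous_map (top_of_set {0..1}) X p" "p 0 = \<phi> \<one>" "p 1 = \<phi> \<one>"
    using assms by (auto simp: loops_at_def pathin_def)
  obtain c where c: "continuous_on {0..1} c" "c ` {0..1} \<subseteq> carrier G" "c 0 = \<one>"
      "\<And>t. t \<in> {0..1} \<Longrightarrow> \<phi> (c t) = p t"
    by (rule lift_exists[OF p(1), of 0 \<one>])
       (use p in \<open>auto simp: convex_imp_simply_connected convex_imp_locally_path_connected\<close>)
  have "c 1 \<in> \<Gamma>" using proj_eq_base_iff[of "c 1"] c(2) c(4)[of 1] p(3) by (simp add: image_subset_iff)
  with c show thesis by (intro that[of c]) (auto simp: deck_paths_def path_def path_image_def)
qed

text \<open>One direction composes with \<open>\<phi>\<close>. For the other, the homotopy is lifted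
  over the square, and uniqueness of lifts identifies the four sides: two are \<open>c\<close> and
  \<open>d\<close>, the other two project to the base point and are therefore constant.\<close>

lemma loop_homotopic_proj_iff:
  assumes c: "c \<in> deck_paths" and d: "d \<in> deck_paths"
  shows "loop_homotopic X (\<phi> \<one>) (\<phi> \<circ> c) (\<phi> \<circ> d) \<longleftrightarrow> homotopic_paths (carrier G) c d"
proof
  assume "homotopic_paths (carrier G) c d"
  then have "homotopic_with (\<lambda>r. pathstart r = pathstart c \<and> pathfinish r = pathfinish c)
      (top_of_set {0..1}) (top_of_set (carrier G)) c d"
    by (simp add: homotopic_paths_def)
  then show "loop_homotopic X (\<phi> \<one>) (\<phi> \<circ> c) (\<phi> \<circ> d)"
    unfolding loop_homotopic_def
    by (rule homotopic_with_compose_continuous_map_left[OF _ proj_continuous])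
       (use deck_pathsD[OF c] proj_deck in \<open>auto simp: pathstart_def pathfinish_def\<close>)
next
  assume "loop_homotopic X (\<phi> \<one>) (\<phi> \<circ> c) (\<phi> \<circ> d)"
  then obtain h where h: "continuous_map (prod_topology (top_of_set {0..1}) (top_of_set {0..1})) X h"
      "\<And>x. h (0, x) = \<phi> (c x)" "\<And>x. h (1, x) = \<phi> (d x)"
      "\<And>t. t \<in> {0..1::real} \<Longrightarrow> h (t, 0::real) = \<phi> \<one> \<and> h (t, 1) = \<phi> \<one>"
    unfolding loop_homotopic_def homotopic_with_def by (auto simp: o_def)
  let ?I = "{0..1::real}"
  let ?K = "?I \<times> ?I"
  have h1: "continuous_map (top_of_set ?K) X h"
    using h(1) by (simp add: prod_topology_subtopology_eu)
  obtain H where H: "continuous_on ?K H" "H ` ?K \<subseteq> carrier G" "H (0, 0) = \<one>"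
    "\<And>k. k \<in> ?K \<Longrightarrow> \<phi> (H k) = h k"
    by (rule lift_exists[OF h1, of "(0, 0)" \<one>])
       (use h(4)[of 0] in \<open>auto simp: convex_imp_simply_connected convex_imp_locally_path_connected convex_Times\<close>)
  have HG: "H (s, t) \<in> carrier G" if "s \<in> ?I" "t \<in> ?I" for s t using H(2) that by auto
  have contH: "continuous_on ?I (\<lambda>x. H (f x))" if "continuous_on ?I f" "f ` ?I \<subseteq> ?K" for f
    using continuous_on_compose2[OF H(1) that] .
  have H0: "H (0, t) = c t" if "t \<in> ?I" for t
    by (rule lift_unique[of ?I "\<lambda>t. H (0, t)" c 0])
       (use that H h deck_pathsD[OF c] HG in \<open>auto simp: path_def path_image_def image_subset_iff
          intro!: contH continuous_intros\<close>)
  have Hs0: "H (s, 0) = \<one>" if "s \<in> ?I" for s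
    by (rule lift_unique[of ?I "\<lambda>s. H (s, 0)" "\<lambda>_. \<one>" 0])
       (use that H h HG in \<open>auto simp: image_subset_iff intro!: contH continuous_intros\<close>)
  have Hs1: "H (s, 1) = c 1" if "s \<in> ?I" for s
    by (rule lift_unique[of ?I "\<lambda>s. H (s, 1)" "\<lambda>_. c 1" 0])
       (use that H h HG H0[of 1] deck_pathsD[OF c] proj_deck in
          \<open>auto simp: image_subset_iff intro!: contH continuous_intros\<close>)
  have H1: "H (1, t) = d t" if "t \<in> ?I" for t
    by (rule lift_unique[of ?I "\<lambda>t. H (1, t)" d 0])
       (use that H h deck_pathsD[OF d] HG Hs0[of 1] in \<open>auto simp: path_def path_image_def image_subset_iff
          intro!: contH continuous_intros\<close>)
  show "homotopic_paths (carrier G) c d"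
    unfolding homotopic_paths
    by (rule exI[of _ H]) (use H H0 H1 Hs0 Hs1 deck_pathsD[OF c] in \<open>auto simp: pathstart_def pathfinish_def\<close>)
qed

text \<open>The second path is translated on the right to start at \<open>c 1\<close>. Right
  multiplication by an element of \<open>\<Gamma>\<close> is invisible under \<open>\<phi>\<close>,
  so the projection is the usual concatenation. The new end point is
  \<open>d 1 \<otimes> c 1\<close>, in reversed order.\<close>

definition deck_join :: "(real \<Rightarrow> 'e) \<Rightarrow> (real \<Rightarrow> 'e) \<Rightarrow> real \<Rightarrow> 'e" where
  "deck_join c d = c +++ (\<lambda>t. d t \<otimes> c 1)"

lemma path_translate:
  assumes "path c" "path_image c \<subseteq> carrier G" "a \<in> carrier G"
  shows "path (\<lambda>t. c t \<otimes> a)" "path_image (\<lambda>t. c t \<otimes> a) \<subseteq> carrier G"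
  using path_continuous_image[OF assms(1), of "\<lambda>x. x \<otimes> a"] assms
    continuous_on_subset[OF continuous_right_mult[OF assms(3)] assms(2)]
  by (auto simp: o_def path_image_def)

lemma deck_join_in:
  assumes "c \<in> deck_paths" "d \<in> deck_paths" shows "deck_join c d \<in> deck_paths"
proof -
  note C = deck_pathsD[OF assms(1)] and D = deck_pathsD[OF assms(2)]
  note P = path_translate[OF D(1,2) C(5)]
  have "d 1 \<otimes> c 1 \<in> \<Gamma>" using C D subgroup subgroup.m_closed by metis
  then show ?thesis
    unfolding deck_paths_def deck_join_def using C D P
    by (intro CollectI conjI path_join_imp subset_path_image_join)
      (simp_all add: pathstart_def pathfinish_def, simp_all add: joinpaths_def)
qed

lemma proj_deck_join:
  assumes "c \<in> deck_paths" "d \<in> deck_paths" "t \<in> {0..1}"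
  shows "\<phi> (deck_join c d t) = loop_join (\<phi> \<circ> c) (\<phi> \<circ> d) t"
  using deck_pathsD[OF assms(1)] deck_pathsD(6)[OF assms(2), of "2 * t - 1"] assms(3)
  by (auto simp: deck_join_def joinpaths_def loop_join_def proj_mult_deck)

lemma deck_join_homotopic:
  assumes "c \<in> deck_paths" "d \<in> deck_paths" "c' \<in> deck_paths" "d' \<in> deck_paths"
    "homotopic_paths (carrier G) c c'" "homotopic_paths (carrier G) d d'"
  shows "homotopic_paths (carrier G) (deck_join c d) (deck_join c' d')"
proof -
  have eq: "c 1 = c' 1" using homotopic_paths_imp_pathfinish[OF assms(5)] by (simp add: pathfinish_def)
  have "homotopic_paths (carrier G) (\<lambda>t. d t \<otimes> c 1) (\<lambda>t. d' t \<otimes> c 1)"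
    using homotopic_paths_continuous_image[OF assms(6) continuous_right_mult, of "c 1" "carrier G"]
      deck_pathsD[OF assms(1)] by (auto simp: o_def)
  then show ?thesis
    unfolding deck_join_def eq[symmetric]
    using assms(5) deck_pathsD[OF assms(1)] deck_pathsD[OF assms(2)]
    by (intro homotopic_paths_join) (auto simp: pathstart_def pathfinish_def)
qed

definition deck_class :: "(real \<Rightarrow> 'e) \<Rightarrow> (real \<Rightarrow> 'b) set" where
  "deck_class c = loop_class X (\<phi> \<one>) (\<phi> \<circ> c)"

lemma deck_class_eq_iff:
  "\<lbrakk>c \<in> deck_paths; d \<in> deck_paths\<rbrakk> \<Longrightarrow> deck_class c = deck_class d \<longleftrightarrow> homotopic_paths (carrier G) c d"
  unfolding deck_class_def
  by (simp add: loop_class_eq_iff proj_deck_path_loop loop_homotopic_proj_iff)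

lemma carrier_fundamental_group:
  "carrier (fundamental_group X (\<phi> \<one>)) = deck_class ` deck_paths"
proof (intro subset_antisym subsetI)
  fix A assume "A \<in> carrier (fundamental_group X (\<phi> \<one>))"
  then obtain p where p: "p \<in> loops_at X (\<phi> \<one>)" "A = loop_class X (\<phi> \<one>) p"
    by (auto simp: fundamental_group_def)
  from loop_lifts[OF p(1)] obtain c where c: "c \<in> deck_paths" "\<And>t. t \<in> {0..1} \<Longrightarrow> \<phi> (c t) = p t"
    by blast
  have "loop_homotopic X (\<phi> \<one>) p (\<phi> \<circ> c)"
    by (rule loop_homotopic_eq[OF p(1)]) (use c in auto)
  then have "A = deck_class c"
    using p by (simp add: deck_class_def loop_class_eq_iff)
  then show "A \<in> deck_class ` deck_paths" using c by blast
qed (auto simp: fundamental_group_def deck_class_def proj_deck_path_loop)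

lemma mult_deck_class:
  assumes c: "c \<in> deck_paths" and d: "d \<in> deck_paths"
  shows "deck_class c \<otimes>\<^bsub>fundamental_group X (\<phi> \<one>)\<^esub> deck_class d = deck_class (deck_join c d)"
proof -
  let ?h = "loop_homotopic X (\<phi> \<one>)"
  \<comment> \<open>The product of classes ranges over all pairs of representatives, so arbitrary
    \<open>p\<close> and \<open>q\<close> are lifted and compared with \<open>c\<close> and
    \<open>d\<close> upstairs.\<close>
  have *: "?h (loop_join p q) (\<phi> \<circ> deck_join c d)" if pq: "?h (\<phi> \<circ> c) p" "?h (\<phi> \<circ> d) q" for p q
  proof -
    obtain c' where c': "c' \<in> deck_paths" "\<And>t. t \<in> {0..1} \<Longrightarrow> \<phi> (c' t) = p t"
      using loop_lifts[OF loop_homotopic_imp_loops(2)[OF pq(1)]] by blast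
    obtain d' where d': "d' \<in> deck_paths" "\<And>t. t \<in> {0..1} \<Longrightarrow> \<phi> (d' t) = q t"
      using loop_lifts[OF loop_homotopic_imp_loops(2)[OF pq(2)]] by blast
    have "?h (\<phi> \<circ> c') p" "?h (\<phi> \<circ> d') q"
      using c' d' by (auto intro!: loop_homotopic_eq proj_deck_path_loop)
    then have "?h (\<phi> \<circ> c) (\<phi> \<circ> c')" "?h (\<phi> \<circ> d) (\<phi> \<circ> d')"
      using pq loop_homotopic_sym loop_homotopic_trans by metis+
    then have "homotopic_paths (carrier G) (deck_join c d) (deck_join c' d')"
      using loop_homotopic_proj_iff c d c' d' deck_join_homotopic by simp
    then have 1: "?h (\<phi> \<circ> deck_join c d) (\<phi> \<circ> deck_join c' d')"
      using loop_homotopic_proj_iff c d c' d' deck_join_in by simp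
    have 2: "?h (\<phi> \<circ> deck_join c' d') (loop_join p q)"
    proof (rule loop_homotopic_eq)
      show "\<phi> \<circ> deck_join c' d' \<in> loops_at X (\<phi> \<one>)"
        using c' d' deck_join_in proj_deck_path_loop by blast
      show "(\<phi> \<circ> deck_join c' d') t = loop_join p q t" if "t \<in> {0..1}" for t
        using proj_deck_join[OF c'(1) d'(1) that] c'(2)[of "2*t"] d'(2)[of "2*t-1"] that
        by (auto simp: loop_join_def)
    qed
    show ?thesis using loop_homotopic_sym[OF loop_homotopic_trans[OF 1 2]] .
  qed
  have self: "?h (\<phi> \<circ> c) (\<phi> \<circ> c)" "?h (\<phi> \<circ> d) (\<phi> \<circ> d)"
    using c d by (auto intro!: loop_homotopic_refl proj_deck_path_loop)
  have "{r. \<exists>p\<in>deck_class c. \<exists>q\<in>deck_class d. ?h (loop_join p q) r} = deck_class (deck_join c d)"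
  proof (intro subset_antisym subsetI)
    fix r assume "r \<in> {r. \<exists>p\<in>deck_class c. \<exists>q\<in>deck_class d. ?h (loop_join p q) r}"
    then obtain p q where "?h (\<phi> \<circ> c) p" "?h (\<phi> \<circ> d) q" "?h (loop_join p q) r"
      by (auto simp: deck_class_def loop_class_def)
    then show "r \<in> deck_class (deck_join c d)"
      using loop_homotopic_trans[OF loop_homotopic_sym[OF *]] by (auto simp: deck_class_def loop_class_def)
  next
    fix r assume "r \<in> deck_class (deck_join c d)"
    then have "?h (\<phi> \<circ> deck_join c d) r" by (simp add: deck_class_def loop_class_def)
    from loop_homotopic_trans[OF *[OF self] this]
    show "r \<in> {r. \<exists>p\<in>deck_class c. \<exists>q\<in>deck_class d. ?h (loop_join p q) r}"
      using self by (auto simp: deck_class_def loop_class_def)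
  qed
  then show ?thesis by (simp add: fundamental_group_def)
qed

lemma const_deck_path: "(\<lambda>_. \<one>) \<in> deck_paths"
  using subgroup by (auto simp: deck_paths_def path_def path_image_def subgroup.one_closed)

lemma one_fundamental_group: "\<one>\<^bsub>fundamental_group X (\<phi> \<one>)\<^esub> = deck_class (\<lambda>_. \<one>)"
  by (simp add: fundamental_group_def deck_class_def o_def)

text \<open>Translating by \<open>b 1\<close> and then by \<open>a 1\<close> is translating by their
  product, so both sides are bracketings of one concatenation in \<open>G\<close>.\<close>

lemma deck_join_assoc:
  assumes "a \<in> deck_paths" "b \<in> deck_paths" "c \<in> deck_paths"
  shows "homotopic_paths (carrier G) (deck_join (deck_join a b) c) (deck_join a (deck_join b c))"
proof -
  note A = deck_pathsD[OF assms(1)] and B = deck_pathsD[OF assms(2)] and C = deck_pathsD[OF assms(3)]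
  let ?b = "\<lambda>t. b t \<otimes> a 1" and ?c = "\<lambda>t. c t \<otimes> (b 1 \<otimes> a 1)"
  let ?c' = "\<lambda>t. (c t \<otimes> b 1) \<otimes> a 1"
  have ba: "b 1 \<otimes> a 1 \<in> carrier G" using A B by simp
  note Pb = path_translate[OF B(1,2) A(5)] and Pc = path_translate[OF C(1,2) ba]
  have e1: "deck_join (deck_join a b) c = (a +++ ?b) +++ ?c"
    by (simp add: deck_join_def joinpaths_def)
  have cc: "?c t = ?c' t" if "t \<in> {0..1}" for t
    using that A B C by (simp add: m_assoc)
  have "homotopic_paths (carrier G) ((a +++ ?b) +++ ?c) (a +++ (?b +++ ?c))"
    by (rule homotopic_paths_sym[OF homotopic_paths_assoc])
      (use A B C Pb Pc in \<open>auto simp: pathstart_def pathfinish_def\<close>)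
  moreover have "homotopic_paths (carrier G) (a +++ (?b +++ ?c)) (deck_join a (deck_join b c))"
  proof (rule homotopic_paths_eq)
    have bc: "path (?b +++ ?c)" "path_image (?b +++ ?c) \<subseteq> carrier G" "a 1 = (?b +++ ?c) 0"
      by (-, (rule path_join_at path_image_join_within; use A B C Pb Pc in simp)+)
        (use A B C in \<open>simp add: joinpaths_def\<close>)
    show "path (a +++ ?b +++ ?c)" "path_image (a +++ ?b +++ ?c) \<subseteq> carrier G"
      using path_join_at[OF A(1) bc(1,3)] path_image_join_within[OF bc(3) A(2) bc(2)] by simp_all
    show "(a +++ ?b +++ ?c) t = deck_join a (deck_join b c) t" if "t \<in> {0..1}" for t
      using that cc[of "2 * (2 * t - 1) - 1"] by (auto simp: deck_join_def joinpaths_def)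
  qed
  ultimately show ?thesis using e1 homotopic_paths_trans by metis
qed

lemma deck_join_left_one:
  assumes "c \<in> deck_paths"
  shows "homotopic_paths (carrier G) (deck_join (\<lambda>_. \<one>) c) c"
proof -
  note C = deck_pathsD[OF assms(1)]
  have "homotopic_paths (carrier G) (linepath \<one> \<one> +++ c) c"
    using homotopic_paths_lid[OF C(1,2)] C(3) by (simp add: pathstart_def)
  moreover have "homotopic_paths (carrier G) (linepath \<one> \<one> +++ c) (deck_join (\<lambda>_. \<one>) c)"
  proof (rule homotopic_paths_eq)
    show "path (linepath \<one> \<one> +++ c)" "path_image (linepath \<one> \<one> +++ c) \<subseteq> carrier G"
      by - (rule path_join_at path_image_join_within; use C in \<open>simp add: linepath_1'\<close>)+
    show "(linepath \<one> \<one> +++ c) t = deck_join (\<lambda>_. \<one>) c t" if "t \<in> {0..1}" for t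
      using that C(6)[of "2*t-1"] by (auto simp: deck_join_def joinpaths_def linepath_refl)
  qed
  ultimately show ?thesis using homotopic_paths_sym homotopic_paths_trans by metis
qed

text \<open>The reversed path starts at \<open>c 1\<close>; the right translation brings its start
  back to the identity.\<close>

definition deck_inverse :: "(real \<Rightarrow> 'e) \<Rightarrow> real \<Rightarrow> 'e" where
  "deck_inverse c = (\<lambda>t. c (1 - t) \<otimes> inv (c 1))"

lemma deck_inverse_in: "c \<in> deck_paths \<Longrightarrow> deck_inverse c \<in> deck_paths"
proof -
  assume c: "c \<in> deck_paths"
  note C = deck_pathsD[OF c]
  have "path (reversepath c)" "path_image (reversepath c) \<subseteq> carrier G" using C by auto
  from path_translate[OF this, of "inv (c 1)"]
  have "path (deck_inverse c)" "path_image (deck_inverse c) \<subseteq> carrier G"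
    using C by (auto simp: deck_inverse_def reversepath_def)
  moreover have "inv (c 1) \<in> \<Gamma>" using C subgroup subgroup.m_inv_closed by fast
  ultimately show ?thesis using C by (simp add: deck_paths_def deck_inverse_def)
qed

lemma deck_join_inverse:
  assumes "c \<in> deck_paths"
  shows "homotopic_paths (carrier G) (deck_join (deck_inverse c) c) (\<lambda>_. \<one>)"
proof -
  note C = deck_pathsD[OF assms(1)]
  let ?d = "\<lambda>t. c t \<otimes> inv (c 1)"
  note P = path_translate[OF C(1,2), of "inv (c 1)"]
  have "deck_join (deck_inverse c) c = reversepath ?d +++ ?d"
    using C by (simp add: deck_join_def deck_inverse_def reversepath_def joinpaths_def fun_eq_iff)
  moreover have "homotopic_paths (carrier G) (reversepath ?d +++ ?d) (linepath (pathfinish ?d) (pathfinish ?d))"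
    using homotopic_paths_linv P C by simp
  moreover have "linepath (pathfinish ?d) (pathfinish ?d) = (\<lambda>_. \<one>)"
    using C by (simp add: pathfinish_def linepath_refl fun_eq_iff)
  ultimately show ?thesis by simp
qed

lemma group_fundamental_group: "group (fundamental_group X (\<phi> \<one>))"
proof (rule groupI; unfold carrier_fundamental_group one_fundamental_group)
  let ?F = "fundamental_group X (\<phi> \<one>)"
  show "deck_class (\<lambda>_. \<one>) \<in> deck_class ` deck_paths" using const_deck_path by blast
  fix x y z assume "x \<in> deck_class ` deck_paths" "y \<in> deck_class ` deck_paths" "z \<in> deck_class ` deck_paths"
  then obtain a b c where abc: "a \<in> deck_paths" "b \<in> deck_paths" "c \<in> deck_paths"
    "x = deck_class a" "y = deck_class b" "z = deck_class c" by blast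
  show "x \<otimes>\<^bsub>?F\<^esub> y \<in> deck_class ` deck_paths"
    using abc by (simp add: mult_deck_class deck_join_in)
  show "x \<otimes>\<^bsub>?F\<^esub> y \<otimes>\<^bsub>?F\<^esub> z = x \<otimes>\<^bsub>?F\<^esub> (y \<otimes>\<^bsub>?F\<^esub> z)"
    using abc by (simp add: mult_deck_class deck_join_in deck_class_eq_iff deck_join_assoc)
next
  let ?F = "fundamental_group X (\<phi> \<one>)"
  fix x assume "x \<in> deck_class ` deck_paths"
  then obtain a where a: "a \<in> deck_paths" "x = deck_class a" by blast
  show "deck_class (\<lambda>_. \<one>) \<otimes>\<^bsub>?F\<^esub> x = x"
    using a by (simp add: mult_deck_class const_deck_path deck_join_in deck_class_eq_iff deck_join_left_one)
  show "\<exists>y\<in>deck_class ` deck_paths. y \<otimes>\<^bsub>?F\<^esub> x = deck_class (\<lambda>_. \<one>)"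
    using a by (intro bexI[of _ "deck_class (deck_inverse a)"])
      (simp_all add: mult_deck_class const_deck_path deck_join_in deck_class_eq_iff deck_join_inverse deck_inverse_in)
qed

text \<open>The end point of a joined path is the product in reversed order, so the end point map is
  an antihomomorphism and its inverse is the homomorphism. Surjectivity is the existence of a path
  in \<open>G\<close> from the identity to any element of \<open>\<Gamma>\<close>.\<close>

lemma fundamental_group_epi:
  assumes conn: "path_connected (carrier G)"
  obtains \<Phi> where "\<Phi> \<in> epi (fundamental_group X (\<phi> \<one>)) (G\<lparr>carrier := \<Gamma>\<rparr>)"
    "\<And>c. c \<in> deck_paths \<Longrightarrow> \<Phi> (deck_class c) = inv (c 1)"
proof -
  \<comment> \<open>The choice of a representative is harmless because homotopies of paths keep the
    end point.\<close>
  define \<Phi> where "\<Phi> A = inv ((SOME c. c \<in> deck_paths \<and> deck_class c = A) 1)" for A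
  have \<Phi>: "\<Phi> (deck_class c) = inv (c 1)" if c: "c \<in> deck_paths" for c
  proof -
    let ?d = "SOME d. d \<in> deck_paths \<and> deck_class d = deck_class c"
    have "?d \<in> deck_paths \<and> deck_class ?d = deck_class c"
      by (rule someI[of _ c]) (use c in simp)
    then have "homotopic_paths (carrier G) ?d c" using deck_class_eq_iff c by blast
    then have "?d 1 = c 1" using homotopic_paths_imp_pathfinish by (fastforce simp: pathfinish_def)
    then show ?thesis by (simp add: \<Phi>_def)
  qed
  have inv\<Gamma>: "inv \<gamma> \<in> \<Gamma>" if "\<gamma> \<in> \<Gamma>" for \<gamma>
    using subgroup that subgroup.m_inv_closed by fast
  have hom: "\<Phi> \<in> hom (fundamental_group X (\<phi> \<one>)) (G\<lparr>carrier := \<Gamma>\<rparr>)"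
  proof (rule homI; unfold carrier_fundamental_group)
    fix A assume "A \<in> deck_class ` deck_paths"
    then show "\<Phi> A \<in> carrier (G\<lparr>carrier := \<Gamma>\<rparr>)" using \<Phi> inv\<Gamma> deck_pathsD(4) by auto
  next
    fix A B assume "A \<in> deck_class ` deck_paths" "B \<in> deck_class ` deck_paths"
    then obtain c d where cd: "c \<in> deck_paths" "d \<in> deck_paths" "A = deck_class c" "B = deck_class d"
      by blast
    have "deck_join c d 1 = d 1 \<otimes> c 1" by (simp add: deck_join_def joinpaths_def)
    then show "\<Phi> (A \<otimes>\<^bsub>fundamental_group X (\<phi> \<one>)\<^esub> B) = \<Phi> A \<otimes>\<^bsub>G\<lparr>carrier := \<Gamma>\<rparr>\<^esub> \<Phi> B"
      using cd deck_pathsD(5) by (simp add: mult_deck_class \<Phi> deck_join_in inv_mult_group)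
  qed
  have "\<gamma> \<in> \<Phi> ` deck_class ` deck_paths" if g: "\<gamma> \<in> \<Gamma>" for \<gamma>
  proof -
    obtain c where "path c" "path_image c \<subseteq> carrier G" "pathstart c = \<one>" "pathfinish c = inv \<gamma>"
      using conn deck_closed[OF g] unfolding path_connected_def by (metis inv_closed one_closed)
    then have "c \<in> deck_paths" "c 1 = inv \<gamma>"
      using inv\<Gamma>[OF g] by (auto simp: deck_paths_def pathstart_def pathfinish_def)
    then have "\<Phi> (deck_class c) = \<gamma>" using \<Phi> deck_closed[OF g] by simp
    then show ?thesis using \<open>c \<in> deck_paths\<close> by blast
  qed
  moreover have "\<Phi> ` deck_class ` deck_paths \<subseteq> \<Gamma>" using \<Phi> inv\<Gamma> deck_pathsD(4) by auto
  ultimately have "\<Phi> ` carrier (fundamental_group X (\<phi> \<one>)) = carrier (G\<lparr>carrier := \<Gamma>\<rparr>)"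
    unfolding carrier_fundamental_group by auto
  then show thesis using that hom \<Phi> by (simp add: epi_def)
qed

text \<open>The loops \<open>\<omega> a\<close> represent the elements of the fundamental group of \<open>G\<close> at \<open>\<one>\<close>.\<close>

theorem group_extension_fundamental_group:
  assumes conn: "path_connected (carrier G)"
    and A: "group A" and C: "group C" and \<psi>: "\<psi> \<in> iso (G\<lparr>carrier := \<Gamma>\<rparr>) C"
    and loop: "\<And>a. a \<in> carrier A \<Longrightarrow> path (\<omega> a) \<and> path_image (\<omega> a) \<subseteq> carrier G \<and> \<omega> a 0 = \<one> \<and> \<omega> a 1 = \<one>"
    and mult: "\<And>a b. \<lbrakk>a \<in> carrier A; b \<in> carrier A\<rbrakk> \<Longrightarrow>
      homotopic_paths (carrier G) (\<omega> a +++ \<omega> b) (\<omega> (a \<otimes>\<^bsub>A\<^esub> b))"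
    and inj: "\<And>a b. \<lbrakk>a \<in> carrier A; b \<in> carrier A; homotopic_paths (carrier G) (\<omega> a) (\<omega> b)\<rbrakk> \<Longrightarrow> a = b"
    and surj: "\<And>c. \<lbrakk>path c; path_image c \<subseteq> carrier G; c 0 = \<one>; c 1 = \<one>\<rbrakk> \<Longrightarrow>
      \<exists>a\<in>carrier A. homotopic_paths (carrier G) c (\<omega> a)"
  shows "group_extension A (fundamental_group X (\<phi> \<one>)) C"
proof -
  let ?F = "fundamental_group X (\<phi> \<one>)"
  obtain \<Phi> where \<Phi>: "\<Phi> \<in> epi ?F (G\<lparr>carrier := \<Gamma>\<rparr>)"
    "\<And>c. c \<in> deck_paths \<Longrightarrow> \<Phi> (deck_class c) = inv (c 1)"
    using fundamental_group_epi[OF conn] by blast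
  interpret G': group "G\<lparr>carrier := \<Gamma>\<rparr>" using subgroup subgroup_imp_group by blast
  interpret C: group C by fact
  have one\<Gamma>: "\<one> \<in> \<Gamma>" using subgroup subgroup.one_closed by blast
  have \<omega>: "\<omega> a \<in> deck_paths" if "a \<in> carrier A" for a
    using loop[OF that] one\<Gamma> by (simp add: deck_paths_def)
  have join: "deck_join (\<omega> a) (\<omega> b) \<in> deck_paths \<and>
      homotopic_paths (carrier G) (deck_join (\<omega> a) (\<omega> b)) (\<omega> (a \<otimes>\<^bsub>A\<^esub> b))"
    if ab: "a \<in> carrier A" "b \<in> carrier A" for a b
  proof
    show "deck_join (\<omega> a) (\<omega> b) \<in> deck_paths" using \<omega> ab deck_join_in by blast
    have "homotopic_paths (carrier G) (\<omega> a +++ \<omega> b) (deck_join (\<omega> a) (\<omega> b))"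
    proof (rule homotopic_paths_eq)
      show "path (\<omega> a +++ \<omega> b)" "path_image (\<omega> a +++ \<omega> b) \<subseteq> carrier G"
        by - (rule path_join_at path_image_join_within; use loop[OF ab(1)] loop[OF ab(2)] in simp)+
      show "(\<omega> a +++ \<omega> b) t = deck_join (\<omega> a) (\<omega> b) t" if t: "t \<in> {0..1}" for t
      proof (cases "t \<le> 1 / 2")
        case False
        then have "\<omega> b (2 * t - 1) \<in> carrier G"
          using t deck_pathsD(6)[OF \<omega>[OF ab(2)]] by simp
        then show ?thesis
          using False loop[OF ab(1)] by (simp add: deck_join_def joinpaths_def)
      qed (simp add: deck_join_def joinpaths_def)
    qed
    then show "homotopic_paths (carrier G) (deck_join (\<omega> a) (\<omega> b)) (\<omega> (a \<otimes>\<^bsub>A\<^esub> b))"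
      using mult[OF ab] homotopic_paths_sym homotopic_paths_trans by metis
  qed
  let ?f = "\<lambda>a. deck_class (\<omega> a)"
  have f: "?f \<in> mon A ?F"
  proof -
    have "?f (a \<otimes>\<^bsub>A\<^esub> b) = ?f a \<otimes>\<^bsub>?F\<^esub> ?f b" if ab: "a \<in> carrier A" "b \<in> carrier A" for a b
    proof -
      have "a \<otimes>\<^bsub>A\<^esub> b \<in> carrier A" using A ab by (simp add: group.is_monoid monoid.m_closed)
      then show ?thesis
        using ab \<omega> join[OF ab] homotopic_paths_sym by (auto simp: mult_deck_class deck_class_eq_iff)
    qed
    moreover have "inj_on ?f (carrier A)"
      by (rule inj_onI) (use \<omega> inj in \<open>simp add: deck_class_eq_iff\<close>)
    ultimately show ?thesis
      using \<omega> by (auto simp: mon_def hom_def carrier_fundamental_group)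
  qed
  have \<psi>': "\<psi> \<in> hom (G\<lparr>carrier := \<Gamma>\<rparr>) C" "inj_on \<psi> \<Gamma>" "\<psi> ` \<Gamma> = carrier C"
    using \<psi> by (auto simp: iso_def bij_betw_def)
  have g: "\<psi> \<circ> \<Phi> \<in> epi ?F C"
    using \<Phi>(1) \<psi>'(1,3) unfolding epi_def by (auto simp: image_comp[symmetric] hom_def Pi_iff)
  have \<psi>1: "\<psi> \<one> = \<one>\<^bsub>C\<^esub>"
    using hom_one[OF \<psi>'(1) G'.is_group C] by simp
  have "?f ` carrier A = kernel ?F C (\<psi> \<circ> \<Phi>)"
  proof (intro subset_antisym subsetI)
    fix x assume "x \<in> ?f ` carrier A"
    then obtain a where a: "a \<in> carrier A" "x = ?f a" by blast
    then show "x \<in> kernel ?F C (\<psi> \<circ> \<Phi>)"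
      using \<omega> \<Phi>(2) loop \<psi>1 by (auto simp: kernel_def carrier_fundamental_group)
  next
    fix x assume "x \<in> kernel ?F C (\<psi> \<circ> \<Phi>)"
    then obtain c where c: "c \<in> deck_paths" "x = deck_class c" "\<psi> (inv (c 1)) = \<one>\<^bsub>C\<^esub>"
      using \<Phi>(2) by (auto simp: kernel_def carrier_fundamental_group)
    have "inv (c 1) \<in> \<Gamma>" using deck_pathsD(4)[OF c(1)] subgroup subgroup.m_inv_closed by fast
    then have "inv (c 1) = \<one>" using \<psi>' \<psi>1 one\<Gamma> c(3) by (metis inj_onD)
    then have "c 1 = \<one>" using deck_pathsD(5)[OF c(1)] by (metis inv_inv inv_one)
    \<comment> \<open>An element of the kernel is represented by a closed loop in \<open>G\<close>,
      and these are exhausted by the loops \<open>\<omega> a\<close>.\<close>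
    then obtain a where a: "a \<in> carrier A" "homotopic_paths (carrier G) c (\<omega> a)"
      using surj deck_pathsD[OF c(1)] by blast
    then show "x \<in> ?f ` carrier A" using c \<omega>[OF a(1)] by (intro image_eqI[of _ _ a]) (simp_all add: deck_class_eq_iff)
  qed
  then show ?thesis
    unfolding group_extension_def
    by (intro conjI exI[of _ ?f] exI[of _ "\<psi> \<circ> \<Phi>"] A C group_fundamental_group f g)
qed

end

section \<open>Loops in the rotation group\<close>

lemma continuous_on_matrix_mult [continuous_intros]:
  fixes f :: "'a::topological_space \<Rightarrow> real^'n^'m" and g :: "'a \<Rightarrow> real^'k^'n"
  assumes "continuous_on S f" "continuous_on S g"
  shows "continuous_on S (\<lambda>x. f x ** g x)"
  unfolding matrix_matrix_mult_def using assms by (intro continuous_intros)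

lemma continuous_on_matrix_vector_mult [continuous_intros]:
  fixes f :: "'a::topological_space \<Rightarrow> real^'n^'m" and g :: "'a \<Rightarrow> real^'n"
  assumes "continuous_on S f" "continuous_on S g"
  shows "continuous_on S (\<lambda>x. f x *v g x)"
  unfolding matrix_vector_mult_def using assms by (intro continuous_intros)

lemma continuous_on_transpose [continuous_intros]:
  fixes f :: "'a::topological_space \<Rightarrow> real^'n^'m"
  assumes "continuous_on S f"
  shows "continuous_on S (\<lambda>x. transpose (f x))"
  unfolding transpose_def using assms by (intro continuous_intros)

section \<open>Rotation matrices and rotations made of two reflections\<close>

definition SO :: "(real^'n^'n) set" where
  "SO = Collect rotation_matrix"

lemma SO_iff: "R \<in> SO \<longleftrightarrow> orthogonal_matrix R \<and> det R = 1"
  by (simp add: SO_def rotation_matrix_def)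

lemma SO_one [simp]: "mat 1 \<in> SO"
  by (simp add: SO_iff orthogonal_matrix_def)

lemma SO_mult: "\<lbrakk>A \<in> SO; B \<in> SO\<rbrakk> \<Longrightarrow> A ** B \<in> SO"
  by (simp add: SO_iff orthogonal_matrix_mul det_mul)

lemma SO_transpose: "A \<in> SO \<Longrightarrow> transpose A \<in> SO"
  by (simp add: SO_iff det_transpose)

lemma SO_transpose_mult: "A \<in> SO \<Longrightarrow> transpose A ** A = mat 1"
  and SO_mult_transpose: "A \<in> SO \<Longrightarrow> A ** transpose A = mat 1"
  by (simp_all add: SO_iff orthogonal_matrix_def)

lemma SO_inner: "A \<in> SO \<Longrightarrow> (A *v x) \<bullet> (A *v y) = x \<bullet> y"
  by (metis SO_transpose_mult dot_lmul_matrix matrix_vector_mul_assoc matrix_vector_mul_lid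
      transpose_matrix_vector transpose_transpose)

lemma SO_norm: "A \<in> SO \<Longrightarrow> norm (A *v x) = norm x"
  by (simp add: norm_eq_sqrt_inner SO_inner)

text \<open>The reflection in the hyperplane orthogonal to \<open>u\<close>, for \<open>u\<close> of
  any nonzero length. For \<open>u = 0\<close> the division by zero makes it the identity.\<close>

definition refl_mat :: "real^'n \<Rightarrow> real^'n^'n" where
  "refl_mat u = (\<chi> i j. (if i = j then 1 else 0) - 2 * u$i * u$j / (u \<bullet> u))"

lemma refl_mat_vec: "refl_mat u *v x = x - (2 * (u \<bullet> x) / (u \<bullet> u)) *\<^sub>R u"
proof -
  have "(\<Sum>j\<in>UNIV. ((if i = j then 1 else 0) - 2 * u$i * u$j / (u \<bullet> u)) * x$j)
      = x$i - (2 * (u \<bullet> x) / (u \<bullet> u)) * u$i" for i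
  proof -
    have "(\<Sum>j\<in>UNIV. ((if i = j then 1 else 0) - 2 * u$i * u$j / (u \<bullet> u)) * x$j)
        = (\<Sum>j\<in>UNIV. (if i = j then x$j else 0) - (2 * u$i / (u \<bullet> u)) * (u$j * x$j))"
      by (intro sum.cong) (auto simp: algebra_simps)
    also have "\<dots> = x$i - (2 * u$i / (u \<bullet> u)) * (u \<bullet> x)"
      unfolding inner_vec_def[of u x] by (simp add: sum_subtractf sum_distrib_left)
    finally show ?thesis by (simp add: algebra_simps)
  qed
  then show ?thesis
    by (simp add: vec_eq_iff matrix_vector_mult_def refl_mat_def)
qed

lemma transpose_refl_mat: "transpose (refl_mat u) = refl_mat u"
  by (simp add: transpose_def refl_mat_def vec_eq_iff mult.commute mult.left_commute)

lemma refl_mat_involution: "refl_mat u ** refl_mat u = mat 1"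
proof (cases "u = 0")
  case False
  have "refl_mat u *v (refl_mat u *v x) = x" for x
  proof -
    have "u \<bullet> (refl_mat u *v x) = - (u \<bullet> x)"
      using False by (simp add: refl_mat_vec inner_diff_right)
    then show ?thesis
      unfolding refl_mat_vec[of u "refl_mat u *v x"] by (simp add: refl_mat_vec)
  qed
  then show ?thesis by (simp add: matrix_eq matrix_vector_mul_assoc[symmetric])
qed (simp add: matrix_eq matrix_vector_mul_assoc[symmetric] refl_mat_vec)

lemma orthogonal_refl_mat: "orthogonal_matrix (refl_mat u)"
  by (simp add: orthogonal_matrix transpose_refl_mat refl_mat_involution)

lemma refl_mat_scale: "c \<noteq> 0 \<Longrightarrow> refl_mat (c *\<^sub>R u) = refl_mat u"
  by (cases "u = 0") (auto simp: matrix_eq refl_mat_vec field_simps)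

text \<open>The two reflections are conjugate by an orthogonal map taking \<open>u\<close> to
  \<open>v\<close>. Equality of the determinants suffices to give a product of two reflections
  determinant one.\<close>

lemma det_refl_mat_eq_unit:
  fixes u v :: "real^'n"
  assumes "norm u = 1" "norm v = 1"
  shows "det (refl_mat u) = det (refl_mat v)"
proof -
  obtain f where f: "orthogonal_transformation f" "f u = v"
    using orthogonal_transformation_exists_1[of u v] assms by metis
  let ?A = "matrix f"
  have A: "orthogonal_matrix ?A" "?A *v u = v" "\<And>x. ?A *v x = f x"
    using f orthogonal_transformation_matrix[of f] fun_cong[OF matrix_vector_mul(2)[OF orthogonal_transformation_linear[OF f(1)]]]
    by simp_all
  have "refl_mat v ** ?A = ?A ** refl_mat u"
  proof -
    have "v \<bullet> f x = u \<bullet> x" for x using f by (metis orthogonal_transformation_def)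
    moreover have "v \<bullet> v = u \<bullet> u" using f by (metis orthogonal_transformation_def)
    ultimately show ?thesis
      using f orthogonal_transformation_linear[OF f(1)]
      by (simp add: matrix_eq matrix_vector_mul_assoc[symmetric] refl_mat_vec A linear_diff linear_scale)
  qed
  then have "det (refl_mat v) * det ?A = det ?A * det (refl_mat u)"
    by (metis det_mul)
  moreover have "det ?A \<noteq> 0" using det_orthogonal_matrix[OF A(1)] by auto
  ultimately show ?thesis by simp
qed

lemma det_refl_mat_eq:
  fixes u v :: "real^'n"
  assumes "u \<noteq> 0" "v \<noteq> 0"
  shows "det (refl_mat u) = det (refl_mat v)"
  using det_refl_mat_eq_unit[of "(1 / norm u) *\<^sub>R u" "(1 / norm v) *\<^sub>R v"] assms
  by (simp add: refl_mat_scale)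

text \<open>For unit vectors, the first reflection takes \<open>x\<close> to \<open>-x\<close> and
  the second takes \<open>-x\<close> to \<open>y\<close>. This is the rotation in the plane of
  \<open>x\<close> and \<open>y\<close>; it depends continuously on the pair away from antipodal
  points.\<close>

definition rot_to :: "real^'n \<Rightarrow> real^'n \<Rightarrow> real^'n^'n" where
  "rot_to x y = refl_mat (x + y) ** refl_mat x"

lemma rot_to_SO:
  assumes "x \<noteq> 0" "x + y \<noteq> 0" shows "rot_to x y \<in> SO"
proof -
  have "det (refl_mat x) * det (refl_mat x) = 1"
    by (metis det_I det_mul refl_mat_involution)
  then show ?thesis
    using det_refl_mat_eq[OF assms] orthogonal_matrix_mul[OF orthogonal_refl_mat orthogonal_refl_mat]
    by (simp add: SO_iff rot_to_def det_mul)
qed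

lemma rot_to_self: "rot_to x x = mat 1"
  using refl_mat_scale[of 2 x] by (simp add: rot_to_def scaleR_2 refl_mat_involution)

lemma rot_to_vec:
  assumes "norm x = 1" "norm y = 1" "x + y \<noteq> 0" shows "rot_to x y *v x = y"
proof -
  have 1: "x \<bullet> x = 1" "y \<bullet> y = 1" using assms by (simp_all add: dot_square_norm)
  have 2: "(x + y) \<bullet> (x + y) = 2 + 2 * (x \<bullet> y)"
    using 1 by (simp add: inner_add_left inner_add_right inner_commute)
  have 3: "2 + 2 * (x \<bullet> y) \<noteq> 0" using 2 assms(3) by (metis inner_eq_zero_iff)
  have "2 * ((x + y) \<bullet> x) = 2 + 2 * (x \<bullet> y)"
    using 1 by (simp add: inner_add_left inner_commute[of y x])
  then have "2 * ((x + y) \<bullet> x) / ((x + y) \<bullet> (x + y)) = 1"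
    using divide_self[OF 3] by (simp only: 2)
  then have "refl_mat (x + y) *v x = - y"
    by (simp only: refl_mat_vec scaleR_one) simp
  moreover have "refl_mat x *v x = - x"
    using 1 by (simp add: refl_mat_vec scaleR_2)
  ultimately show ?thesis
    using matrix_vector_mult_scaleR[of "refl_mat (x + y)" "-1" x]
    by (simp add: rot_to_def matrix_vector_mul_assoc[symmetric])
qed

text \<open>Such a \<open>z\<close> lies in both mirrors.\<close>

lemma rot_to_fixes: "\<lbrakk>x \<bullet> z = 0; y \<bullet> z = 0\<rbrakk> \<Longrightarrow> rot_to x y *v z = z"
  by (simp add: rot_to_def matrix_vector_mul_assoc[symmetric] refl_mat_vec inner_add_left)

lemma continuous_on_refl_mat:
  assumes "continuous_on S f" "\<And>s. s \<in> S \<Longrightarrow> f s \<noteq> 0"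
  shows "continuous_on S (\<lambda>s. refl_mat (f s))"
  unfolding refl_mat_def using assms by (intro continuous_intros) auto

lemma continuous_on_rot_to:
  assumes "continuous_on S f" "continuous_on S g" "\<And>s. s \<in> S \<Longrightarrow> f s \<noteq> 0" "\<And>s. s \<in> S \<Longrightarrow> f s + g s \<noteq> 0"
  shows "continuous_on S (\<lambda>s. rot_to (f s) (g s))"
  unfolding rot_to_def using assms by (intro continuous_intros continuous_on_refl_mat) auto

primrec transport :: "(real \<times> 'k \<Rightarrow> real^'n) \<Rightarrow> nat \<Rightarrow> ('k \<Rightarrow> real^'n^'n) \<Rightarrow> nat \<Rightarrow> real \<times> 'k \<Rightarrow> real^'n^'n" where
  "transport h N F 0 p = F (snd p)"
| "transport h N F (Suc m) p =
    rot_to (h (min (fst p) (real m / N), snd p)) (h (min (fst p) (real (Suc m) / N), snd p)) ** transport h N F m p"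

lemma unit_add_neq_zero:
  assumes "norm (x::'a::real_normed_vector) = 1" "dist x y < 2" shows "x + y \<noteq> 0"
proof
  assume "x + y = 0"
  then have "y = - x" by (simp add: eq_neg_iff_add_eq_0 add.commute)
  then have "dist x y = norm (2 *\<^sub>R x)" by (simp add: dist_norm scaleR_2)
  then show False using assms by simp
qed

text \<open>Homotopy lifting for the map that sends a rotation to the image of \<open>e\<close>. Two
  extra clauses carry the later use: over a stationary point the lift is stationary, which keeps the
  ends of a loop fixed, and vectors orthogonal to the motion stay fixed, which preserves axes
  already straightened.\<close>

lemma sphere_lift:
  fixes h :: "real \<times> 'k::metric_space \<Rightarrow> real^'n" and e :: "real^'n"
  assumes K: "compact K" and h: "continuous_on ({0..1} \<times> K) h"
    and unit: "\<And>p. p \<in> {0..1} \<times> K \<Longrightarrow> norm (h p) = 1"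
    and F: "continuous_on K F" "F ` K \<subseteq> SO" "\<And>k. k \<in> K \<Longrightarrow> F k *v e = h (0, k)"
  obtains H where "continuous_on ({0..1} \<times> K) H" "H ` ({0..1} \<times> K) \<subseteq> SO"
    "\<And>s k. \<lbrakk>s \<in> {0..1}; k \<in> K\<rbrakk> \<Longrightarrow> H (s, k) *v e = h (s, k)"
    "\<And>k. k \<in> K \<Longrightarrow> H (0, k) = F k"
    "\<And>s k. \<lbrakk>s \<in> {0..1}; k \<in> K; \<And>s. s \<in> {0..1} \<Longrightarrow> h (s, k) = h (0, k)\<rbrakk> \<Longrightarrow> H (s, k) = F k"
    "\<And>s k z. \<lbrakk>s \<in> {0..1}; k \<in> K; F k *v z = z; \<And>s. s \<in> {0..1} \<Longrightarrow> h (s, k) \<bullet> z = 0\<rbrakk> \<Longrightarrow> H (s, k) *v z = z"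
proof -
  let ?D = "{0..1::real} \<times> K"
  have "uniformly_continuous_on ?D h"
    using K h by (intro compact_uniformly_continuous compact_Times) auto
  \<comment> \<open>The constant 2 is the diameter of the unit sphere: points at smaller distance
    are not antipodal, so \<open>rot_to\<close> applies to neighbouring sample points.\<close>
  then obtain d where d: "d > 0" "\<And>p q. \<lbrakk>p \<in> ?D; q \<in> ?D; dist p q < d\<rbrakk> \<Longrightarrow> dist (h p) (h q) < 2"
    unfolding uniformly_continuous_on_def by (metis dist_commute zero_less_numeral)
  obtain N :: nat where N: "N > 0" "1 / N < d"
    using d(1) by (metis nat_approx_posE of_nat_0_less_iff zero_less_Suc)
  let ?a = "\<lambda>m s. min s (real m / N)"
  have a: "?a m s \<in> {0..1}" if "s \<in> {0..1}" for m s using that by auto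
  have nz: "h (?a m s, k) + h (?a (Suc m) s, k) \<noteq> 0" "norm (h (?a m s, k)) = 1" "h (?a m s, k) \<noteq> 0"
    if "s \<in> {0..1}" "k \<in> K" for m s k
  proof -
    show n: "norm (h (?a m s, k)) = 1" using unit a[OF that(1)] that by simp
    then show "h (?a m s, k) \<noteq> 0" by auto
    have clamp: "\<bar>min s a - min s (a + b)\<bar> \<le> b" if "0 \<le> b" for a b :: real
      using that by (auto simp: min_def)
    have "real (Suc m) / N = real m / N + 1 / N" by (simp add: add_divide_distrib)
    then have "\<bar>?a m s - ?a (Suc m) s\<bar> \<le> 1 / N" using clamp[of "1 / N" "real m / N"] by simp
    then have "dist (?a m s, k) (?a (Suc m) s, k) < d"
      using N by (simp add: dist_prod_def dist_real_def)
    then have "dist (h (?a m s, k)) (h (?a (Suc m) s, k)) < 2"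
      using a[OF that(1)] that by (intro d) auto
    with n show "h (?a m s, k) + h (?a (Suc m) s, k) \<noteq> 0" by (rule unit_add_neq_zero)
  qed
  let ?T = "transport h N F"
  have inv: "?T m (s, k) \<in> SO \<and> ?T m (s, k) *v e = h (?a m s, k)" if "s \<in> {0..1}" "k \<in> K" for m s k
  proof (induction m)
    case 0
    have "?a 0 s = 0" using that by auto
    then show ?case using F that by auto
  next
    case (Suc m)
    then show ?case
      using nz[OF that, of m] nz(2)[OF that, of "Suc m"]
      by (simp add: SO_mult rot_to_SO matrix_vector_mul_assoc[symmetric] rot_to_vec)
  qed
  have cont: "continuous_on ?D (?T m)" for m
  proof (induction m)
    case 0
    have "continuous_on ?D (\<lambda>p. F (snd p))"
      by (rule continuous_on_compose2[OF F(1)]) (auto intro: continuous_intros)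
    then show ?case by (simp add: fun_eq_iff)
  next
    case (Suc m)
    have c: "continuous_on ?D (\<lambda>p. h (?a m (fst p), snd p))" for m
      by (rule continuous_on_compose2[OF h]) (auto intro!: continuous_intros)
    show ?case
      unfolding transport.simps
      by (intro continuous_on_matrix_mult continuous_on_rot_to c Suc) (use nz in auto)
  qed
  show thesis
  proof (rule that[of "?T N"])
    show "continuous_on ?D (?T N)" by (rule cont)
    show "?T N ` ?D \<subseteq> SO" using inv by auto
    show "?T N (s, k) *v e = h (s, k)" if "s \<in> {0..1}" "k \<in> K" for s k
      using inv[OF that, of N] N that by auto
    \<comment> \<open>If all clamped samples coincide, every factor is \<open>rot_to x x\<close>.
      This covers both time zero and stationary points.\<close>
    have const: "?T m (s, k) = F k" if "\<And>n. h (?a n s, k) = h (0, k)" for s k m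
      by (induction m) (simp_all add: that[of "Suc _", simplified] that[simplified] rot_to_self)
    show "?T N (0, k) = F k" if "k \<in> K" for k
      by (rule const) simp
    show "?T N (s, k) = F k" if "s \<in> {0..1}" "k \<in> K" "\<And>s. s \<in> {0..1} \<Longrightarrow> h (s, k) = h (0, k)" for s k
      by (rule const) (use that a in blast)
    show "?T N (s, k) *v z = z"
      if "s \<in> {0..1}" "k \<in> K" "F k *v z = z" "\<And>s. s \<in> {0..1} \<Longrightarrow> h (s, k) \<bullet> z = 0" for s k z
    proof -
      have "?T m (s, k) *v z = z" for m
        using a[OF that(1)] that(4)
        by (induction m) (simp_all add: that(3) matrix_vector_mul_assoc[symmetric] rot_to_fixes del: of_nat_Suc)
      then show ?thesis .
    qed
  qed
qed

section \<open>Straightening rotations one axis after the other\<close>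

definition coord_sphere :: "'n set \<Rightarrow> (real^'n) set" where
  "coord_sphere I = {x. norm x = 1 \<and> (\<forall>i\<in>I. x$i = 0)}"

text \<open>The sphere is the relative frontier of the unit ball of a coordinate subspace. This
  makes the general results on frontiers of bounded convex sets applicable, with the dimension read
  off from the number of free axes.\<close>

lemma coord_sphere_rel_frontier:
  obtains S :: "(real^'n) set" where "convex S" "bounded S" "aff_dim S = int (card (- I))"
    "rel_frontier S = coord_sphere I"
proof
  let ?V = "{x::real^'n. \<forall>i. i \<notin> - I \<longrightarrow> x$i = 0}"
  have V: "subspace ?V" by (auto simp: subspace_def)
  have "0 \<in> interior (cball 0 1) \<inter> ?V" by simp
  then have ne: "interior (cball 0 1) \<inter> ?V \<noteq> {}" by blast
  show "convex (cball 0 1 \<inter> ?V)" using V by (simp add: convex_Int subspace_imp_convex)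
  show "bounded (cball 0 1 \<inter> ?V)" by (simp add: bounded_Int)
  have "aff_dim (?V \<inter> cball 0 1) = aff_dim ?V"
    using ne V by (intro aff_dim_convex_Int_nonempty_interior) (auto simp: subspace_imp_convex)
  then show "aff_dim (cball 0 1 \<inter> ?V) = int (card (- I))"
    using V dim_substandard_cart[of "- I", where 'a=real] by (simp add: aff_dim_subspace Int_commute dim_vec_eq)
  show "rel_frontier (cball 0 1 \<inter> ?V) = coord_sphere I"
    using convex_affine_rel_frontier_Int[OF convex_cball subspace_imp_affine[OF V] ne]
    by (auto simp: coord_sphere_def)
qed

lemma path_connected_coord_sphere: "card (- I) \<noteq> 1 \<Longrightarrow> path_connected (coord_sphere I)"
  by (rule coord_sphere_rel_frontier[of I]) (metis of_nat_eq_1_iff path_connected_sphere_gen)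

text \<open>The sphere has dimension \<open>card (- I) - 1\<close>, so the bound 3 excludes exactly
  the circle and below.\<close>

lemma simply_connected_coord_sphere: "card (- I) \<ge> 3 \<Longrightarrow> simply_connected (coord_sphere I)"
  by (rule coord_sphere_rel_frontier[of I]) (metis of_nat_le_iff of_nat_numeral simply_connected_sphere_gen)

definition SO_fix :: "'n set \<Rightarrow> (real^'n^'n) set" where
  "SO_fix I = {R \<in> SO. \<forall>i\<in>I. R *v axis i 1 = axis i 1}"

lemma SO_fix_subset: "SO_fix I \<subseteq> SO"
  by (auto simp: SO_fix_def)

lemma SO_fix_axis_in_sphere:
  assumes "R \<in> SO_fix I" "l \<notin> I" shows "R *v axis l 1 \<in> coord_sphere I"
proof -
  have R: "R \<in> SO" using assms by (simp add: SO_fix_def)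
  have "(R *v axis l 1) $ i = 0" if "i \<in> I" for i
  proof -
    have "(R *v axis l 1) $ i = (R *v axis l 1) \<bullet> (R *v axis i 1)"
      using assms that by (simp add: SO_fix_def inner_axis)
    also have "\<dots> = axis l 1 \<bullet> axis i (1::real)" using SO_inner[OF R] .
    finally show ?thesis using that assms by (auto simp: inner_axis_axis)
  qed
  then show ?thesis using SO_norm[OF R] by (simp add: coord_sphere_def norm_axis_1)
qed

text \<open>The image of the remaining axis is orthogonal to all fixed ones, so the matrix is
  diagonal, and the determinant forces the last diagonal entry to be one.\<close>

lemma SO_fix_all_but_one:
  assumes "R \<in> SO_fix (- {j})" shows "R = mat 1"
proof -
  have R: "R \<in> SO" "\<And>i. i \<noteq> j \<Longrightarrow> R *v axis i 1 = axis i 1" using assms by (auto simp: SO_fix_def)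
  have col: "R $ a $ b = (R *v axis b 1) $ a" for a b
    by (simp add: matrix_vector_mult_basis column_def)
  have off: "R $ a $ b = 0" if "a \<noteq> b" for a b
  proof (cases "b = j")
    case True
    then have "(R *v axis b 1) $ a = 0"
      using SO_fix_axis_in_sphere[OF assms, of b] that by (auto simp: coord_sphere_def)
    then show ?thesis by (simp add: col)
  next
    case False
    then show ?thesis using R(2)[OF False] that by (simp add: col axis_def)
  qed
  have diag: "R $ b $ b = 1" if "b \<noteq> j" for b
    using R(2)[OF that] by (simp add: col axis_def)
  have "det R = (\<Prod>i\<in>UNIV. R $ i $ i)" using off by (rule det_diagonal)
  also have "\<dots> = R $ j $ j * (\<Prod>i\<in>UNIV - {j}. R $ i $ i)" by (simp add: prod.remove)
  also have "\<dots> = R $ j $ j" using diag by simp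
  finally have "R $ j $ j = 1" using R by (simp add: SO_iff)
  then have "R $ a $ b = (if a = b then 1 else 0)" for a b
    using off diag by (cases "a = j") auto
  then show ?thesis by (simp add: vec_eq_iff mat_def)
qed

text \<open>A path on the sphere from the image of the axis \<open>l\<close> back to the axis lifts
  to a path of rotations. It stays orthogonal to the axes in \<open>I\<close>, which therefore
  remain fixed.\<close>

lemma SO_fix_path_step:
  assumes R: "R \<in> SO_fix I" and l: "l \<notin> I" and c: "card (- I) \<noteq> 1"
  obtains R' where "R' \<in> SO_fix (insert l I)" "path_component SO R R'"
proof -
  have "axis l 1 \<in> coord_sphere I" using l unfolding coord_sphere_def by (simp add: norm_axis_1) (auto simp: axis_def)
  then obtain g where g: "path g" "path_image g \<subseteq> coord_sphere I"
      "pathstart g = R *v axis l 1" "pathfinish g = axis l 1"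
    using path_connected_coord_sphere[OF c] SO_fix_axis_in_sphere[OF R l]
    unfolding path_connected_def by metis
  have gS: "g s \<in> coord_sphere I" if "s \<in> {0..1}" for s using g that by (auto simp: path_image_def)
  \<comment> \<open>Path lifting is the case of a parameter space with a single point.\<close>
  let ?D = "{0..1} \<times> {0::real}"
  obtain H where H: "continuous_on ?D H" "H ` ?D \<subseteq> SO"
    "\<And>s k. \<lbrakk>s \<in> {0..1}; k \<in> {0}\<rbrakk> \<Longrightarrow> H (s, k) *v axis l 1 = (g \<circ> fst) (s, k)"
    "\<And>k. k \<in> {0} \<Longrightarrow> H (0, k) = R"
    "\<And>s k z. \<lbrakk>s \<in> {0..1}; k \<in> {0}; R *v z = z; \<And>s. s \<in> {0..1} \<Longrightarrow> (g \<circ> fst) (s, k) \<bullet> z = 0\<rbrakk> \<Longrightarrow> H (s, k) *v z = z"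
  proof (rule sphere_lift[of "{0::real}" "g \<circ> fst" "\<lambda>_. R" "axis l 1"])
    show "continuous_on ?D (g \<circ> fst)"
      unfolding o_def
      by (rule continuous_on_compose2[OF g(1)[unfolded path_def]]) (auto intro!: continuous_intros)
  qed (use g gS R in \<open>auto simp: pathstart_def coord_sphere_def SO_fix_def\<close>)
  show thesis
  proof
    have "H (1, 0) *v axis l 1 = axis l 1" using H(3)[of 1 0] g by (simp add: pathfinish_def)
    moreover have "H (1, 0) *v axis i 1 = axis i 1" if "i \<in> I" for i
      using H(5)[of 1 0 "axis i 1"] gS R that by (auto simp: SO_fix_def coord_sphere_def inner_axis)
    ultimately show "H (1, 0) \<in> SO_fix (insert l I)" using H(2) by (auto simp: SO_fix_def)
    have "continuous_on {0..1} (\<lambda>s. H (s, 0))"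
      by (rule continuous_on_compose2[OF H(1)]) (auto intro!: continuous_intros)
    then show "path_component SO R (H (1, 0))"
      unfolding path_component_def using H(2,4)
      by (intro exI[of _ "\<lambda>s. H (s, 0)"]) (auto simp: path_def path_image_def pathstart_def pathfinish_def)
  qed
qed

lemma SO_fix_path_component:
  "R \<in> SO_fix I \<Longrightarrow> path_component SO R (mat 1)"
proof (induction "card (- I)" arbitrary: R I rule: less_induct)
  case less
  show ?case
  proof (cases "card (- I) \<le> 1")
    case True
    then obtain j where "- I \<subseteq> {j}"
      by (metis card_le_Suc0_iff_eq finite One_nat_def singletonI subsetI)
    then have "R = mat 1" using less.prems SO_fix_all_but_one[of R j] by (auto simp: SO_fix_def)
    then show ?thesis by (simp add: path_component_refl)
  next
    case False
    then obtain l where l: "l \<notin> I" by (metis ComplI card.empty equals0I zero_le_one ComplD)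
    then obtain R' where R': "R' \<in> SO_fix (insert l I)" "path_component SO R R'"
      using SO_fix_path_step[OF less.prems l] False by auto
    have "- insert l I \<subset> - I" using l by auto
    then have "card (- insert l I) < card (- I)" by (intro psubset_card_mono) auto
    from less.hyps[OF this R'(1)] R'(2) show ?thesis by (rule path_component_trans[rotated])
  qed
qed

lemma path_connected_SO: "path_connected SO"
proof -
  have "path_component SO R (mat 1)" if "R \<in> SO" for R
    using SO_fix_path_component[of R "{}"] that by (simp add: SO_fix_def)
  then show ?thesis
    unfolding path_connected_component by (meson path_component_sym path_component_trans)
qed

text \<open>The image of the axis \<open>l\<close> traces a loop on a simply connected sphere.
  Lifting its contraction deforms \<open>c\<close> until the axis stands still. The contraction is
  stationary at both ends of the loop, so the base point does not move.\<close>

lemma SO_loop_step: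
  assumes c: "path c" "\<And>t. t \<in> {0..1} \<Longrightarrow> c t \<in> SO_fix I" "c 0 = mat 1" "c 1 = mat 1"
    and l: "l \<notin> I" and d: "card (- I) \<ge> 3"
  obtains c' where "path c'" "\<And>t. t \<in> {0..1} \<Longrightarrow> c' t \<in> SO_fix (insert l I)" "c' 0 = mat 1" "c' 1 = mat 1"
    "homotopic_paths SO c c'"
proof -
  let ?I = "{0..1::real}"
  let ?g = "\<lambda>t. c t *v axis l 1"
  have g: "path ?g" "path_image ?g \<subseteq> coord_sphere I" "pathstart ?g = axis l 1" "pathfinish ?g = axis l 1"
    using c SO_fix_axis_in_sphere[OF c(2) l]
    by (auto simp: path_def path_image_def pathstart_def pathfinish_def intro!: continuous_intros)
  then have "homotopic_paths (coord_sphere I) ?g (linepath (axis l 1) (axis l 1))"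
    using simply_connected_coord_sphere[OF d] unfolding simply_connected_eq_contractible_path by metis
  then obtain h where h: "continuous_on (?I \<times> ?I) h" "h \<in> (?I \<times> ?I) \<rightarrow> coord_sphere I"
    "\<And>x. x \<in> ?I \<Longrightarrow> h (0, x) = ?g x" "\<And>x. x \<in> ?I \<Longrightarrow> h (1, x) = axis l 1"
    "\<And>t. t \<in> ?I \<Longrightarrow> h (t, 0) = axis l 1" "\<And>t. t \<in> ?I \<Longrightarrow> h (t, 1) = axis l 1"
    unfolding homotopic_paths using g(3,4)
    by (auto simp: linepath_refl) (auto simp: pathstart_def pathfinish_def)
  have hS: "h (s, t) \<in> coord_sphere I" if "s \<in> ?I" "t \<in> ?I" for s t using h(2) that by auto
  obtain H where H: "continuous_on (?I \<times> ?I) H" "H ` (?I \<times> ?I) \<subseteq> SO"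
    "\<And>s k. \<lbrakk>s \<in> ?I; k \<in> ?I\<rbrakk> \<Longrightarrow> H (s, k) *v axis l 1 = h (s, k)"
    "\<And>k. k \<in> ?I \<Longrightarrow> H (0, k) = c k"
    "\<And>s k. \<lbrakk>s \<in> ?I; k \<in> ?I; \<And>s. s \<in> ?I \<Longrightarrow> h (s, k) = h (0, k)\<rbrakk> \<Longrightarrow> H (s, k) = c k"
    "\<And>s k z. \<lbrakk>s \<in> ?I; k \<in> ?I; c k *v z = z; \<And>s. s \<in> ?I \<Longrightarrow> h (s, k) \<bullet> z = 0\<rbrakk> \<Longrightarrow> H (s, k) *v z = z"
  proof (rule sphere_lift[of ?I h c "axis l 1"])
    show "continuous_on ?I c" using c(1) by (simp add: path_def)
    show "c ` ?I \<subseteq> SO" using c(2) SO_fix_subset by blast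
    show "norm (h p) = 1" if "p \<in> ?I \<times> ?I" for p using h(2) that by (auto simp: coord_sphere_def)
  qed (use h in auto)
  have HS: "H (s, t) \<in> SO" if "s \<in> ?I" "t \<in> ?I" for s t using H(2) that by auto
  have H0: "H (s, 0) = mat 1" and H1: "H (s, 1) = mat 1" if "s \<in> ?I" for s
    using H(5)[OF that, of 0] H(5)[OF that, of 1] h(5,6) c(3,4) by simp_all
  show thesis
  proof
    show "path (\<lambda>t. H (1, t))"
      unfolding path_def by (rule continuous_on_compose2[OF H(1)]) (auto intro!: continuous_intros)
    show "H (1, 0) = mat 1" "H (1, 1) = mat 1" using H0 H1 by auto
    show "H (1, t) \<in> SO_fix (insert l I)" if t: "t \<in> ?I" for t
    proof -
      have "H (1, t) *v axis l 1 = axis l 1" using H(3)[of 1 t] h(4) t by simp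
      moreover have "H (1, t) *v axis i 1 = axis i 1" if "i \<in> I" for i
        using H(6)[of 1 t "axis i 1"] hS c(2)[OF t] that t
        by (auto simp: SO_fix_def coord_sphere_def inner_axis)
      ultimately show ?thesis using HS[of 1 t] t by (auto simp: SO_fix_def)
    qed
    show "homotopic_paths SO c (\<lambda>t. H (1, t))"
      unfolding homotopic_paths using H HS H0 H1 c(3,4)
      by (intro exI[of _ H]) (auto simp: pathstart_def pathfinish_def)
  qed
qed

text \<open>As long as an axis \<open>l\<close> other than \<open>i\<close> and \<open>j\<close> is
  free, there are at least three free axes and \<open>SO_loop_step\<close> applies. The reduction
  stops at the circle of rotations in the plane of \<open>i\<close> and \<open>j\<close>.\<close>

lemma SO_loop_reduce:
  fixes i j :: "'n::finite" and c :: "real \<Rightarrow> real^'n^'n"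
  assumes ij: "i \<noteq> j"
  shows "\<lbrakk>path c; \<And>t. t \<in> {0..1} \<Longrightarrow> c t \<in> SO_fix I; c 0 = mat 1; c 1 = mat 1; i \<notin> I; j \<notin> I\<rbrakk> \<Longrightarrow>
    \<exists>c'. path c' \<and> (\<forall>t\<in>{0..1}. c' t \<in> SO_fix (- {i, j})) \<and> c' 0 = mat 1 \<and> c' 1 = mat 1 \<and>
      homotopic_paths SO c c'"
proof (induction "card (- I)" arbitrary: c I rule: less_induct)
  case less
  show ?case
  proof (cases "- I = {i, j}")
    case True
    then have I: "I = - {i, j}" by auto
    have "homotopic_paths SO c c"
      using less.prems(1) subsetD[OF SO_fix_subset less.prems(2)] by (auto simp: path_image_def)
    then show ?thesis using less.prems unfolding I by blast
  next
    case False
    then obtain l where l: "l \<notin> I" "l \<noteq> i" "l \<noteq> j" using less.prems(5,6) by auto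
    have "card {l, i, j} \<le> card (- I)" using l less.prems(5,6) by (intro card_mono) auto
    then have "card (- I) \<ge> 3" using l ij by simp
    from SO_loop_step[OF less.prems(1-4) l(1) this]
    obtain d where d: "path d" "\<And>t. t \<in> {0..1} \<Longrightarrow> d t \<in> SO_fix (insert l I)" "d 0 = mat 1" "d 1 = mat 1"
      "homotopic_paths SO c d" by blast
    have "- insert l I \<subset> - I" using l by auto
    then have "card (- insert l I) < card (- I)" by (intro psubset_card_mono) auto
    from less.hyps[OF this d(1-4)] l less.prems(5,6) d(5) show ?thesis
      by (metis homotopic_paths_trans insertE)
  qed
qed

section \<open>Rotations of a coordinate plane\<close>

definition plane_rot :: "'n \<Rightarrow> 'n \<Rightarrow> real \<Rightarrow> real^'n^'n" where
  "plane_rot i j \<theta> = (\<chi> a b.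
     if a = i then (if b = i then cos \<theta> else if b = j then - sin \<theta> else 0)
     else if a = j then (if b = i then sin \<theta> else if b = j then cos \<theta> else 0)
     else if a = b then 1 else 0)"

lemma plane_rot_vec:
  assumes "i \<noteq> j"
  shows "(plane_rot i j \<theta> *v x) $ a =
    (if a = i then cos \<theta> * x$i - sin \<theta> * x$j else if a = j then sin \<theta> * x$i + cos \<theta> * x$j else x$a)"
proof -
  have two: "(\<Sum>b\<in>UNIV. (if b = i then c else if b = j then d else 0) * x$b) = c * x$i + d * x$j" for c d
  proof -
    have "(\<Sum>b\<in>UNIV. (if b = i then c else if b = j then d else 0) * x$b)
        = (\<Sum>b\<in>UNIV. (if b = i then c * x$b else 0) + (if b = j then d * x$b else 0))"
      using assms by (intro sum.cong) auto
    then show ?thesis by (simp add: sum.distrib)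
  qed
  have one: "(\<Sum>b\<in>UNIV. (if a = b then 1 else 0) * x$b) = x$a"
    by (simp add: if_distrib[of "\<lambda>c. c * _"] cong: if_cong)
  show ?thesis
    using two[of "cos \<theta>" "- sin \<theta>"] two[of "sin \<theta>" "cos \<theta>"] one
    by (simp add: matrix_vector_mult_def plane_rot_def)
qed

lemma plane_rot_0: "i \<noteq> j \<Longrightarrow> plane_rot i j 0 = mat 1"
  by (simp add: matrix_eq vec_eq_iff plane_rot_vec)

lemma plane_rot_add:
  "i \<noteq> j \<Longrightarrow> plane_rot i j (\<theta> + \<eta>) = plane_rot i j \<theta> ** plane_rot i j \<eta>"
  by (simp add: matrix_eq vec_eq_iff plane_rot_vec matrix_vector_mul_assoc[symmetric] cos_add sin_add algebra_simps)

lemma transpose_plane_rot: "i \<noteq> j \<Longrightarrow> transpose (plane_rot i j \<theta>) = plane_rot i j (- \<theta>)"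
  by (auto simp: transpose_def plane_rot_def vec_eq_iff)

text \<open>The determinant is the square of the determinant at half the angle, hence nonnegative,
  and it is one of \<open>1\<close> and \<open>-1\<close> by orthogonality.\<close>

lemma plane_rot_SO:
  assumes "i \<noteq> j" shows "plane_rot i j \<theta> \<in> SO"
proof -
  have o: "orthogonal_matrix (plane_rot i j \<theta>)"
    using assms plane_rot_add[OF assms, of "-\<theta>" \<theta>]
    by (simp add: orthogonal_matrix transpose_plane_rot plane_rot_0)
  have "det (plane_rot i j \<theta>) = det (plane_rot i j (\<theta> / 2)) * det (plane_rot i j (\<theta> / 2))"
    using plane_rot_add[OF assms, of "\<theta>/2" "\<theta>/2"] by (simp add: det_mul)
  then have "det (plane_rot i j \<theta>) \<ge> 0" by simp
  then show ?thesis using o det_orthogonal_matrix[OF o] by (auto simp: SO_iff)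
qed

lemma continuous_on_plane_rot [continuous_intros]:
  fixes f :: "'a::t2_space \<Rightarrow> real"
  assumes "continuous_on S f" shows "continuous_on S (\<lambda>s. plane_rot i j (f s))"
  unfolding plane_rot_def
proof (intro continuous_on_vec_lambda)
  fix a b
  show "continuous_on S (\<lambda>s. if a = i then if b = i then cos (f s) else if b = j then - sin (f s) else 0
        else if a = j then if b = i then sin (f s) else if b = j then cos (f s) else 0
        else if a = b then 1 else 0)"
    using assms by (cases "a = i"; cases "a = j"; cases "b = i"; cases "b = j"; cases "a = b")
      (auto intro!: continuous_intros)
qed

text \<open>Turning back by \<open>\<theta>\<close> also brings the axis \<open>i\<close> home. The
  product then fixes every axis but \<open>j\<close> and is the identity.\<close>

lemma SO_fix_plane:
  assumes ij: "i \<noteq> j" and R: "R \<in> SO_fix (- {i, j})"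
    and c: "(R *v axis i 1) $ i = cos \<theta>" "(R *v axis i 1) $ j = sin \<theta>"
  shows "R = plane_rot i j \<theta>"
proof -
  let ?P = "plane_rot i j (- \<theta>)"
  have off: "(R *v axis i 1) $ a = 0" if "a \<noteq> i" "a \<noteq> j" for a
    using SO_fix_axis_in_sphere[OF R, of i] that by (auto simp: coord_sphere_def)
  have cs: "cos \<theta> * cos \<theta> + sin \<theta> * sin \<theta> = 1" using sin_cos_squared_add3 by blast
  have "?P *v (R *v axis i 1) = axis i 1"
    using ij cs off c by (auto simp: vec_eq_iff plane_rot_vec axis_def)
  moreover have "?P *v (R *v axis k 1) = axis k 1" if "k \<noteq> i" "k \<noteq> j" for k
    using that ij R by (auto simp: SO_fix_def vec_eq_iff plane_rot_vec axis_def)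
  ultimately have "?P *v (R *v axis k 1) = axis k 1" if "k \<noteq> j" for k
    using that by (cases "k = i") auto
  then have "?P ** R \<in> SO_fix (- {j})"
    using R ij by (simp add: SO_fix_def SO_mult plane_rot_SO matrix_vector_mul_assoc[symmetric])
  then have "?P ** R = mat 1" by (rule SO_fix_all_but_one)
  then have "plane_rot i j \<theta> ** ?P ** R = plane_rot i j \<theta>"
    by (simp add: matrix_mul_assoc[symmetric])
  moreover have "plane_rot i j \<theta> ** ?P = mat 1"
    using plane_rot_add[OF ij, of \<theta> "- \<theta>"] ij by (simp add: plane_rot_0)
  ultimately show ?thesis by simp
qed

definition turns :: "'n \<Rightarrow> 'n \<Rightarrow> int \<Rightarrow> real \<Rightarrow> real^'n^'n" where
  "turns i j k t = plane_rot i j (2 * pi * k * t)"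

lemma plane_rot_periodic: "i \<noteq> j \<Longrightarrow> plane_rot i j (\<theta> + 2 * pi * of_int k) = plane_rot i j \<theta>"
  using cos_int_2pin[of k] sin_int_2pin[of k]
  by (simp add: matrix_eq vec_eq_iff plane_rot_vec cos_add sin_add)

lemma turns_loop:
  assumes "i \<noteq> j"
  shows "path (turns i j k)" "path_image (turns i j k) \<subseteq> SO" "turns i j k 0 = mat 1" "turns i j k 1 = mat 1"
  using assms plane_rot_periodic[of i j 0 k]
  by (auto simp: path_def path_image_def turns_def[abs_def] plane_rot_SO plane_rot_0 intro!: continuous_intros)

lemma homotopic_plane_rot:
  assumes ij: "i \<noteq> j" and "path a" "path b" "a 0 = b 0" "a 1 = b 1"
  shows "homotopic_paths SO (\<lambda>t. plane_rot i j (a t)) (\<lambda>t. plane_rot i j (b t))"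
proof -
  have "homotopic_paths UNIV a b"
    by (rule homotopic_paths_linear) (use assms in \<open>auto simp: pathstart_def pathfinish_def\<close>)
  from homotopic_paths_continuous_image[OF this, of "plane_rot i j" SO]
  show ?thesis using ij continuous_on_plane_rot[OF continuous_on_id, of UNIV i j]
    by (simp add: o_def plane_rot_SO)
qed

text \<open>Adding \<open>2 * pi * k\<close> to the angle of the second loop leaves the loop
  unchanged and makes the combined angle continuous. It then runs from \<open>0\<close> to
  \<open>2 * pi * (k + m)\<close> and can be straightened.\<close>

lemma turns_join:
  assumes ij: "i \<noteq> j"
  shows "homotopic_paths SO (turns i j k +++ turns i j m) (turns i j (k + m))"
proof -
  let ?a = "(\<lambda>t. 2 * pi * k * t) +++ (\<lambda>t. 2 * pi * m * t + 2 * pi * k)"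
  have "turns i j k +++ turns i j m = (\<lambda>t. plane_rot i j (?a t))"
    by (auto simp: fun_eq_iff joinpaths_def turns_def plane_rot_periodic[OF ij])
  moreover have "homotopic_paths SO (\<lambda>t. plane_rot i j (?a t)) (\<lambda>t. plane_rot i j (2 * pi * (k + m) * t))"
  proof (rule homotopic_plane_rot[OF ij])
    show "path ?a" by (rule path_join_at) (auto simp: path_def intro!: continuous_intros)
    show "path (\<lambda>t. 2 * pi * (k + m) * t)" by (auto simp: path_def intro!: continuous_intros)
  qed (simp_all add: joinpaths_def algebra_simps)
  ultimately show ?thesis by (simp add: turns_def[abs_def])
qed

text \<open>Once the loop lives in a single plane, it is given by its angle. A continuous choice of
  the angle exists on the interval, and its total increase counts the turns.\<close>

lemma SO_loop_homotopic_turns: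
  fixes c :: "real \<Rightarrow> real^'n^'n"
  assumes ij: "i \<noteq> j" and c: "path c" "path_image c \<subseteq> SO" "c 0 = mat 1" "c 1 = mat 1"
  obtains k where "homotopic_paths SO c (turns i j k)"
proof -
  obtain d where d: "path d" "\<And>t. t \<in> {0..1} \<Longrightarrow> d t \<in> SO_fix (- {i, j})" "d 0 = mat 1" "d 1 = mat 1"
      "homotopic_paths SO c d"
  proof -
    have "c t \<in> SO_fix {}" if "t \<in> {0..1}" for t
      using c(2) that by (auto simp: SO_fix_def path_image_def)
    from SO_loop_reduce[OF ij c(1) this c(3,4)] show thesis using that by auto
  qed
  define z where "z t = Complex ((d t *v axis i 1) $ i) ((d t *v axis i 1) $ j)" for t
  have contd: "continuous_on {0..1} d" using d(1) by (simp add: path_def)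
  have contz: "continuous_on {0..1} z"
    unfolding z_def Complex_eq by (intro continuous_intros contd)
  have nz: "norm (z t) = 1" if "t \<in> {0..1}" for t
  proof -
    let ?x = "d t *v axis i 1"
    have x: "?x \<in> coord_sphere (- {i, j})" using SO_fix_axis_in_sphere[OF d(2)[OF that], of i] by simp
    then have "?x \<bullet> ?x = 1" by (simp add: coord_sphere_def dot_square_norm)
    moreover have "?x \<bullet> ?x = (\<Sum>a\<in>{i, j}. ?x $ a * ?x $ a)"
      unfolding inner_vec_def inner_real_def using x by (intro sum.mono_neutral_right) (auto simp: coord_sphere_def)
    ultimately show ?thesis using ij by (simp add: z_def cmod_def power2_eq_square)
  qed
  \<comment> \<open>The image of the axis \<open>i\<close> is a point of the unit circle, and the
    continuous logarithm over the contractible interval supplies its angle.\<close>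
  obtain L where L: "continuous_on {0..1} L" "\<And>t. t \<in> {0..1} \<Longrightarrow> z t = exp (L t)"
    by (rule continuous_logarithm_on_contractible[OF contz])
      (use nz in \<open>force simp: convex_imp_contractible\<close>)+
  define \<theta> where "\<theta> t = Im (L t)" for t
  have ReL: "Re (L t) = 0" if "t \<in> {0..1}" for t using nz[OF that] L(2)[OF that] by simp
  have zc: "z t = Complex (cos (\<theta> t)) (sin (\<theta> t))" if "t \<in> {0..1}" for t
    using L(2)[OF that] ReL[OF that] by (simp add: \<theta>_def exp_eq_polar cis.ctr)
  have d\<theta>: "d t = plane_rot i j (\<theta> t)" if "t \<in> {0..1}" for t
    using SO_fix_plane[OF ij d(2)[OF that], of "\<theta> t"] zc[OF that] by (simp add: z_def)
  have cont\<theta>: "continuous_on {0..1} \<theta>" unfolding \<theta>_def using L(1) by (intro continuous_intros)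
  have endpoint: "cos (\<theta> t) = 1 \<and> sin (\<theta> t) = 0" if "t \<in> {0, 1}" for t
    using zc[of t] that d(3,4) ij by (auto simp: z_def axis_def)
  obtain m n :: int where mn: "\<theta> 0 = 2 * pi * m" "\<theta> 1 = 2 * pi * n"
    using endpoint[of 0] endpoint[of 1] by (metis cos_one_2pi_int insertCI mult.commute mult.assoc)
  \<comment> \<open>The chosen angle starts at some multiple \<open>2 * pi * m\<close> of the full
    turn, which has to be subtracted first.\<close>
  have "homotopic_paths SO d (turns i j (n - m))"
  proof -
    have "homotopic_paths SO (\<lambda>t. plane_rot i j (\<theta> t - 2 * pi * m)) (\<lambda>t. plane_rot i j (2 * pi * (n - m) * t))"
      by (rule homotopic_plane_rot[OF ij])
        (use cont\<theta> mn in \<open>auto simp: path_def algebra_simps intro!: continuous_intros\<close>)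
    moreover have "homotopic_paths SO d (\<lambda>t. plane_rot i j (\<theta> t - 2 * pi * m))"
    proof (rule homotopic_paths_eq)
      show "path d" by (rule d(1))
      show "path_image d \<subseteq> SO" using subsetD[OF SO_fix_subset d(2)] by (auto simp: path_image_def)
      show "d t = plane_rot i j (\<theta> t - 2 * pi * m)" if "t \<in> {0..1}" for t
        using d\<theta>[OF that] plane_rot_periodic[OF ij, of "\<theta> t" "- m"] by simp
    qed
    ultimately show ?thesis
      using homotopic_paths_trans by (fastforce simp: turns_def[abs_def])
  qed
  then show thesis using that d(5) homotopic_paths_trans by blast
qed

text \<open>Conjugating by the half turn in the plane of \<open>j\<close> and a third axis reverses the rotation.\<close>

lemma turns_reverse:
  assumes ij: "i \<noteq> j" and k: "k \<noteq> i" "k \<noteq> j"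
  shows "homotopic_paths SO (turns i j m) (turns i j (- m))"
proof -
  have jk: "j \<noteq> k" using k by simp
  let ?Q = "plane_rot j k"
  let ?h = "\<lambda>p. ?Q (pi * fst p) ** turns i j m (snd p) ** ?Q (- (pi * fst p))"
  have Q: "?Q a ** ?Q (- a) = mat 1" for a
    using plane_rot_add[OF jk, of a "-a"] jk by (simp add: plane_rot_0)
  have "?Q pi ** turns i j m t ** ?Q (- pi) = turns i j (- m) t" for t
    using ij k jk
    by (simp add: matrix_eq matrix_vector_mul_assoc[symmetric] turns_def vec_eq_iff plane_rot_vec)
  moreover have "continuous_on ({0..1} \<times> {0..1}) ?h"
    unfolding turns_def by (intro continuous_intros)
  ultimately show ?thesis
    unfolding homotopic_paths
    by (intro exI[of _ ?h])
      (use ij jk turns_loop[OF ij] in \<open>auto simp: turns_def[of i j m] plane_rot_0 SO_mult plane_rot_SO Q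
        pathstart_def pathfinish_def plane_rot_periodic[of i j 0, simplified]\<close>)
qed

text \<open>The last of the \<open>m + 2\<close> turns is replaced by its reverse, which cancels one
  more turn.\<close>

lemma turns_add_2:
  assumes ij: "i \<noteq> j" and k: "k \<noteq> i" "k \<noteq> j"
  shows "homotopic_paths SO (turns i j (m + 2)) (turns i j m)"
proof -
  let ?t = "turns i j"
  have "homotopic_paths SO (?t (m + 1) +++ ?t 1) (?t (m + 1) +++ ?t (-1))"
    using turns_loop[OF ij] turns_reverse[OF assms, of 1]
    by (intro homotopic_paths_join) (auto simp: pathstart_def pathfinish_def)
  moreover have "homotopic_paths SO (?t (m + 1) +++ ?t 1) (?t (m + 2))"
    "homotopic_paths SO (?t (m + 1) +++ ?t (-1)) (?t m)"
  proof -
    have "(m + 1) + 1 = m + 2" "(m + 1) + - 1 = m" by simp_all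
    then show "homotopic_paths SO (?t (m + 1) +++ ?t 1) (?t (m + 2))"
      "homotopic_paths SO (?t (m + 1) +++ ?t (-1)) (?t m)"
      using turns_join[OF ij, of "m + 1" 1] turns_join[OF ij, of "m + 1" "-1"] by metis+
  qed
  ultimately show ?thesis using homotopic_paths_trans homotopic_paths_sym by metis
qed

lemma turns_cong_mod_2:
  assumes ij: "i \<noteq> j" and k: "k \<noteq> i" "k \<noteq> j"
  shows "homotopic_paths SO (turns i j m) (turns i j (m mod 2))"
proof -
  have pos: "homotopic_paths SO (turns i j (m + 2 * int n)) (turns i j m)" for m n
  proof (induction n)
    case 0
    then show ?case using turns_loop[OF ij] by simp
  next
    case (Suc n)
    have "m + 2 * int (Suc n) = (m + 2 * int n) + 2" by simp
    then show ?case
      using homotopic_paths_trans[OF turns_add_2[OF assms, of "m + 2 * int n"] Suc] by (simp only:)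
  qed
  have eq: "m = m mod 2 + 2 * (m div 2)" by simp
  show ?thesis
  proof (cases "m div 2 \<ge> 0")
    case True
    then show ?thesis using pos[of "m mod 2" "nat (m div 2)"] by simp
  next
    case False
    then have "int (nat (- (m div 2))) = - (m div 2)" by linarith
    then have "m + 2 * int (nat (- (m div 2))) = m mod 2" using eq by linarith
    then show ?thesis using pos[of m "nat (- (m div 2))"] homotopic_paths_sym by metis
  qed
qed

section \<open>The spin covering\<close>

lemma bounded_bilinear_matrix_mult:
  "bounded_bilinear ((**) :: real^'n^'m \<Rightarrow> real^'k^'n \<Rightarrow> real^'k^'m)"
  by (subst bilinear_conv_bounded_bilinear[symmetric])
    (auto simp: bilinear_def matrix_matrix_mult_def vec_eq_iff sum.distrib algebra_simps sum_distrib_left intro!: linearI)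

interpretation mm: bounded_bilinear "(**) :: real^'n^'m \<Rightarrow> real^'k^'n \<Rightarrow> real^'k^'m"
  by (rule bounded_bilinear_matrix_mult)

lemma transpose_scaleR: "transpose (c *\<^sub>R A) = c *\<^sub>R transpose (A :: real^'n^'m)"
  by (simp add: transpose_def vec_eq_iff)

lemma transpose_add: "transpose (A + B) = transpose A + transpose (B :: real^'n^'m)"
  by (simp add: transpose_def vec_eq_iff)

section \<open>Majorana operators on the exterior algebra\<close>

definition toggle :: "'n \<Rightarrow> 'n set \<Rightarrow> 'n set" where
  "toggle i A = (if i \<in> A then A - {i} else insert i A)"

text \<open>The sign from moving the generator \<open>i\<close> past the smaller generators in
  \<open>A\<close>. The order is the arbitrary one given by \<open>to_nat\<close>.\<close>

definition swap_sign :: "'n::finite \<Rightarrow> 'n set \<Rightarrow> real" where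
  "swap_sign i A = (-1) ^ card {j \<in> A. to_nat j < to_nat i}"

definition mem_sign :: "'n \<Rightarrow> 'n set \<Rightarrow> real" where
  "mem_sign i A = (if i \<in> A then 1 else -1)"

lemma toggle_toggle [simp]: "toggle i (toggle i A) = A"
  by (auto simp: toggle_def)

lemma toggle_commute: "toggle i (toggle j A) = toggle j (toggle i A)"
  by (auto simp: toggle_def)

lemma mem_toggle: "k \<in> toggle i A \<longleftrightarrow> (if k = i then k \<notin> A else k \<in> A)"
  by (simp add: toggle_def)

lemma toggle_eq_iff: "A = toggle i B \<longleftrightarrow> B = toggle i A"
proof
  show "B = toggle i A" if "A = toggle i B" using that by simp
  show "A = toggle i B" if "B = toggle i A" using that by simp
qed

lemma mem_sign_toggle: "mem_sign i (toggle j A) = (if i = j then - mem_sign i A else mem_sign i A)"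
  by (simp add: mem_sign_def mem_toggle)

lemma swap_sign_toggle:
  "swap_sign i (toggle j A) = (if to_nat j < to_nat i then - swap_sign i A else swap_sign i A)"
proof (cases "to_nat j < to_nat i")
  case True
  let ?S = "\<lambda>A. {k \<in> A. to_nat k < to_nat i}"
  show ?thesis
  proof (cases "j \<in> A")
    case j: True
    have "?S A = insert j (?S (toggle j A))" "j \<notin> ?S (toggle j A)"
      using j True by (auto simp: toggle_def)
    then show ?thesis using True by (simp add: swap_sign_def)
  next
    case j: False
    have "?S (toggle j A) = insert j (?S A)" "j \<notin> ?S A"
      using j True by (auto simp: toggle_def)
    then show ?thesis using True by (simp add: swap_sign_def)
  qed
next
  case False
  then have "{k \<in> toggle j A. to_nat k < to_nat i} = {k \<in> A. to_nat k < to_nat i}"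
    by (auto simp: toggle_def)
  then show ?thesis using False by (simp add: swap_sign_def)
qed

lemma swap_sign_sq [simp]: "swap_sign i A * swap_sign i A = 1"
  by (simp add: swap_sign_def flip: power_add mult_2)

text \<open>The two families of Majorana operators on the exterior algebra, whose basis is indexed by
  the subsets of \<open>'n\<close>. The \<open>gam i\<close> generate the Clifford algebra, and the even elements of it
  commute with the \<open>eta i\<close>.\<close>

definition gam :: "'n::finite \<Rightarrow> real^('n set)^('n set)" where
  "gam i = (\<chi> A B. if B = toggle i A then swap_sign i A else 0)"

definition eta :: "'n::finite \<Rightarrow> real^('n set)^('n set)" where
  "eta i = (\<chi> A B. if B = toggle i A then swap_sign i A * mem_sign i A else 0)"

text \<open>These operators are signed permutation matrices, so multiplication only shifts an index
  and adds a sign. All relations below become identities between signs.\<close>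

lemma gam_left: "(gam i ** M) $ A $ B = swap_sign i A * M $ toggle i A $ B"
  by (simp add: matrix_matrix_mult_def gam_def if_distrib[of "\<lambda>c. c * _"] cong: if_cong)

lemma eta_left: "(eta i ** M) $ A $ B = swap_sign i A * mem_sign i A * M $ toggle i A $ B"
  by (simp add: matrix_matrix_mult_def eta_def if_distrib[of "\<lambda>c. c * _"] cong: if_cong)

lemma gam_right: "(M ** gam i) $ A $ B = M $ A $ toggle i B * swap_sign i B"
  by (simp add: matrix_matrix_mult_def gam_def if_distrib[of "\<lambda>c. _ * c"] toggle_eq_iff[of B]
      swap_sign_toggle cong: if_cong)

lemma eta_right: "(M ** eta i) $ A $ B = - M $ A $ toggle i B * swap_sign i B * mem_sign i B"
  by (simp add: matrix_matrix_mult_def eta_def if_distrib[of "\<lambda>c. _ * c"] toggle_eq_iff[of B]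
      swap_sign_toggle mem_sign_toggle cong: if_cong)

lemma gam_sq: "gam i ** gam i = mat 1"
  by (simp add: vec_eq_iff gam_left mat_def) (auto simp: gam_def swap_sign_toggle)

lemma gam_anticommute: "i \<noteq> j \<Longrightarrow> gam i ** gam j = - (gam j ** gam i)"
  using inj_to_nat[THEN injD, of i j]
  by (simp add: vec_eq_iff gam_left)
    (auto simp: gam_def swap_sign_toggle toggle_commute[of i j])

lemma gam_eta: "gam i ** eta j = - (eta j ** gam i)"
  using inj_to_nat[THEN injD, of i j]
  by (simp add: vec_eq_iff gam_left eta_left)
    (auto simp: gam_def eta_def swap_sign_toggle mem_sign_toggle toggle_commute[of i j])

lemma transpose_gam: "transpose (gam i) = gam i"
  by (auto simp: vec_eq_iff transpose_def gam_def swap_sign_toggle toggle_eq_iff)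

lemma transpose_eta: "transpose (eta i) = - eta i"
  by (auto simp: vec_eq_iff transpose_def eta_def swap_sign_toggle mem_sign_toggle toggle_eq_iff)

text \<open>An entry off the diagonal is compared along one toggled axis. Commuting with
  \<open>gam\<close> and with \<open>eta\<close> gives the same equation with opposite signs, so it
  vanishes. Commuting with \<open>gam\<close> carries one diagonal entry to all the others.\<close>

lemma central_is_scalar:
  fixes u :: "real^('n::finite set)^('n set)"
  assumes g: "\<And>i. u ** gam i = gam i ** u" and e: "\<And>i. u ** eta i = eta i ** u"
  shows "u = u $ {} $ {} *\<^sub>R mat 1"
proof -
  have g': "u $ A $ toggle i B * swap_sign i B = swap_sign i A * u $ toggle i A $ B" for i A B
    using arg_cong[OF g[of i], of "\<lambda>M. M $ A $ B"] by (simp add: gam_left gam_right)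
  have e': "- (u $ A $ toggle i B * swap_sign i B * mem_sign i B) = swap_sign i A * mem_sign i A * u $ toggle i A $ B" for i A B
    using arg_cong[OF e[of i], of "\<lambda>M. M $ A $ B"] by (simp add: eta_left eta_right)
  have off: "u $ A $ B = 0" if "A \<noteq> B" for A B
  proof -
    obtain i where i: "i \<in> A \<longleftrightarrow> i \<notin> B" using \<open>A \<noteq> B\<close> by auto
    let ?B = "toggle i B"
    \<comment> \<open>Since \<open>i\<close> lies in exactly one of \<open>A\<close> and
      \<open>B\<close>, toggling it in \<open>B\<close> makes the two membership signs equal; this
      is what makes the equations clash.\<close>
    have m: "mem_sign i ?B = mem_sign i A" using i by (auto simp: mem_sign_def toggle_def)
    have nz: "swap_sign i A \<noteq> 0" "swap_sign i ?B \<noteq> 0" "mem_sign i A \<noteq> 0"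
      by (auto simp: swap_sign_def mem_sign_def)
    have 1: "u $ A $ B * swap_sign i ?B = swap_sign i A * u $ toggle i A $ ?B"
      using g'[of A i ?B] by simp
    have "- (u $ A $ B * swap_sign i ?B) * mem_sign i A = (swap_sign i A * u $ toggle i A $ ?B) * mem_sign i A"
      using e'[of A i ?B] by (simp add: m algebra_simps)
    then have "- (u $ A $ B * swap_sign i ?B) = u $ A $ B * swap_sign i ?B"
      using nz 1 by (metis mult_right_cancel)
    then show ?thesis using nz by simp
  qed
  have tog: "u $ toggle i A $ toggle i A = u $ A $ A" for i A
    using g'[of A i "toggle i A"] by (simp add: swap_sign_toggle) (simp add: swap_sign_def)
  have diag: "u $ A $ A = u $ {} $ {}" for A
  proof (induction A rule: finite_induct[OF finite])
    case (2 i A)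
    then show ?case using tog[of i A] by (simp add: toggle_def)
  qed simp
  show ?thesis
    using off diag by (simp add: vec_eq_iff mat_def)
qed

section \<open>Clifford multiplication by vectors\<close>

definition cliff :: "real^'n::finite \<Rightarrow> real^('n set)^('n set)" where
  "cliff v = (\<Sum>i\<in>UNIV. v $ i *\<^sub>R gam i)"

lemma cliff_axis: "cliff (axis i c) = c *\<^sub>R gam i"
  by (simp add: cliff_def axis_def if_distrib[of "\<lambda>c. c *\<^sub>R _"] cong: if_cong)

lemma linear_cliff: "linear cliff"
  by (rule linearI) (simp_all add: cliff_def scaleR_add_left sum.distrib scaleR_sum_right)

lemmas cliff_add = linear_add[OF linear_cliff] and cliff_scaleR = linear_scale[OF linear_cliff]

lemma cliff_eta: "cliff v ** eta j = - (eta j ** cliff v)"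
  by (simp add: cliff_def mm.sum_left mm.sum_right mm.scaleR_left mm.scaleR_right gam_eta sum_negf)

lemma transpose_cliff:
  fixes v :: "real^'n::finite"
  shows "transpose (cliff v) = cliff v"
proof -
  have "linear (transpose :: real^('n set)^('n set) \<Rightarrow> real^('n set)^('n set))"
    by (rule linearI) (simp_all add: transpose_add transpose_scaleR)
  then show ?thesis by (simp add: cliff_def linear_sum transpose_scaleR transpose_gam)
qed

text \<open>The generators square to one and anticommute, so only the diagonal of the double sum
  survives the symmetrisation.\<close>

lemma cliff_anticommutator:
  fixes v w :: "real^'n::finite"
  shows "cliff v ** cliff w + cliff w ** cliff v = (2 * (v \<bullet> w)) *\<^sub>R mat 1"
proof -
  have *: "gam i ** gam j + gam j ** gam i = (if i = j then 2 else 0) *\<^sub>R mat 1" for i j :: 'n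
    using gam_anticommute[of i j] by (auto simp: gam_sq scaleR_2)
  have 1: "cliff v ** cliff w = (\<Sum>i\<in>UNIV. \<Sum>j\<in>UNIV. (v $ i * w $ j) *\<^sub>R (gam i ** gam j))" for v w :: "real^'n"
    unfolding cliff_def mm.sum_left mm.sum_right mm.scaleR_left mm.scaleR_right scaleR_sum_right scaleR_scaleR
    by (subst sum.swap) (simp add: mult.commute)
  have 2: "cliff w ** cliff v = (\<Sum>i\<in>UNIV. \<Sum>j\<in>UNIV. (v $ i * w $ j) *\<^sub>R (gam j ** gam i))"
    unfolding 1 by (subst sum.swap) (simp add: mult.commute)
  have "cliff v ** cliff w + cliff w ** cliff v
      = (\<Sum>i\<in>UNIV. \<Sum>j\<in>UNIV. (v $ i * w $ j) *\<^sub>R (gam i ** gam j + gam j ** gam i))"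
    unfolding 1[of v w] 2 by (simp add: sum.distrib scaleR_add_right)
  also have "\<dots> = (\<Sum>i\<in>UNIV. \<Sum>j\<in>UNIV. (if i = j then v $ i * w $ j * 2 else 0) *\<^sub>R mat 1)"
    unfolding * by (intro sum.cong) auto
  also have "\<dots> = (\<Sum>i\<in>UNIV. v $ i * w $ i * 2) *\<^sub>R mat 1"
    unfolding scaleR_sum_left[symmetric] by simp
  also have "(\<Sum>i\<in>UNIV. v $ i * w $ i * 2) = 2 * (v \<bullet> w)"
    by (simp add: inner_vec_def sum_distrib_left mult.commute)
  finally show ?thesis .
qed

lemma cliff_sq: "norm v = 1 \<Longrightarrow> cliff v ** cliff v = mat 1"
  using cliff_anticommutator[of v v] by (simp add: dot_square_norm scaleR_2[symmetric] del: scaleR_2)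

lemma cliff_orthogonal: "v \<bullet> w = 0 \<Longrightarrow> cliff v ** cliff w = - (cliff w ** cliff v)"
  using cliff_anticommutator[of v w] by (simp add: eq_neg_iff_add_eq_0)

lemma continuous_on_cliff [continuous_intros]: "continuous_on S f \<Longrightarrow> continuous_on S (\<lambda>x. cliff (f x))"
  unfolding cliff_def by (intro continuous_intros)

text \<open>Conjugation by \<open>s\<close> implements the rotation \<open>A\<close> on the Clifford
  generators. Commuting with the \<open>eta j\<close> determines \<open>s\<close> up to a scalar,
  and orthogonality reduces the scalar to a sign.\<close>

definition spin_lift :: "real^'n::finite^'n \<Rightarrow> real^('n set)^('n set) \<Rightarrow> bool" where
  "spin_lift A s \<longleftrightarrow> orthogonal_matrix s \<and> (\<forall>j. s ** eta j = eta j ** s) \<and>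
     (\<forall>i. s ** gam i = cliff (A *v axis i 1) ** s)"

lemma spin_lift_cliff:
  assumes "spin_lift A s" shows "s ** cliff v = cliff (A *v v) ** s"
proof -
  have "A *v v = (\<Sum>i\<in>UNIV. v $ i *\<^sub>R (A *v axis i 1))"
    using matrix_mult_sum[of A v] by (simp add: matrix_vector_mult_basis scalar_mult_eq_scaleR)
  then have "cliff (A *v v) = (\<Sum>i\<in>UNIV. v $ i *\<^sub>R cliff (A *v axis i 1))"
    by (simp add: linear_sum[OF linear_cliff] cliff_scaleR)
  then show ?thesis
    using assms by (simp add: cliff_def mm.sum_left mm.sum_right mm.scaleR_left mm.scaleR_right spin_lift_def)
qed

lemma spin_lift_one: "spin_lift (mat 1) (mat 1)"
  by (simp add: spin_lift_def cliff_axis orthogonal_matrix_def)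

lemma spin_lift_minus: "spin_lift A s \<Longrightarrow> spin_lift A (- s)"
  using transpose_scaleR[of "-1" s]
  by (simp add: spin_lift_def mm.minus_left mm.minus_right orthogonal_matrix)

lemma intertwine_mult:
  fixes s t X Y Z :: "real^'m^'m"
  assumes "s ** Y = Z ** s" "t ** X = Y ** t"
  shows "s ** t ** X = Z ** (s ** t)"
proof -
  have "s ** t ** X = s ** (Y ** t)" by (simp only: matrix_mul_assoc[symmetric] assms(2))
  also have "\<dots> = Z ** (s ** t)" by (simp only: matrix_mul_assoc assms(1))
  finally show ?thesis .
qed

lemma spin_lift_mult:
  assumes "spin_lift A s" "spin_lift B t" shows "spin_lift (A ** B) (s ** t)"
proof -
  have "s ** t ** eta j = eta j ** (s ** t)" for j
    by (rule intertwine_mult) (use assms in \<open>simp_all add: spin_lift_def\<close>)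
  moreover have "s ** t ** gam i = cliff (A ** B *v axis i 1) ** (s ** t)" for i
    using spin_lift_cliff[OF assms(1), of "B *v axis i 1"] assms(2)
    by (intro intertwine_mult[of _ "cliff (B *v axis i 1)"]) (simp_all add: spin_lift_def matrix_vector_mul_assoc)
  ultimately show ?thesis
    using assms by (simp add: spin_lift_def orthogonal_matrix_mul)
qed

lemma spin_lift_transpose:
  assumes A: "A \<in> SO" and s: "spin_lift A s" shows "spin_lift (transpose A) (transpose s)"
proof -
  have os: "transpose s ** s = mat 1" "s ** transpose s = mat 1"
    using s by (simp_all add: spin_lift_def orthogonal_matrix_def)
  have swap: "transpose s ** X = Y ** transpose s" if "X ** s = s ** Y" for X Y
  proof -
    have "transpose s ** X = transpose s ** (X ** s) ** transpose s"
      by (simp only: matrix_mul_assoc[symmetric] os matrix_mul_rid)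
    also have "\<dots> = transpose s ** s ** Y ** transpose s" by (simp only: that matrix_mul_assoc)
    finally show ?thesis by (simp only: os matrix_mul_lid)
  qed
  have "gam i ** s = s ** cliff (transpose A *v axis i 1)" for i
    using spin_lift_cliff[OF s, of "transpose A *v axis i 1"] SO_mult_transpose[OF A]
    by (simp add: matrix_vector_mul_assoc cliff_axis del: transpose_matrix_vector)
  then show ?thesis
    using s by (simp add: spin_lift_def swap del: transpose_matrix_vector)
qed

text \<open>The quotient of two lifts is a lift of the identity, hence commutes with all
  \<open>gam\<close> and \<open>eta\<close> and is scalar. An orthogonal scalar matrix is
  \<open>1\<close> or \<open>-1\<close>.\<close>

lemma spin_lift_unique:
  assumes s: "spin_lift A s" and t: "spin_lift A t" and A: "A \<in> SO"
  shows "t = s \<or> t = - s"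
proof -
  let ?u = "transpose s ** t"
  have u: "spin_lift (mat 1) ?u"
    using spin_lift_mult[OF spin_lift_transpose[OF A s] t] SO_transpose_mult[OF A] by simp
  then obtain c where c: "?u = c *\<^sub>R mat 1"
    using central_is_scalar[of ?u] by (auto simp: spin_lift_def cliff_axis)
  have "transpose ?u ** ?u = mat 1" using u by (simp add: spin_lift_def orthogonal_matrix_def)
  then have "(c * c) *\<^sub>R mat 1 = (mat 1 :: real^('a set)^('a set))"
    unfolding c by (simp add: transpose_scaleR mm.scaleR_left mm.scaleR_right)
  from arg_cong[OF this, of "\<lambda>M. M $ {} $ {}"] have "c * c = 1" by (simp add: mat_def)
  then have "c = 1 \<or> c = -1" by (metis square_eq_1_iff)
  moreover have "t = s ** ?u"
    using s by (simp add: matrix_mul_assoc spin_lift_def orthogonal_matrix_def)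
  ultimately show ?thesis unfolding c by (auto simp: mm.scaleR_right)
qed

text \<open>Averaging \<open>x \<mapsto> x + \<gamma>(A e\<^sub>k) x \<gamma>\<^sub>k\<close> over all \<open>k\<close> turns \<open>1\<close> into an intertwiner of \<open>\<gamma>\<^sub>k\<close> and
  \<open>\<gamma>(A e\<^sub>k)\<close>. It depends continuously on \<open>A\<close> and does not vanish at \<open>A = 1\<close>, so it provides a local
  section of the spin covering.\<close>

primrec intertwiner :: "real^'n::finite^'n \<Rightarrow> 'n list \<Rightarrow> real^('n set)^('n set)" where
  "intertwiner A [] = mat 1"
| "intertwiner A (k # xs) = intertwiner A xs + cliff (A *v axis k 1) ** intertwiner A xs ** gam k"

text \<open>Each new summand has two additional factors that anticommute with \<open>eta j\<close>,
  and the signs cancel.\<close>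

lemma intertwiner_eta: "intertwiner A xs ** eta j = eta j ** intertwiner A xs"
proof (induction xs)
  case (Cons k xs)
  let ?Q = "intertwiner A xs" and ?g = "cliff (A *v axis k 1)"
  have "?g ** ?Q ** gam k ** eta j = - (?g ** (?Q ** eta j) ** gam k)"
    by (simp add: matrix_mul_assoc[symmetric] gam_eta mm.minus_right)
  also have "\<dots> = - (?g ** eta j ** ?Q ** gam k)" by (simp add: Cons matrix_mul_assoc)
  also have "\<dots> = eta j ** (?g ** ?Q ** gam k)" by (simp add: cliff_eta mm.minus_left matrix_mul_assoc)
  finally show ?case by (simp add: Cons mm.add_left mm.add_right)
qed simp

text \<open>For the index \<open>k\<close> just added, both generators square to one, so the
  relation exchanges the two summands. For any other index the generators anticommute on both sides
  and the relation is inherited; distinctness of the list prevents a third case.\<close>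

lemma intertwiner_gam:
  assumes A: "A \<in> SO" and "distinct xs" "i \<in> set xs"
  shows "intertwiner A xs ** gam i = cliff (A *v axis i 1) ** intertwiner A xs"
  using assms(2,3)
proof (induction xs)
  case (Cons k xs)
  let ?Q = "intertwiner A xs" and ?g = "\<lambda>k. cliff (A *v axis k 1)"
  have sq: "?g k ** ?g k = mat 1" using SO_norm[OF A] by (simp add: cliff_sq norm_axis_1)
  show ?case
  proof (cases "i = k")
    case True
    have "?g k ** ?Q ** gam k ** gam k = ?g k ** ?Q"
      by (simp add: matrix_mul_assoc[symmetric] gam_sq)
    moreover have "?g k ** (?g k ** ?Q ** gam k) = ?Q ** gam k"
      by (simp add: matrix_mul_assoc sq)
    ultimately show ?thesis unfolding True by (simp add: mm.add_left mm.add_right)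
  next
    case False
    then have IH: "?Q ** gam i = ?g i ** ?Q" using Cons by auto
    have "?g i ** ?g k = - (?g k ** ?g i)"
      using False SO_inner[OF A] by (intro cliff_orthogonal) (simp add: inner_axis_axis)
    then have "?g i ** (?g k ** ?Q ** gam k) = - (?g k ** (?g i ** ?Q) ** gam k)"
      by (simp add: matrix_mul_assoc mm.minus_left)
    also have "\<dots> = - (?g k ** ?Q ** (gam i ** gam k))" by (simp add: IH[symmetric] matrix_mul_assoc)
    also have "\<dots> = ?g k ** ?Q ** gam k ** gam i"
      using gam_anticommute[OF False] by (simp add: mm.minus_right matrix_mul_assoc)
    finally show ?thesis using IH by (simp add: mm.add_left mm.add_right)
  qed
qed simp

lemma continuous_on_intertwiner: "continuous_on S (\<lambda>A. intertwiner A xs)"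
  by (induction xs) (auto intro!: continuous_intros)

lemma intertwiner_one: "intertwiner (mat 1) xs = 2 ^ length xs *\<^sub>R mat 1"
  by (induction xs) (simp_all add: cliff_axis mm.scaleR_left mm.scaleR_right gam_sq scaleR_2[symmetric] del: scaleR_2)

text \<open>For the intertwiner \<open>Q\<close>, the product \<open>transpose (Q A) ** Q A\<close>
  commutes with all \<open>gam\<close> and \<open>eta\<close>, so it is a scalar \<open>c A\<close>.
  Where this scalar is positive, dividing by its square root makes \<open>Q\<close>
  orthogonal.\<close>

lemma spin_section:
  obtains N :: "(real^'n::finite^'n) set" and \<sigma> where "openin (top_of_set SO) N" "mat 1 \<in> N"
    "continuous_on N \<sigma>" "\<sigma> (mat 1) = mat 1" "\<And>A. A \<in> N \<Longrightarrow> spin_lift A (\<sigma> A)"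
proof -
  obtain xs :: "'n list" where xs: "set xs = UNIV" "distinct xs"
    using finite_distinct_list[OF finite_class.finite_UNIV] by blast
  define Q where "Q A = intertwiner A xs" for A
  define c where "c A = (transpose (Q A) ** Q A) $ {} $ {}" for A
  have contQ: "continuous_on S Q" for S unfolding Q_def by (rule continuous_on_intertwiner)
  have contc: "continuous_on S c" for S unfolding c_def by (intro continuous_intros contQ)
  have eta: "Q A ** eta j = eta j ** Q A" for A j unfolding Q_def by (rule intertwiner_eta)
  have gam: "Q A ** gam i = cliff (A *v axis i 1) ** Q A" if "A \<in> SO" for A i
    unfolding Q_def using xs by (intro intertwiner_gam[OF that]) auto
  have eta': "transpose (Q A) ** eta j = eta j ** transpose (Q A)" for A j
    using arg_cong[OF eta[of A j], of transpose]
    by (simp add: matrix_transpose_mul transpose_eta mm.minus_left mm.minus_right)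
  have gam': "gam i ** transpose (Q A) = transpose (Q A) ** cliff (A *v axis i 1)" if "A \<in> SO" for A i
    using arg_cong[OF gam[OF that, of i], of transpose]
    by (simp add: matrix_transpose_mul transpose_gam transpose_cliff)
  have QQ: "transpose (Q A) ** Q A = c A *\<^sub>R mat 1" if A: "A \<in> SO" for A
    unfolding c_def
  proof (rule central_is_scalar)
    fix i
    show "transpose (Q A) ** Q A ** gam i = gam i ** (transpose (Q A) ** Q A)"
      by (rule intertwine_mult[OF gam'[OF A, symmetric] gam[OF A]])
    show "transpose (Q A) ** Q A ** eta i = eta i ** (transpose (Q A) ** Q A)"
      by (rule intertwine_mult[OF eta' eta])
  qed
  have c0: "c A \<ge> 0" for A
    by (simp add: c_def matrix_matrix_mult_def transpose_def sum_nonneg)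
  have Q1: "Q (mat 1) = 2 ^ length xs *\<^sub>R mat 1" unfolding Q_def by (rule intertwiner_one)
  have c1: "c (mat 1) = 2 ^ length xs * 2 ^ length xs"
    by (simp add: c_def Q1 transpose_scaleR mm.scaleR_left mm.scaleR_right) (simp add: mat_def)
  \<comment> \<open>\<open>c\<close> is continuous and equals the square of
    \<open>2 ^ length xs\<close> at the identity, so the set is open and contains the
    identity.\<close>
  let ?N = "SO \<inter> c -` {0<..}"
  define \<sigma> where "\<sigma> A = (1 / sqrt (c A)) *\<^sub>R Q A" for A
  show thesis
  proof
    show "openin (top_of_set SO) ?N"
      by (rule continuous_openin_preimage_gen[OF contc]) simp
    show "mat 1 \<in> ?N" by (simp add: c1)
    show "continuous_on ?N \<sigma>" unfolding \<sigma>_def by (intro continuous_intros contc contQ) auto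
    show "\<sigma> (mat 1) = mat 1" by (simp add: \<sigma>_def c1 Q1 real_sqrt_mult)
    fix A assume A: "A \<in> ?N"
    then have pos: "c A > 0" by simp
    have "orthogonal_matrix (\<sigma> A)"
      using QQ[of A] A by (simp add: orthogonal_matrix \<sigma>_def transpose_scaleR mm.scaleR_left mm.scaleR_right)
    moreover have "\<sigma> A ** eta j = eta j ** \<sigma> A" for j
      using eta by (simp add: \<sigma>_def mm.scaleR_left mm.scaleR_right)
    moreover have "\<sigma> A ** gam i = cliff (A *v axis i 1) ** \<sigma> A" for i
      using gam A by (simp add: \<sigma>_def mm.scaleR_left mm.scaleR_right)
    ultimately show "spin_lift A (\<sigma> A)" by (simp add: spin_lift_def)
  qed
qed

section \<open>The spin group as a double cover of the rotations\<close>

definition spin_group :: "((real^'n::finite^'n) \<times> (real^('n set)^('n set))) monoid" where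
  "spin_group = \<lparr>carrier = {(A, s). A \<in> SO \<and> spin_lift A s},
    monoid.mult = (\<lambda>g h. (fst g ** fst h, snd g ** snd h)), one = (mat 1, mat 1)\<rparr>"

lemma spin_group_simps:
  "g \<in> carrier spin_group \<longleftrightarrow> fst g \<in> SO \<and> spin_lift (fst g) (snd g)"
  "g \<otimes>\<^bsub>spin_group\<^esub> h = (fst g ** fst h, snd g ** snd h)"
  "\<one>\<^bsub>spin_group\<^esub> = (mat 1, mat 1)"
  by (auto simp: spin_group_def split_beta)

lemma group_spin_group: "group spin_group"
proof (rule groupI)
  fix g :: "(real^'a^'a) \<times> (real^('a set)^('a set))" assume g: "g \<in> carrier spin_group"
  then have "(transpose (fst g), transpose (snd g)) \<in> carrier spin_group"
    by (simp add: spin_group_simps SO_transpose spin_lift_transpose)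
  moreover have "transpose (snd g) ** snd g = mat 1"
    using g by (simp add: spin_group_simps spin_lift_def orthogonal_matrix_def)
  ultimately show "\<exists>y\<in>carrier spin_group. y \<otimes>\<^bsub>spin_group\<^esub> g = \<one>\<^bsub>spin_group\<^esub>"
    using g by (intro bexI[of _ "(transpose (fst g), transpose (snd g))"])
      (auto simp: spin_group_simps SO_transpose_mult)
qed (auto simp: spin_group_simps SO_mult spin_lift_mult spin_lift_one matrix_mul_assoc)

lemma inv_spin_group:
  assumes "g \<in> carrier spin_group"
  shows "inv\<^bsub>spin_group\<^esub> g = (transpose (fst g), transpose (snd g))"
proof (rule group.inv_equality[OF group_spin_group])
  show "(transpose (fst g), transpose (snd g)) \<otimes>\<^bsub>spin_group\<^esub> g = \<one>\<^bsub>spin_group\<^esub>"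
    using assms by (simp add: spin_group_simps SO_transpose_mult spin_lift_def orthogonal_matrix_def)
  show "(transpose (fst g), transpose (snd g)) \<in> carrier spin_group"
    using assms by (simp add: spin_group_simps SO_transpose spin_lift_transpose)
qed fact

text \<open>The section near the identity is moved to \<open>A0\<close> by multiplying with the
  given lift.\<close>

lemma spin_local_section:
  fixes A0 :: "real^'n::finite^'n"
  assumes A0: "A0 \<in> SO" "spin_lift A0 s0"
  obtains M \<tau> where "openin (top_of_set SO) M" "A0 \<in> M" "continuous_on M \<tau>" "\<tau> A0 = (A0, s0)"
    "\<And>A. A \<in> M \<Longrightarrow> \<tau> A \<in> carrier spin_group \<and> fst (\<tau> A) = A"
proof -
  obtain N :: "(real^'n^'n) set" and \<sigma> where N: "openin (top_of_set SO) N" "mat 1 \<in> N"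
    "continuous_on N \<sigma>" "\<sigma> (mat 1) = mat 1" "\<And>A. A \<in> N \<Longrightarrow> spin_lift A (\<sigma> A)"
    using spin_section by blast
  let ?M = "SO \<inter> (\<lambda>A. transpose A0 ** A) -` N"
  show thesis
  proof
    show "openin (top_of_set SO) ?M"
      by (rule continuous_openin_preimage[OF _ _ N(1)])
        (use A0 in \<open>auto intro!: continuous_intros SO_mult SO_transpose\<close>)
    show "A0 \<in> ?M" using A0 N(2) by (simp add: SO_transpose_mult)
    show "continuous_on ?M (\<lambda>A. (A, s0 ** \<sigma> (transpose A0 ** A)))"
      by (intro continuous_intros continuous_on_compose2[OF N(3)]) auto
    show "(A0, s0 ** \<sigma> (transpose A0 ** A0)) = (A0, s0)"
      using A0 N(4) by (simp add: SO_transpose_mult)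
    fix A assume A: "A \<in> ?M"
    have "A0 ** (transpose A0 ** A) = A" using A0 by (simp add: matrix_mul_assoc SO_mult_transpose)
    then have "spin_lift A (s0 ** \<sigma> (transpose A0 ** A))"
      using spin_lift_mult[OF A0(2) N(5), of "transpose A0 ** A"] A by simp
    then show "(A, s0 ** \<sigma> (transpose A0 ** A)) \<in> carrier spin_group \<and> fst (A, s0 ** \<sigma> (transpose A0 ** A)) = A"
      using A by (simp add: spin_group_simps)
  qed
qed

text \<open>Through every point of the spin group passes a continuous local section, and its
  preimage of an open set is an open set inside the image.\<close>

lemma open_map_spin: "open_map (top_of_set (carrier spin_group)) (top_of_set SO) fst"
  unfolding open_map_def
proof (intro allI impI)
  fix U :: "((real^'a^'a) \<times> (real^('a set)^('a set))) set"
  assume U: "openin (top_of_set (carrier spin_group)) U"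
  show "openin (top_of_set SO) (fst ` U)"
  proof (subst openin_subopen, intro ballI)
    fix A0 assume "A0 \<in> fst ` U"
    then obtain s0 where s0: "(A0, s0) \<in> U" by auto
    then have "(A0, s0) \<in> carrier spin_group" using U openin_imp_subset by blast
    then have "A0 \<in> SO" "spin_lift A0 s0" by (simp_all add: spin_group_simps)
    then obtain M \<tau> where M: "openin (top_of_set SO) M" "A0 \<in> M" "continuous_on M \<tau>" "\<tau> A0 = (A0, s0)"
      "\<And>A. A \<in> M \<Longrightarrow> \<tau> A \<in> carrier spin_group \<and> fst (\<tau> A) = A"
      using spin_local_section by blast
    have "openin (top_of_set M) (M \<inter> \<tau> -` U)"
      by (rule continuous_openin_preimage[OF M(3) _ U]) (use M(5) in auto)
    then have "openin (top_of_set SO) (M \<inter> \<tau> -` U)" using M(1) openin_trans by blast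
    moreover have "M \<inter> \<tau> -` U \<subseteq> fst ` U" using M(5) by force
    moreover have "A0 \<in> M \<inter> \<tau> -` U" using M s0 by simp
    ultimately show "\<exists>T. openin (top_of_set SO) T \<and> A0 \<in> T \<and> T \<subseteq> fst ` U" by blast
  qed
qed

text \<open>The image is open and closed under products and inverses. Its translates by elements
  outside it are open and disjoint from it, so its complement is open too, and the rotations are
  connected.\<close>

lemma spin_onto: "fst ` carrier spin_group = (SO :: (real^'n::finite^'n) set)"
proof -
  let ?I = "fst ` carrier spin_group :: (real^'n^'n) set"
  have sub: "?I \<subseteq> SO" by (auto simp: spin_group_simps)
  have I_iff: "A \<in> ?I \<longleftrightarrow> A \<in> SO \<and> (\<exists>s. spin_lift A s)" for A
    by (simp add: image_iff Bex_def split_paired_Ex spin_group_simps)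
  have one: "mat 1 \<in> ?I" using I_iff spin_lift_one by auto
  have "openin (top_of_set SO) ?I"
    using open_map_spin openin_subtopology_self unfolding open_map_def by blast
  moreover have "openin (top_of_set SO) (SO - ?I)"
  proof (subst openin_subopen, intro ballI)
    fix A assume A: "A \<in> SO - ?I"
    let ?T = "SO \<inter> (\<lambda>B. transpose A ** B) -` ?I"
    have "openin (top_of_set SO) ?T"
      by (rule continuous_openin_preimage[OF _ _ \<open>openin (top_of_set SO) ?I\<close>])
        (use A in \<open>auto intro!: continuous_intros SO_mult SO_transpose\<close>)
    moreover have "A \<in> ?T" using A one by (simp add: SO_transpose_mult)
    moreover have "?T \<subseteq> SO - ?I"
    proof
      fix B assume B: "B \<in> ?T"
      have "B \<notin> ?I"
      proof
        assume "B \<in> ?I"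
        then obtain s t where st: "spin_lift B s" "spin_lift (transpose A ** B) t"
          using B I_iff by auto
        have "transpose A ** B \<in> SO" using B I_iff by auto
        from spin_lift_mult[OF st(1) spin_lift_transpose[OF this st(2)]]
        have "spin_lift (B ** (transpose B ** A)) (s ** transpose t)"
          by (simp add: matrix_transpose_mul)
        moreover have "B ** (transpose B ** A) = A"
          using B by (simp add: matrix_mul_assoc SO_mult_transpose)
        ultimately show False using A I_iff by auto
      qed
      then show "B \<in> SO - ?I" using B by simp
    qed
    ultimately show "\<exists>T. openin (top_of_set SO) T \<and> A \<in> T \<and> T \<subseteq> SO - ?I" by blast
  qed
  moreover have "connected (SO :: (real^'n^'n) set)" using path_connected_SO path_connected_imp_connected by blast
  ultimately have "SO - ?I = {} \<or> ?I = {}"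
    unfolding connected_openin using sub by blast
  then show ?thesis using one sub by blast
qed

definition spin_kernel :: "((real^'n::finite^'n) \<times> (real^('n set)^('n set))) set" where
  "spin_kernel = {(mat 1, mat 1), (mat 1, - mat 1)}"

lemma discrete_quotient_spin_group:
  "discrete_quotient (spin_group :: ((real^'n::finite^'n) \<times> (real^('n set)^('n set))) monoid)
     (top_of_set SO) fst spin_kernel"
proof -
  let ?G = "spin_group :: ((real^'n^'n) \<times> (real^('n set)^('n set))) monoid"
  interpret group ?G by (rule group_spin_group)
  have ker: "spin_kernel \<subseteq> carrier ?G"
    by (auto simp: spin_kernel_def spin_group_simps spin_lift_one spin_lift_minus)
  show "discrete_quotient ?G (top_of_set SO) fst spin_kernel"
  proof (intro discrete_quotient.intro discrete_quotient_axioms.intro)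
    show "group ?G" by (rule group_spin_group)
    show "continuous_on (carrier ?G \<times> carrier ?G) (\<lambda>(x, y). x \<otimes>\<^bsub>?G\<^esub> y)"
      unfolding spin_group_simps split_beta by (intro continuous_intros)
    show "continuous_on (carrier ?G) (m_inv ?G)"
      by (subst continuous_on_cong[OF refl inv_spin_group]) (auto intro!: continuous_intros)
    show "continuous_map (top_of_set (carrier ?G)) (top_of_set SO) fst"
      by (auto simp: spin_group_simps intro!: continuous_intros)
    show "open_map (top_of_set (carrier ?G)) (top_of_set SO) fst" by (rule open_map_spin)
    show "fst ` carrier ?G = topspace (top_of_set SO)" by (simp add: spin_onto)
    show "subgroup spin_kernel ?G"
      by (rule subgroupI[OF ker])
        (auto simp: inv_spin_group subsetD[OF ker], auto simp: spin_kernel_def spin_group_simps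
          mm.minus_left mm.minus_right transpose_scaleR[of "-1", simplified])
    \<comment> \<open>The sign of one diagonal entry separates the identity from its
      negative.\<close>
    let ?W = "{p :: (real^'n^'n) \<times> (real^('n set)^('n set)). snd p $ {} $ {} > 0}"
    have "open ?W" by (intro open_Collect_less continuous_intros)
    moreover have "?W \<inter> spin_kernel = {\<one>\<^bsub>?G\<^esub>}"
      by (auto simp: spin_kernel_def spin_group_simps mat_def)
    ultimately show "\<exists>W. open W \<and> W \<inter> spin_kernel = {\<one>\<^bsub>?G\<^esub>}" by blast
    fix g h :: "(real^'n^'n) \<times> (real^('n set)^('n set))"
    assume g: "g \<in> carrier ?G" and h: "h \<in> carrier ?G"
    show "(fst g = fst h) = (inv\<^bsub>?G\<^esub> g \<otimes>\<^bsub>?G\<^esub> h \<in> spin_kernel)"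
    proof
      assume eq: "fst g = fst h"
      then have "inv\<^bsub>?G\<^esub> g \<otimes>\<^bsub>?G\<^esub> h \<in> carrier ?G"
        "fst (inv\<^bsub>?G\<^esub> g \<otimes>\<^bsub>?G\<^esub> h) = mat 1"
        using g h by (simp_all, simp add: inv_spin_group[OF g] spin_group_simps SO_transpose_mult)
      then show "inv\<^bsub>?G\<^esub> g \<otimes>\<^bsub>?G\<^esub> h \<in> spin_kernel"
        using spin_lift_unique[OF spin_lift_one _ SO_one]
        by (auto simp: spin_kernel_def spin_group_simps(1) prod_eq_iff)
    next
      assume "inv\<^bsub>?G\<^esub> g \<otimes>\<^bsub>?G\<^esub> h \<in> spin_kernel"
      then have "transpose (fst g) ** fst h = mat 1"
        by (auto simp: inv_spin_group[OF g] spin_kernel_def spin_group_simps)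
      then have "fst g ** transpose (fst g) ** fst h = fst g"
        by (simp add: matrix_mul_assoc[symmetric])
      then show "fst g = fst h" using g by (simp add: spin_group_simps SO_mult_transpose)
    qed
  qed
qed

text \<open>The product \<open>gam j ** gam i\<close> squares to \<open>-1\<close>, so the lift is
  its exponential at half the angle. The half angle is the source of the sign after a full
  turn.\<close>

lemma spin_lift_plane_rot:
  fixes i j :: "'n::finite"
  assumes ij: "i \<noteq> j"
  shows "spin_lift (plane_rot i j \<theta>) (cos (\<theta> / 2) *\<^sub>R mat 1 + sin (\<theta> / 2) *\<^sub>R (gam j ** gam i))"
proof -
  let ?c = "cos (\<theta> / 2)" and ?s = "sin (\<theta> / 2)"
  let ?b = "gam j ** gam i :: real^('n set)^('n set)"
  have anti: "gam i ** gam j = - ?b" using gam_anticommute[OF ij] .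
  have bi: "?b ** gam i = gam j" "gam i ** ?b = - gam j"
    by (simp_all add: matrix_mul_assoc[symmetric] gam_sq) (simp add: matrix_mul_assoc anti mm.minus_left,
        simp add: matrix_mul_assoc[symmetric] gam_sq)
  have bj: "?b ** gam j = - gam i" "gam j ** ?b = gam i"
    by (simp_all add: matrix_mul_assoc gam_sq) (simp add: matrix_mul_assoc[symmetric] anti mm.minus_right,
        simp add: matrix_mul_assoc gam_sq)
  have bk: "?b ** gam k = gam k ** ?b" if "k \<noteq> i" "k \<noteq> j" for k
    by (simp add: matrix_mul_assoc[symmetric] gam_anticommute[of i k] that not_sym[OF that(1)] mm.minus_right)
      (simp add: matrix_mul_assoc gam_anticommute[of j k] not_sym[OF that(2)] mm.minus_left)
  have beta: "?b ** eta k = eta k ** ?b" for k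
    by (simp add: matrix_mul_assoc[symmetric] gam_eta mm.minus_right)
      (simp add: matrix_mul_assoc gam_eta mm.minus_left)
  have bt: "transpose ?b = - ?b" by (simp add: matrix_transpose_mul transpose_gam anti)
  have bb: "?b ** ?b = - mat 1"
    by (simp add: matrix_mul_assoc bj(1) mm.minus_left gam_sq)
  \<comment> \<open>These are the difference formulas for \<open>\<theta> - \<theta> / 2\<close>;
    they turn the coefficients on the side of the rotated generators into half-angle ones.\<close>
  have c1: "?c * cos \<theta> + ?s * sin \<theta> = ?c"
    using cos_diff[of \<theta> "\<theta> / 2"] by (simp add: algebra_simps)
  have c2: "?c * sin \<theta> - ?s * cos \<theta> = ?s"
    using sin_diff[of \<theta> "\<theta> / 2"] by (simp add: algebra_simps)
  let ?S = "?c *\<^sub>R mat 1 + ?s *\<^sub>R ?b"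
  have Pi: "plane_rot i j \<theta> *v axis i 1 = cos \<theta> *\<^sub>R axis i 1 + sin \<theta> *\<^sub>R axis j 1"
    and Pj: "plane_rot i j \<theta> *v axis j 1 = - sin \<theta> *\<^sub>R axis i 1 + cos \<theta> *\<^sub>R axis j 1"
    using ij by (auto simp: vec_eq_iff plane_rot_vec axis_def)
  have Pk: "plane_rot i j \<theta> *v axis k 1 = axis k 1" if "k \<noteq> i" "k \<noteq> j" for k
    using ij that by (auto simp: vec_eq_iff plane_rot_vec axis_def)
  have "?S ** gam k = cliff (plane_rot i j \<theta> *v axis k 1) ** ?S" for k
  proof -
    consider "k = i" | "k = j" | "k \<noteq> i" "k \<noteq> j" by blast
    then show ?thesis
    proof cases
      case 1
      have "cliff (plane_rot i j \<theta> *v axis i 1) ** ?S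
          = (?c * cos \<theta> + ?s * sin \<theta>) *\<^sub>R gam i + (?c * sin \<theta> - ?s * cos \<theta>) *\<^sub>R gam j"
        unfolding Pi by (simp add: cliff_add cliff_scaleR cliff_axis mm.add_left mm.add_right mm.scaleR_left
          mm.scaleR_right mm.diff_left bi bj algebra_simps)
      then show ?thesis
        unfolding 1 c1 c2 by (simp add: mm.add_left mm.scaleR_left bi)
    next
      case 2
      have "cliff (plane_rot i j \<theta> *v axis j 1) ** ?S
          = - (?c * sin \<theta> - ?s * cos \<theta>) *\<^sub>R gam i + (?c * cos \<theta> + ?s * sin \<theta>) *\<^sub>R gam j"
        unfolding Pj cliff_add cliff_scaleR by (simp add: cliff_axis mm.add_left mm.add_right mm.scaleR_left
          mm.scaleR_right mm.minus_left mm.diff_left bi bj algebra_simps)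
      then show ?thesis
        unfolding 2 c1 c2 by (simp add: mm.add_left mm.scaleR_left bj)
    next
      case 3
      then show ?thesis
        by (simp add: Pk cliff_axis mm.add_left mm.add_right mm.scaleR_left mm.scaleR_right bk)
    qed
  qed
  moreover have "?S ** eta k = eta k ** ?S" for k
    by (simp add: mm.add_left mm.add_right mm.scaleR_left mm.scaleR_right beta)
  moreover have "transpose ?S ** ?S = (?c * ?c + ?s * ?s) *\<^sub>R mat 1"
    by (simp add: transpose_add transpose_scaleR bt bb mm.add_left mm.add_right mm.scaleR_left mm.scaleR_right
       mm.minus_left mm.diff_left algebra_simps) (simp flip: scaleR_left_distrib)
  then have "orthogonal_matrix ?S"
    by (simp add: orthogonal_matrix sin_cos_squared_add3)
  ultimately show ?thesis by (simp add: spin_lift_def)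
qed

text \<open>The lift of a full turn to the spin group ends at \<open>-1\<close>.\<close>

lemma full_turn_not_nullhomotopic:
  fixes i j :: "'n::finite"
  assumes ij: "i \<noteq> j"
  shows "\<not> homotopic_paths SO (turns i j 1) (\<lambda>_. mat 1)"
proof
  interpret spin: discrete_quotient "spin_group :: ((real^'n^'n) \<times> (real^('n set)^('n set))) monoid"
    "top_of_set SO" fst spin_kernel
    by (rule discrete_quotient_spin_group)
  assume hom: "homotopic_paths SO (turns i j 1) (\<lambda>_. mat 1)"
  \<comment> \<open>The lift of one turn given by the half-angle formula at
    \<open>\<theta> = 2 * pi * t\<close>.\<close>
  define c :: "real \<Rightarrow> (real^'n^'n) \<times> (real^('n set)^('n set))"
    where "c t = (turns i j 1 t, cos (pi * t) *\<^sub>R mat 1 + sin (pi * t) *\<^sub>R (gam j ** gam i))" for t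
  have cG: "c t \<in> carrier spin_group" for t
    using spin_lift_plane_rot[OF ij, of "2 * pi * t"] plane_rot_SO[OF ij]
    by (simp add: spin_group_simps c_def turns_def)
  have "path c"
    unfolding c_def path_def using turns_loop(1)[OF ij] by (intro continuous_intros) (simp add: path_def)
  moreover have c01: "c 0 = (mat 1, mat 1)" "c 1 = (mat 1, - mat 1)"
    using turns_loop[OF ij] by (simp_all add: c_def)
  ultimately have c: "c \<in> spin.deck_paths"
    using cG unfolding spin.deck_paths_def by (auto simp: path_image_def spin_group_simps(3) spin_kernel_def)
  have "homotopic_with (\<lambda>r. pathstart r = pathstart (turns i j 1) \<and> pathfinish r = pathfinish (turns i j 1))
      (top_of_set {0..1}) (top_of_set SO) (turns i j 1) (\<lambda>_. mat 1)"
    using hom by (simp add: homotopic_paths_def)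
  then have "loop_homotopic (top_of_set SO) (mat 1) (turns i j 1) (\<lambda>_. mat 1)"
    unfolding loop_homotopic_def
    by (rule homotopic_with_mono) (use turns_loop[OF ij] in \<open>simp add: pathstart_def pathfinish_def\<close>)
  then have "loop_homotopic (top_of_set SO) (fst \<one>\<^bsub>spin_group\<^esub>) (fst \<circ> c) (fst \<circ> (\<lambda>_. \<one>\<^bsub>spin_group\<^esub>))"
    by (simp add: spin_group_simps c_def o_def)
  then have "homotopic_paths (carrier spin_group) c (\<lambda>_. \<one>\<^bsub>spin_group\<^esub>)"
    using spin.loop_homotopic_proj_iff[OF c spin.const_deck_path] by simp
  then have "c 1 = \<one>\<^bsub>spin_group\<^esub>"
    using homotopic_paths_imp_pathfinish by (fastforce simp: pathfinish_def)
  then have "(- mat 1 :: real^('n set)^('n set)) = mat 1" using c01 by (simp add: spin_group_simps)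
  from arg_cong[OF this, of "\<lambda>M. M $ {} $ {}"] show False by (simp add: mat_def)
qed

lemma turns_0: "i \<noteq> j \<Longrightarrow> turns i j 0 = (\<lambda>_. mat 1)"
  by (simp add: turns_def[abs_def] plane_rot_0)

text \<open>In the plane, the first column maps rotations to the punctured complex plane. Lifting
  the homotopy through the exponential keeps the end points of the angles, which determine the
  numbers of turns.\<close>

lemma turns_homotopic_imp_eq:
  fixes i j :: "'n::finite"
  assumes card: "CARD('n) = 2" and ij: "i \<noteq> j"
    and hom: "homotopic_paths SO (turns i j k) (turns i j m)"
  shows "k = m"
proof -
  have univ: "(UNIV :: 'n set) = {i, j}"
    by (rule card_seteq[symmetric]) (use card ij in auto)
  let ?z = "\<lambda>R :: real^'n^'n. Complex (R $ i $ i) (R $ j $ i)"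
  have nz: "?z R \<noteq> 0" if "R \<in> SO" for R
  proof
    assume "?z R = 0"
    then have "R *v axis i 1 = 0"
      using univ by (auto simp: matrix_vector_mult_basis column_def vec_eq_iff complex_eq_iff)
    then show False using SO_norm[OF that, of "axis i 1"] by (simp add: norm_axis_1)
  qed
  have "homotopic_paths (- {0}) (?z \<circ> turns i j k) (?z \<circ> turns i j m)"
  proof (rule homotopic_paths_continuous_image[OF hom])
    show "continuous_on SO ?z" unfolding Complex_eq by (intro continuous_intros)
  qed (use nz in auto)
  moreover have z: "(?z \<circ> turns i j k) t = exp (\<i> * complex_of_real (2 * pi * k * t))" for k t
    using ij by (simp add: turns_def plane_rot_def exp_eq_polar cis.ctr)
  ultimately have hom': "homotopic_paths (- {0}) (\<lambda>t. exp (\<i> * complex_of_real (2 * pi * k * t)))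
      (\<lambda>t. exp (\<i> * complex_of_real (2 * pi * m * t)))"
    unfolding o_def by (simp only:)
  have "homotopic_paths UNIV (\<lambda>t. \<i> * complex_of_real (2 * pi * k * t)) (\<lambda>t. \<i> * complex_of_real (2 * pi * m * t))"
    by (rule covering_space_lift_homotopic_paths[OF covering_space_exp_punctured_plane _ _ _ _ hom'])
      (auto simp: path_def path_image_def pathstart_def intro!: continuous_intros)
  then have "\<i> * complex_of_real (2 * pi * k) = \<i> * complex_of_real (2 * pi * m)"
    using homotopic_paths_imp_pathfinish by (fastforce simp: pathfinish_def)
  then show ?thesis by simp
qed

section \<open>Rigid motions\<close>

type_synonym 'n rigid = "(real^'n) \<times> (real^'n^'n)"

definition act :: "'n::finite rigid \<Rightarrow> real^'n \<Rightarrow> real^'n" where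
  "act g = (\<lambda>x. snd g *v x + fst g)"

text \<open>Pairs of a vector and a matrix live in a Euclidean space, as the locale of discrete
  quotients demands; \<open>act\<close> interprets them as maps. The product is composition of these
  maps.\<close>

definition SE :: "'n::finite rigid monoid" where
  "SE = \<lparr>carrier = UNIV \<times> SO,
    monoid.mult = (\<lambda>g h. (snd g *v fst h + fst g, snd g ** snd h)), one = (0, mat 1)\<rparr>"

abbreviation shift :: "real^'n \<Rightarrow> 'n::finite rigid" where
  "shift v \<equiv> (v, mat 1)"

lemma SE_simps:
  "g \<in> carrier SE \<longleftrightarrow> snd g \<in> SO"
  "g \<otimes>\<^bsub>SE\<^esub> h = (snd g *v fst h + fst g, snd g ** snd h)"
  "\<one>\<^bsub>SE\<^esub> = (0, mat 1)"
  by (auto simp: SE_def mem_Times_iff)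

lemma act_mult: "act (g \<otimes>\<^bsub>SE\<^esub> h) x = act g (act h x)"
  by (simp add: act_def SE_simps matrix_vector_mul_assoc[symmetric] matrix_vector_right_distrib)

lemma act_one: "act \<one>\<^bsub>SE\<^esub> x = x"
  by (simp add: act_def SE_simps)

lemma act_shift: "act (shift v) = (\<lambda>x. x + v)"
  by (simp add: act_def)

interpretation SE: group SE
proof (rule groupI)
  fix g :: "'a rigid" assume "g \<in> carrier SE"
  then show "\<exists>y\<in>carrier SE. y \<otimes>\<^bsub>SE\<^esub> g = \<one>\<^bsub>SE\<^esub>"
    using matrix_vector_mult_scaleR[of "transpose (snd g)" "-1" "fst g"]
    by (intro bexI[of _ "(- (transpose (snd g) *v fst g), transpose (snd g))"])
      (auto simp: SE_simps SO_transpose_mult SO_transpose simp del: transpose_matrix_vector)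
qed (auto simp: SE_simps SO_mult matrix_mul_assoc matrix_vector_mul_assoc[symmetric] matrix_vector_right_distrib)

lemma shift_in_SE: "shift v \<in> carrier SE"
  by (simp add: SE_simps)

lemma inv_SE:
  assumes "g \<in> carrier SE"
  shows "inv\<^bsub>SE\<^esub> g = (- (transpose (snd g) *v fst g), transpose (snd g))"
  using assms
  by (intro SE.inv_equality)
    (auto simp: SE_simps SO_transpose_mult SO_transpose simp del: transpose_matrix_vector)

lemma act_inv: "g \<in> carrier SE \<Longrightarrow> act (inv\<^bsub>SE\<^esub> g) (act g x) = x"
  and act_inv': "g \<in> carrier SE \<Longrightarrow> act g (act (inv\<^bsub>SE\<^esub> g) x) = x"
  by (simp_all flip: act_mult add: act_one)

lemma inj_act: "g \<in> carrier SE \<Longrightarrow> inj (act g)"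
  using act_inv by (metis injI)

lemma surj_act: "g \<in> carrier SE \<Longrightarrow> surj (act g)"
  using act_inv' by (metis surjI)

lemma act_diff: "act g x - act g y = snd g *v (x - y)"
  by (simp add: act_def matrix_vector_mult_diff_distrib)

lemma act_add: "act g (x + v) = act g x + snd g *v v"
  by (simp add: act_def matrix_vector_right_distrib)

lemma dist_act: "g \<in> carrier SE \<Longrightarrow> dist (act g x) (act g y) = dist x y"
  by (simp add: dist_norm act_diff SO_norm SE_simps)

lemma act_eqI:
  assumes "act g = act h" shows "g = h"
proof -
  have "fst g = fst h" using fun_cong[OF assms, of 0] by (simp add: act_def)
  moreover have "snd g = snd h"
    using fun_cong[OF assms] \<open>fst g = fst h\<close> by (simp add: act_def matrix_eq)
  ultimately show ?thesis by (simp add: prod_eq_iff)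
qed

text \<open>An isometry fixing the origin is linear and orthogonal, with determinant
  \<open>1\<close> or \<open>-1\<close>; positivity leaves \<open>1\<close>.\<close>

lemma pos_isometry_iff: "pos_isometry f \<longleftrightarrow> (\<exists>g\<in>carrier SE. f = act g)"
proof
  assume f: "pos_isometry f"
  let ?h = "\<lambda>x. f x - f 0"
  have h: "orthogonal_transformation ?h"
    using f unfolding orthogonal_transformation_isometry pos_isometry_def by (simp add: dist_norm)
  have o: "orthogonal_matrix (matrix ?h)" and w: "matrix ?h *v x = f x - f 0" for x
    using h orthogonal_transformation_matrix[of ?h]
      fun_cong[OF matrix_vector_mul(2)[OF orthogonal_transformation_linear[OF h]]] by simp_all
  have "det (matrix ?h) = 1"
    using det_orthogonal_matrix[OF o] f by (auto simp: pos_isometry_def)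
  then have "(f 0, matrix ?h) \<in> carrier SE" using o by (simp add: SE_simps SO_iff)
  moreover have "f = act (f 0, matrix ?h)" by (simp add: act_def w)
  ultimately show "\<exists>g\<in>carrier SE. f = act g" by blast
next
  assume "\<exists>g\<in>carrier SE. f = act g"
  then obtain g where g: "g \<in> carrier SE" "f = act g" by blast
  have "matrix (\<lambda>x. act g x - act g 0) = snd g" by (simp add: act_def)
  then show "pos_isometry f"
    using g by (auto simp: pos_isometry_def dist_act SE_simps SO_iff)
qed

section \<open>Rigid motions preserve bodies and their faces\<close>

lemma act_image: "act g ` X = (+) (fst g) ` ((*v) (snd g) ` X)"
  by (auto simp: act_def image_image add.commute)

lemma SO_inj: "R \<in> SO \<Longrightarrow> inj ((*v) R)"
  by (rule injI) (metis SO_transpose_mult matrix_vector_mul_assoc matrix_vector_mul_lid)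

lemma continuous_on_act [continuous_intros]:
  "continuous_on S f \<Longrightarrow> continuous_on S (\<lambda>x. act g (f x))"
  unfolding act_def by (intro continuous_intros)

lemma closure_act: "g \<in> carrier SE \<Longrightarrow> closure (act g ` X) = act g ` closure X"
  unfolding act_image closure_translation
  by (subst closure_injective_linear_image) (auto simp: SE_simps SO_inj)

lemma frontier_act:
  assumes "g \<in> carrier SE" shows "frontier (act g ` X) = act g ` frontier X"
proof -
  have "- (act g ` X) = act g ` (- X)"
    using bij_image_Compl_eq[of "act g" X] inj_act[OF assms] surj_act[OF assms] by (simp add: bij_def)
  then show ?thesis
    using assms by (simp add: frontier_closures closure_act image_Int[OF inj_act])
qed

text \<open>One inclusion is maximality of components. The other is the same inclusion for the
  inverse motion.\<close>

lemma connected_component_set_act: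
  assumes g: "g \<in> carrier SE"
  shows "connected_component_set (act g ` S) (act g x) = act g ` connected_component_set S x"
proof -
  have sub: "act g ` connected_component_set S x \<subseteq> connected_component_set (act g ` S) (act g x)"
    if "g \<in> carrier SE" for g :: "'a rigid" and S x
  proof (cases "x \<in> S")
    case True
    then show ?thesis
      using connected_component_subset[of S x]
      by (intro connected_component_maximal connected_continuous_image continuous_on_act
          continuous_on_id connected_connected_component) (auto simp: connected_component_refl)
  next
    case False
    then show ?thesis by (metis connected_component_eq_empty image_empty empty_subsetI)
  qed
  have "connected_component_set (act g ` S) (act g x) =
      act g ` (act (inv\<^bsub>SE\<^esub> g) ` connected_component_set (act g ` S) (act g x))"
    using g by (simp add: image_image act_inv')
  also have "\<dots> \<subseteq> act g ` connected_component_set (act (inv\<^bsub>SE\<^esub> g) ` act g ` S) (act (inv\<^bsub>SE\<^esub> g) (act g x))"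
    using sub[of "inv\<^bsub>SE\<^esub> g"] g by (intro image_mono) simp
  also have "\<dots> = act g ` connected_component_set S x" using g by (simp add: image_image act_inv)
  finally show ?thesis using sub[OF g] by blast
qed

text \<open>The linear part of \<open>g\<close> permutes the displacements of each length, so the
  test ball is preserved.\<close>

lemma locally_similar_act:
  assumes g: "g \<in> carrier SE"
  shows "locally_similar (act g ` P) (act g x) (act g y) \<longleftrightarrow> locally_similar P x y"
proof -
  have mem: "act g x + snd g *v v \<in> act g ` P \<longleftrightarrow> x + v \<in> P" for x v
    using inj_act[OF g] by (simp flip: act_add add: inj_image_mem_iff)
  have R: "snd g \<in> SO" using g by (simp add: SE_simps)
  have surj: "\<exists>v. w = snd g *v v \<and> norm v = norm w" for w
    using SO_mult_transpose[OF R] SO_norm[OF SO_transpose[OF R]]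
    by (intro exI[of _ "transpose (snd g) *v w"])
      (simp add: matrix_vector_mul_assoc del: transpose_matrix_vector)
  show ?thesis
    unfolding locally_similar_def
    by (metis mem surj SO_norm[OF R])
qed

lemma proper_faces_act:
  assumes g: "g \<in> carrier SE"
  shows "proper_faces (act g ` P) = (`) (act g) ` proper_faces P"
proof -
  have "{y. locally_similar (act g ` P) (act g x) y} = act g ` {y. locally_similar P x y}" for x
    using locally_similar_act[OF g] surj_act[OF g] by (auto simp: image_iff) (metis surjD)
  then show ?thesis
    using g by (simp add: proper_faces_def Setcompr_eq_image frontier_act image_image
        connected_component_set_act closure_act)
qed

lemma polyhedral_body_act:
  assumes g: "g \<in> carrier SE" and P: "polyhedral_body P" shows "polyhedral_body (act g ` P)"
proof -
  obtain F where F: "finite F" "F \<noteq> {}" "\<And>p. p \<in> F \<Longrightarrow> polytope p \<and> aff_dim p = int CARD('a)" "P = \<Union>F"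
    using P unfolding polyhedral_body_def by blast
  have inj: "inj ((*v) (snd g))" using g by (simp add: SE_simps SO_inj)
  have "polytope (act g ` p) \<and> aff_dim (act g ` p) = int CARD('a)" if "p \<in> F" for p
    unfolding act_image polytope_translation_eq aff_dim_translation_eq
    using F(3)[OF that] inj by (simp add: polytope_linear_image aff_dim_injective_linear_image)
  then show ?thesis
    unfolding polyhedral_body_def using F
    by (intro exI[of _ "(`) (act g) ` F"]) (auto simp: image_Union)
qed

section \<open>Moving tiles\<close>

lemma move_tile_act_mult: "move_tile (act (g \<otimes>\<^bsub>SE\<^esub> h)) t = move_tile (act g) (move_tile (act h) t)"
  by (simp add: move_tile_def image_image act_mult)

lemma move_tile_act_one: "move_tile (act \<one>\<^bsub>SE\<^esub>) t = t"
  by (simp add: move_tile_def act_one)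

lemma move_act_mult: "move (act (g \<otimes>\<^bsub>SE\<^esub> h)) S = move (act g) (move (act h) S)"
  by (simp add: move_def image_image move_tile_act_mult)

lemma move_act_one: "move (act \<one>\<^bsub>SE\<^esub>) S = S"
  by (simp add: move_def move_tile_act_one)

lemma move_act_inv: "g \<in> carrier SE \<Longrightarrow> move (act (inv\<^bsub>SE\<^esub> g)) (move (act g) S) = S"
  by (simp flip: move_act_mult add: move_act_one)

lemma move_act_cancel: "g \<in> carrier SE \<Longrightarrow> move (act g) S = move (act g) S' \<longleftrightarrow> S = S'"
  using move_act_inv by metis

lemma move_act_eq_iff:
  assumes "g \<in> carrier SE" "h \<in> carrier SE"
  shows "move (act g) S = move (act h) S' \<longleftrightarrow> move (act (inv\<^bsub>SE\<^esub> h \<otimes>\<^bsub>SE\<^esub> g)) S = S'"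
  using move_act_cancel[of "inv\<^bsub>SE\<^esub> h" "move (act g) S" "move (act h) S'"] assms
  by (simp add: move_act_mult move_act_inv)

lemma move_mono: "S \<subseteq> S' \<Longrightarrow> move f S \<subseteq> move f S'"
  by (auto simp: move_def)

lemma tilingD:
  assumes "tiling S"
  shows "t \<in> S \<Longrightarrow> polyhedral_body (fst t)" and "(\<Union>t\<in>S. fst t) = UNIV"
    and "\<lbrakk>t \<in> S; t' \<in> S; t \<noteq> t'\<rbrakk> \<Longrightarrow> fst t \<inter> fst t' \<subseteq> frontier (fst t) \<inter> frontier (fst t') \<and>
        fst t \<inter> fst t' = \<Union>(proper_faces (fst t) \<inter> proper_faces (fst t'))"
    and "\<exists>P. finite P \<and> (\<forall>t\<in>S. \<exists>p\<in>P. \<exists>v. t = move_tile (\<lambda>x. x + v) p)"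
proof -
  note A = assms[unfolded tiling_def]
  show "t \<in> S \<Longrightarrow> polyhedral_body (fst t)" by (rule bspec[OF conjunct1[OF A]])
  show "(\<Union>t\<in>S. fst t) = UNIV" by (rule conjunct1[OF conjunct2[OF A]])
  show "\<lbrakk>t \<in> S; t' \<in> S; t \<noteq> t'\<rbrakk> \<Longrightarrow> fst t \<inter> fst t' \<subseteq> frontier (fst t) \<inter> frontier (fst t') \<and>
        fst t \<inter> fst t' = \<Union>(proper_faces (fst t) \<inter> proper_faces (fst t'))"
    by (rule mp[OF bspec[OF bspec[OF conjunct1[OF conjunct2[OF conjunct2[OF A]]]]]])
  show "\<exists>P. finite P \<and> (\<forall>t\<in>S. \<exists>p\<in>P. \<exists>v. t = move_tile (\<lambda>x. x + v) p)"
    by (rule conjunct2[OF conjunct2[OF conjunct2[OF A]]])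
qed

lemma tiling_move:
  assumes g: "g \<in> carrier SE" and S: "tiling S" shows "tiling (move (act g) S)"
  unfolding tiling_def
proof (intro conjI ballI impI)
  note inj = inj_act[OF g]
  note S1 = tilingD(1)[OF S] and S2 = tilingD(2)[OF S] and S3 = tilingD(3)[OF S]
  obtain P where P: "finite P" "\<And>t. t \<in> S \<Longrightarrow> \<exists>p\<in>P. \<exists>v. t = move_tile (\<lambda>x. x + v) p"
    using tilingD(4)[OF S] by metis
  show "polyhedral_body (fst t)" if "t \<in> move (act g) S" for t
    using that S1 polyhedral_body_act[OF g] by (auto simp: move_def move_tile_def)
  have "(\<Union>t\<in>move (act g) S. fst t) = act g ` (\<Union>t\<in>S. fst t)"
    by (auto simp: move_def move_tile_def)
  then show "(\<Union>t\<in>move (act g) S. fst t) = UNIV" using S2 surj_act[OF g] by simp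
  show "fst t \<inter> fst t' \<subseteq> frontier (fst t) \<inter> frontier (fst t')"
       "fst t \<inter> fst t' = \<Union>(proper_faces (fst t) \<inter> proper_faces (fst t'))"
    if t: "t \<in> move (act g) S" "t' \<in> move (act g) S" "t \<noteq> t'" for t t'
  proof -
    obtain s s' where s: "s \<in> S" "s' \<in> S" "t = move_tile (act g) s" "t' = move_tile (act g) s'"
      using t(1,2) unfolding move_def by blast
    have "s \<noteq> s'" using s t by auto
    note 3 = S3[OF s(1,2) this]
    have i: "fst t \<inter> fst t' = act g ` (fst s \<inter> fst s')"
      using s by (simp add: move_tile_def image_Int[OF inj])
    show "fst t \<inter> fst t' \<subseteq> frontier (fst t) \<inter> frontier (fst t')"
      unfolding i using image_mono[OF conjunct1[OF 3], of "act g"] s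
      by (simp add: move_tile_def frontier_act[OF g] image_Int[OF inj])
    have inj2: "inj ((`) (act g))" using inj by (rule inj_on_image[OF inj_on_subset]) auto
    have "proper_faces (fst t) \<inter> proper_faces (fst t') = (`) (act g) ` (proper_faces (fst s) \<inter> proper_faces (fst s'))"
      using s by (simp add: move_tile_def proper_faces_act[OF g] image_Int[OF inj2])
    then show "fst t \<inter> fst t' = \<Union>(proper_faces (fst t) \<inter> proper_faces (fst t'))"
      unfolding i using 3 by (simp add: image_Union)
  qed
  show "\<exists>P. finite P \<and> (\<forall>t\<in>move (act g) S. \<exists>p\<in>P. \<exists>v. t = move_tile (\<lambda>x. x + v) p)"
  proof (intro exI[of _ "move (act g) P"] conjI ballI)
    show "finite (move (act g) P)" using P by (simp add: move_def)
    fix t assume "t \<in> move (act g) S"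
    then obtain s where s: "s \<in> S" "t = move_tile (act g) s" by (auto simp: move_def)
    obtain p v where pv: "p \<in> P" "s = move_tile (\<lambda>x. x + v) p" using P(2)[OF s(1)] by blast
    have "t = move_tile (\<lambda>x. x + snd g *v v) (move_tile (act g) p)"
      unfolding s pv by (simp add: move_tile_def image_image act_add)
    then show "\<exists>p\<in>move (act g) P. \<exists>v. t = move_tile (\<lambda>x. x + v) p"
      using pv by (auto simp: move_def)
  qed
qed

section \<open>Local finiteness\<close>

text \<open>A full-dimensional convex polytope is the closure of its interior, and this passes to
  finite unions.\<close>

lemma polyhedral_body_regular:
  assumes "polyhedral_body (P :: (real^'n::finite) set)"
  shows "compact P" "P \<subseteq> closure (interior P)" "interior P \<noteq> {}"
proof -
  obtain F where F: "finite F" "F \<noteq> {}" "\<And>p. p \<in> F \<Longrightarrow> polytope p \<and> aff_dim p = int CARD('n)" "P = \<Union>F"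
    using assms unfolding polyhedral_body_def by blast
  show "compact P" using F polytope_imp_compact by (auto intro!: compact_Union)
  have p: "interior p \<noteq> {} \<and> closure (interior p) = closure p" if "p \<in> F" for p
  proof -
    have "convex p" "aff_dim p = int DIM(real^'n)" "p \<noteq> {}"
      using F(3)[OF that] by (auto simp: polytope_imp_convex)
    then show ?thesis
      using interior_rel_interior[of p] rel_interior_eq_empty[of p] convex_closure_rel_interior[of p] by simp
  qed
  have sub: "interior p \<subseteq> interior P" if "p \<in> F" for p using that F(4) by (auto intro!: interior_mono)
  show "P \<subseteq> closure (interior P)"
  proof
    fix x assume "x \<in> P"
    then obtain q where q: "q \<in> F" "x \<in> q" using F(4) by blast
    then have "x \<in> closure (interior q)" using p closure_subset by blast
    then show "x \<in> closure (interior P)" using closure_mono[OF sub[OF q(1)]] by blast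
  qed
  show "interior P \<noteq> {}" using F(2) p sub by blast
qed

lemma tiling_tile:
  assumes "tiling S" "t \<in> S"
  shows "compact (fst t)" "fst t \<subseteq> closure (interior (fst t))" "interior (fst t) \<noteq> {}" "fst t \<noteq> {}"
  using polyhedral_body_regular[OF tilingD(1)[OF assms]] interior_subset[of "fst t"] by auto

lemma tiling_covers: "tiling S \<Longrightarrow> \<exists>t\<in>S. x \<in> fst t"
  using tilingD(2)[of S] by auto

lemma tiling_overlap:
  assumes "tiling S" "t \<in> S" "t' \<in> S" "x \<in> interior (fst t)" "x \<in> fst t'"
  shows "t = t'"
proof (rule ccontr)
  assume "t \<noteq> t'"
  then have "fst t \<inter> fst t' \<subseteq> frontier (fst t)" using tilingD(3)[OF assms(1-3)] by blast
  then have "x \<in> frontier (fst t)" using assms interior_subset by blast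
  then show False using assms by (simp add: frontier_def)
qed

text \<open>Up to translation there are finitely many shapes, so an inner radius and an outer radius
  can be chosen for all tiles at once, around a common centre in each tile.\<close>

lemma tiling_bounds:
  assumes "tiling S"
  obtains r D where "r > 0" "\<And>t. t \<in> S \<Longrightarrow> \<exists>c. ball c r \<subseteq> fst t \<and> fst t \<subseteq> cball c D"
proof -
  obtain P where P: "finite P" "\<And>t. t \<in> S \<Longrightarrow> \<exists>p\<in>P. \<exists>v. t = move_tile (\<lambda>x. x + v) p"
    using tilingD(4)[OF assms] by metis
  have "\<exists>r D. r > 0 \<and> (\<forall>t\<in>S. (\<exists>p\<in>P. \<exists>v. t = move_tile (\<lambda>x. x + v) p) \<longrightarrow>
      (\<exists>c. ball c r \<subseteq> fst t \<and> fst t \<subseteq> cball c D))"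
    using P(1)
  proof (induction P)
    case empty
    then show ?case by (auto intro: exI[of _ 1])
  next
    case (insert q P)
    then obtain r D where rD: "r > 0" "\<And>t. \<lbrakk>t \<in> S; \<exists>p\<in>P. \<exists>v. t = move_tile (\<lambda>x. x + v) p\<rbrakk> \<Longrightarrow>
        \<exists>c. ball c r \<subseteq> fst t \<and> fst t \<subseteq> cball c D" by blast
    show ?case
    proof (cases "\<exists>t\<in>S. \<exists>v. t = move_tile (\<lambda>x. x + v) q")
      \<comment> \<open>A prototile without a copy in \<open>S\<close> may have any shape, so it
        must not enter the bounds.\<close>
      case False
      then show ?thesis using rD by (intro exI[of _ r] exI[of _ D]) auto
    next
      case True
      then obtain v0 where t0: "move_tile (\<lambda>x. x + v0) q \<in> S" by blast
      let ?A = "(\<lambda>x. x + v0) ` fst q"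
      have A: "compact ?A" "interior ?A \<noteq> {}"
        using tiling_tile[OF assms t0] by (simp_all add: move_tile_def)
      then obtain c0 where "c0 \<in> interior ?A" by blast
      then obtain r0 where r0: "r0 > 0" "ball c0 r0 \<subseteq> ?A" by (auto simp: mem_interior)
      obtain D0 where D0: "?A \<subseteq> cball c0 D0"
        using compact_imp_bounded[OF A(1)] bounded_subset_ballD ball_subset_cball by (metis order_trans)
      have "\<exists>c. ball c (min r r0) \<subseteq> fst t \<and> fst t \<subseteq> cball c (max D D0)"
        if t: "t \<in> S" "p \<in> insert q P" "t = move_tile (\<lambda>x. x + v) p" for t p v
      proof (cases "p = q")
        case True
        have ft: "fst t = (\<lambda>x. x + (v - v0)) ` ?A" using t True by (simp add: move_tile_def image_image)
        have "ball (c0 + (v - v0)) r0 = (\<lambda>x. x + (v - v0)) ` ball c0 r0"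
          "cball (c0 + (v - v0)) D0 = (\<lambda>x. x + (v - v0)) ` cball c0 D0"
          using ball_translation[of "v - v0" c0 r0] cball_translation[of "v - v0" c0 D0]
          by (simp_all add: add.commute)
        then have "ball (c0 + (v - v0)) r0 \<subseteq> fst t" "fst t \<subseteq> cball (c0 + (v - v0)) D0"
          unfolding ft using r0 D0 by auto
        moreover have "ball (c0 + (v - v0)) (min r r0) \<subseteq> ball (c0 + (v - v0)) r0"
          "cball (c0 + (v - v0)) D0 \<subseteq> cball (c0 + (v - v0)) (max D D0)" by auto
        ultimately show ?thesis by (meson order_trans)
      next
        case False
        then obtain c where c: "ball c r \<subseteq> fst t" "fst t \<subseteq> cball c D" using rD(2) t by blast
        moreover have "ball c (min r r0) \<subseteq> ball c r" "cball c D \<subseteq> cball c (max D D0)" by auto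
        ultimately show ?thesis by (meson order_trans)
      qed
      then have "\<forall>t\<in>S. (\<exists>p\<in>insert q P. \<exists>v. t = move_tile (\<lambda>x. x + v) p) \<longrightarrow>
          (\<exists>c. ball c (min r r0) \<subseteq> fst t \<and> fst t \<subseteq> cball c (max D D0))" by metis
      moreover have "min r r0 > 0" using rD(1) r0(1) by simp
      ultimately show ?thesis by metis
    qed
  qed
  then show thesis using that P(2) by metis
qed

text \<open>A packing argument: centres at distance less than \<open>r\<close> would put one centre
  in the interior of the other tile. So the centres of tiles meeting \<open>A\<close> form a bounded
  uniformly discrete set.\<close>

lemma tiling_locally_finite:
  assumes S: "tiling S" and A: "bounded A"
  shows "finite {t \<in> S. fst t \<inter> A \<noteq> {}}"
proof -
  obtain r D where r: "r > 0" "\<And>t. t \<in> S \<Longrightarrow> \<exists>c. ball c r \<subseteq> fst t \<and> fst t \<subseteq> cball c D"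
    using tiling_bounds[OF S] by metis
  then obtain c where c: "\<And>t. t \<in> S \<Longrightarrow> ball (c t) r \<subseteq> fst t \<and> fst t \<subseteq> cball (c t) D" by metis
  let ?F = "{t \<in> S. fst t \<inter> A \<noteq> {}}"
  have sep: "t = t'" if "t \<in> S" "t' \<in> S" "dist (c t) (c t') < r" for t t'
  proof (rule tiling_overlap[OF S that(1,2)])
    show "c t' \<in> interior (fst t)"
      using c[OF that(1)] that(3) by (meson interior_maximal mem_ball open_ball subsetD)
    show "c t' \<in> fst t'" using c[OF that(2)] r(1) by (meson centre_in_ball subsetD)
  qed
  obtain a M where M: "A \<subseteq> cball a M" using A bounded_subset_ballD ball_subset_cball by (metis order_trans)
  have "dist a (c t) \<le> M + D" if t: "t \<in> ?F" for t
  proof -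
    obtain x where "x \<in> fst t" "x \<in> A" "t \<in> S" using t by auto
    then have "dist (c t) x \<le> D" "dist a x \<le> M" using c[of t] M by (auto simp del: split_paired_All)
    then show ?thesis using dist_triangle[of a "c t" x] by (simp add: dist_commute)
  qed
  then have "c ` ?F \<subseteq> cball a (M + D)" by (intro image_subsetI) (simp only: mem_cball)
  then have "bounded (c ` ?F)" by (rule bounded_subset[OF bounded_cball])
  moreover have "uniform_discrete (c ` ?F)"
    unfolding uniform_discrete_def using r(1) sep by (intro exI[of _ r]) auto
  ultimately have "finite (c ` ?F)" using uniform_discrete_finite_iff by blast
  moreover have "inj_on c ?F" using sep r(1) by (intro inj_onI) auto
  ultimately show ?thesis by (rule finite_imageD)
qed

section \<open>Periods\<close>

definition periods :: "('n::finite, 'l) tile set \<Rightarrow> (real^'n) set" where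
  "periods S = {v. move (act (shift v)) S = S}"

lemma mem_move_iff:
  assumes "g \<in> carrier SE"
  shows "t \<in> move (act g) S \<longleftrightarrow> move_tile (act (inv\<^bsub>SE\<^esub> g)) t \<in> S"
proof -
  have "move_tile (act g) (move_tile (act (inv\<^bsub>SE\<^esub> g)) t) = t"
    "move_tile (act (inv\<^bsub>SE\<^esub> g)) (move_tile (act g) t) = t" for t :: "('a, 'b) tile"
    using assms by (simp_all flip: move_tile_act_mult add: move_tile_act_one)
  note inv = this
  show ?thesis
  proof
    assume "t \<in> move (act g) S"
    then obtain s where "s \<in> S" "t = move_tile (act g) s" unfolding move_def by blast
    then show "move_tile (act (inv\<^bsub>SE\<^esub> g)) t \<in> S" using inv(2)[of s] by simp
  next
    assume "move_tile (act (inv\<^bsub>SE\<^esub> g)) t \<in> S"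
    then have "move_tile (act g) (move_tile (act (inv\<^bsub>SE\<^esub> g)) t) \<in> move (act g) S"
      unfolding move_def by (rule imageI)
    then show "t \<in> move (act g) S" unfolding inv(1) .
  qed
qed

lemma inv_shift: "inv\<^bsub>SE\<^esub> (shift v) = shift (- v)"
  by (simp add: inv_SE shift_in_SE)

lemma shift_mult: "shift u \<otimes>\<^bsub>SE\<^esub> shift v = shift (v + u)"
  by (simp add: SE_simps)

lemma move_shift_shift: "move (act (shift u)) (move (act (shift v)) S) = move (act (shift (v + u))) S"
  by (simp flip: move_act_mult add: shift_mult)

lemma periods_0: "0 \<in> periods S"
  using move_act_one by (simp add: periods_def SE_simps)

lemma periods_add: "\<lbrakk>u \<in> periods S; v \<in> periods S\<rbrakk> \<Longrightarrow> u + v \<in> periods S"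
  using move_shift_shift[of v u S] by (simp add: periods_def)

lemma periods_minus: "u \<in> periods S \<Longrightarrow> - u \<in> periods S"
  using move_act_inv[OF shift_in_SE, of u S] by (simp add: periods_def inv_shift)

lemma periods_of_nat: "u \<in> periods S \<Longrightarrow> of_nat n *\<^sub>R u \<in> periods S"
  by (induction n) (simp_all add: periods_0 periods_add scaleR_add_left)

lemma periods_of_int: "u \<in> periods S \<Longrightarrow> of_int k *\<^sub>R u \<in> periods S"
  using periods_of_nat[of u S "nat k"] periods_minus[OF periods_of_nat[of u S "nat (- k)"]]
  by (cases "k \<ge> 0") simp_all

lemma periods_sum:
  assumes "finite B" "B \<subseteq> periods S"
  shows "(\<Sum>b\<in>B. of_int (c b) *\<^sub>R b) \<in> periods S"
  using assms by (induction B) (simp_all add: periods_0 periods_add periods_of_int)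

text \<open>Conjugating a translation by \<open>g\<close> rotates its vector by the linear part of
  \<open>g\<close>.\<close>

lemma periods_move:
  assumes g: "g \<in> carrier SE" and v: "v \<in> periods S"
  shows "snd g *v v \<in> periods (move (act g) S)"
proof -
  have "shift (snd g *v v) \<otimes>\<^bsub>SE\<^esub> g = g \<otimes>\<^bsub>SE\<^esub> shift v"
    by (simp add: SE_simps add.commute)
  then show ?thesis using v by (simp add: periods_def flip: move_act_mult) (simp add: move_act_mult)
qed

text \<open>Integer parts of the coordinates are removed; the fractional parts are less than one,
  whence the bound by the sum of the norms.\<close>

lemma lattice_reduce:
  fixes B :: "'a::real_normed_vector set"
  assumes "finite B" "span B = UNIV"
  obtains c :: "'a \<Rightarrow> int" where "norm (x - (\<Sum>b\<in>B. of_int (c b) *\<^sub>R b)) \<le> (\<Sum>b\<in>B. norm b)"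
proof -
  have "x \<in> range (\<lambda>u. \<Sum>b\<in>B. u b *\<^sub>R b)" using assms span_finite[of B] by auto
  then obtain u where u: "x = (\<Sum>b\<in>B. u b *\<^sub>R b)" by blast
  have "norm (x - (\<Sum>b\<in>B. of_int \<lfloor>u b\<rfloor> *\<^sub>R b)) = norm (\<Sum>b\<in>B. frac (u b) *\<^sub>R b)"
    unfolding u frac_def by (simp add: sum_subtractf scaleR_diff_left)
  also have "\<dots> \<le> (\<Sum>b\<in>B. norm (frac (u b) *\<^sub>R b))" by (rule norm_sum)
  also have "\<dots> \<le> (\<Sum>b\<in>B. norm b)"
    by (intro sum_mono) (auto intro!: mult_left_le_one_le simp: less_imp_le[OF frac_lt_1])
  finally show thesis by (rule that)
qed

lemma periodic_tiling_basis:
  fixes T :: "('n::finite, 'l) tile set"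
  assumes "periodic_tiling T"
  obtains B where "finite B" "span B = UNIV" "B \<subseteq> periods T"
proof -
  obtain B where B: "independent B" "span B = (UNIV :: (real^'n) set)"
    "{v. move (\<lambda>x. x + v) T = T} = {\<Sum>b\<in>B. of_int (c b) *\<^sub>R b | c :: real^'n \<Rightarrow> int. True}"
    using assms unfolding periodic_tiling_def full_rank_lattice_def by blast
  have fin: "finite B" using B(1) by (rule independent_imp_finite)
  have "b \<in> periods T" if "b \<in> B" for b
  proof -
    have "b = (\<Sum>b'\<in>B. of_int (if b' = b then 1 else 0) *\<^sub>R b')"
      using fin that by (simp add: if_distrib[of of_int] if_distrib[of "\<lambda>c. c *\<^sub>R _"] cong: if_cong)
    then have "b \<in> {v. move (\<lambda>x. x + v) T = T}"
      unfolding B(3) by (intro CollectI exI[of _ "\<lambda>b'. if b' = b then 1 else 0"] conjI TrueI)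
    then show ?thesis by (simp add: periods_def act_shift)
  qed
  then show thesis using that fin B(2) by blast
qed

section \<open>Agreement of tilings on large balls\<close>

lemma agree_onD: "\<lbrakk>agree_on A S S'; t \<in> S; fst t \<inter> A \<noteq> {}\<rbrakk> \<Longrightarrow> t \<in> S'"
  unfolding agree_on_def by blast

lemma agree_on_sym: "agree_on A S S' \<Longrightarrow> agree_on A S' S"
  unfolding agree_on_def by simp

lemma agree_on_trans: "\<lbrakk>agree_on A S S'; agree_on A S' S''\<rbrakk> \<Longrightarrow> agree_on A S S''"
  unfolding agree_on_def by simp

lemma agree_onI:
  assumes "\<And>t. \<lbrakk>t \<in> S; fst t \<inter> A \<noteq> {}\<rbrakk> \<Longrightarrow> t \<in> S'" "\<And>t. \<lbrakk>t \<in> S'; fst t \<inter> A \<noteq> {}\<rbrakk> \<Longrightarrow> t \<in> S"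
  shows "agree_on A S S'"
  unfolding agree_on_def using assms by blast

lemma agree_on_move:
  assumes g: "g \<in> carrier SE" and "agree_on A S S'"
  shows "agree_on (act g ` A) (move (act g) S) (move (act g) S')"
proof -
  have meet: "fst (move_tile (act g) t) \<inter> act g ` A \<noteq> {} \<longleftrightarrow> fst t \<inter> A \<noteq> {}" for t :: "('a, 'b) tile"
    by (simp add: move_tile_def flip: image_Int[OF inj_act[OF g]])
  have "{t \<in> move (act g) S. fst t \<inter> act g ` A \<noteq> {}} = move_tile (act g) ` {t \<in> S. fst t \<inter> A \<noteq> {}}"
    for S :: "('a, 'b) tile set"
    unfolding move_def using meet by blast
  then show ?thesis using assms(2) by (simp add: agree_on_def)
qed

lemma agree_on_all_balls_eq:
  assumes "tiling S" "tiling S'" "\<And>n. n \<ge> N \<Longrightarrow> agree_on (ball 0 (real n)) S S'"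
  shows "S = S'"
proof -
  have "t \<in> S'" if A: "tiling S" "t \<in> S" "\<And>n. n \<ge> N \<Longrightarrow> agree_on (ball 0 (real n)) S S'" for t and S S' :: "('a, 'b) tile set"
  proof -
    obtain x where x: "x \<in> fst t" using tiling_tile(4)[OF A(1,2)] by blast
    obtain m :: nat where "norm x < m" using reals_Archimedean2 by blast
    then have "x \<in> fst t \<inter> ball 0 (real (max m N))" using x by simp
    then show ?thesis using agree_onD[OF A(3)[of "max m N"] A(2)] by fastforce
  qed
  from this[of S _ S'] this[of S' _ S] show ?thesis using assms agree_on_sym by blast
qed

text \<open>A common spanning set of periods moves a point of any tile into the ball, where the
  tilings agree, and moves the tile back in the other tiling.\<close>

lemma agree_periodic_eq:
  assumes B: "finite B" "span B = UNIV" "B \<subseteq> periods S" "B \<subseteq> periods S'"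
    and S: "tiling S" "tiling S'" and R: "(\<Sum>b\<in>B. norm b) < R" "agree_on (ball 0 R) S S'"
  shows "S = S'"
proof -
  have "t \<in> S'" if A: "tiling S" "t \<in> S" "B \<subseteq> periods S" "B \<subseteq> periods S'" "agree_on (ball 0 R) S S'"
    for t and S S' :: "('a, 'b) tile set"
  proof -
    obtain x where x: "x \<in> fst t" using tiling_tile(4)[OF A(1,2)] by blast
    obtain c :: "_ \<Rightarrow> int" where c: "norm (x - (\<Sum>b\<in>B. of_int (c b) *\<^sub>R b)) \<le> (\<Sum>b\<in>B. norm b)"
      using lattice_reduce[OF B(1,2)] by blast
    let ?l = "\<Sum>b\<in>B. of_int (c b) *\<^sub>R b" and ?t = "move_tile (act (shift (- (\<Sum>b\<in>B. of_int (c b) *\<^sub>R b)))) t"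
    have l: "?l \<in> periods S" "?l \<in> periods S'" using periods_sum[OF B(1)] A by blast+
    have iff: "?t \<in> U \<longleftrightarrow> t \<in> U" if "?l \<in> periods U" for U :: "('a, 'b) tile set"
      using mem_move_iff[OF shift_in_SE, of t ?l U] that by (simp add: inv_shift periods_def)
    have "x - ?l \<in> fst ?t \<inter> ball 0 R" using x c R(1) by (auto simp: move_tile_def act_shift)
    then have "?t \<in> S'" using agree_onD[OF A(5), of ?t] iff[OF l(1)] A(2) by blast
    then show ?thesis using iff[OF l(2)] by simp
  qed
  from this[of S _ S'] this[of S' _ S] show ?thesis using assms agree_on_sym by blast
qed

text \<open>A point of the compact set that is extreme in the direction \<open>u - v\<close> would
  be surpassed by its translate.\<close>

lemma compact_shift_eq:
  fixes A :: "(real^'n::finite) set"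
  assumes "compact A" "A \<noteq> {}" "(\<lambda>x. x + u) ` A = (\<lambda>x. x + v) ` A"
  shows "u = v"
proof (rule ccontr)
  assume "u \<noteq> v"
  obtain x where x: "x \<in> A" "\<And>y. y \<in> A \<Longrightarrow> y \<bullet> (u - v) \<le> x \<bullet> (u - v)"
  proof -
    have "continuous_on A (\<lambda>y. y \<bullet> (u - v))" by (intro continuous_intros)
    from continuous_attains_sup[OF assms(1,2) this] show thesis using that by blast
  qed
  have "x + u \<in> (\<lambda>x. x + v) ` A" using x(1) assms(3) by blast
  then obtain y where y: "y \<in> A" "x + u = y + v" by blast
  then have "y = x + (u - v)" by (simp add: algebra_simps)
  then have "(u - v) \<bullet> (u - v) \<le> 0" using x(2)[OF y(1)] by (simp add: inner_add_left)
  moreover have "(u - v) \<bullet> (u - v) > 0" using \<open>u \<noteq> v\<close> by simp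
  ultimately show False by simp
qed

lemma shift_tile_eq:
  assumes "tiling S" "t \<in> S" "move_tile (act (shift u)) t = move_tile (act (shift v)) t"
  shows "u = v"
  using compact_shift_eq[OF tiling_tile(1,4)[OF assms(1,2)]] assms(3) by (simp add: move_tile_def act_shift)

text \<open>A translation by at most \<open>M\<close> that agrees with \<open>T\<close> near the
  origin carries \<open>t0\<close> to one of finitely many tiles. So there are finitely many
  candidates, and each one that is not a period already fails on some ball.\<close>

lemma local_periods:
  fixes T :: "('n::finite, 'l) tile set"
  assumes T: "tiling T"
  obtains R where "\<And>v. \<lbrakk>norm v \<le> M; agree_on (ball 0 R) (move (act (shift v)) T) T\<rbrakk> \<Longrightarrow> v \<in> periods T"
proof -
  obtain t0 where t0: "t0 \<in> T" "0 \<in> fst t0" using tiling_covers[OF T] by blast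
  define V where "V = {v. norm v \<le> M \<and> move_tile (act (shift v)) t0 \<in> T}"
  have "(\<lambda>v. move_tile (act (shift v)) t0) ` V \<subseteq> {t \<in> T. fst t \<inter> cball 0 M \<noteq> {}}"
  proof
    fix t assume "t \<in> (\<lambda>v. move_tile (act (shift v)) t0) ` V"
    then obtain v where v: "norm v \<le> M" "t \<in> T" "t = move_tile (act (shift v)) t0" by (auto simp: V_def)
    have "v \<in> fst t" unfolding v using t0 by (force simp: move_tile_def act_shift)
    then show "t \<in> {t \<in> T. fst t \<inter> cball 0 M \<noteq> {}}" using v by auto
  qed
  then have "finite ((\<lambda>v. move_tile (act (shift v)) t0) ` V)"
    using tiling_locally_finite[OF T bounded_cball] finite_subset by blast
  moreover have "inj_on (\<lambda>v. move_tile (act (shift v)) t0) V"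
    using shift_tile_eq[OF T t0(1)] by (rule inj_onI)
  ultimately have finV: "finite V" by (rule finite_imageD)
  have "\<exists>r. \<not> agree_on (ball 0 r) (move (act (shift v)) T) T" if "v \<notin> periods T" for v
    using agree_on_all_balls_eq[OF tiling_move[OF shift_in_SE T] T, of 0 v] that by (auto simp: periods_def)
  then obtain r where r: "\<And>v. v \<notin> periods T \<Longrightarrow> \<not> agree_on (ball 0 (r v)) (move (act (shift v)) T) T"
    by metis
  \<comment> \<open>The first terms make the ball meet the translate of \<open>t0\<close>; the sum
    dominates every radius on which a candidate fails.\<close>
  define R where "R = \<bar>M\<bar> + 1 + (\<Sum>v\<in>V. \<bar>r v\<bar>)"
  have "0 \<le> (\<Sum>v\<in>V. \<bar>r v\<bar>)" by (intro sum_nonneg) auto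
  then have R1: "M < R" unfolding R_def by linarith
  have Rr: "r v \<le> R" if "v \<in> V" for v
    using member_le_sum[of v V "\<lambda>v. \<bar>r v\<bar>"] that finV by (simp add: R_def)
  show thesis
  proof (rule that[of R], rule ccontr)
    fix v assume v: "norm v \<le> M" "agree_on (ball 0 R) (move (act (shift v)) T) T" "v \<notin> periods T"
    let ?t = "move_tile (act (shift v)) t0"
    have "?t \<in> move (act (shift v)) T" using t0 by (simp add: move_def)
    moreover have "v \<in> fst ?t \<inter> ball 0 R" using t0 v R1 by (force simp: move_tile_def act_shift)
    ultimately have "?t \<in> T" using agree_onD[OF v(2)] by blast
    then have "v \<in> V" using v by (simp add: V_def)
    then have "agree_on (ball 0 (r v)) (move (act (shift v)) T) T"
      using agree_on_subset[OF v(2)] Rr by (simp add: subset_ball)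
    then show False using r v by blast
  qed
qed

lemma meets_ball_shift:
  assumes "fst t \<inter> ball 0 R \<noteq> {}" "norm v \<le> M"
  shows "fst (move_tile (act (shift v)) t) \<inter> ball 0 (R + M) \<noteq> {}"
proof -
  obtain x where x: "x \<in> fst t" "norm x < R" using assms by auto
  have "norm (x + v) < R + M" using norm_triangle_ineq[of x v] x assms by simp
  then have "x + v \<in> fst (move_tile (act (shift v)) t) \<inter> ball 0 (R + M)"
    using x by (simp add: move_tile_def act_shift)
  then show ?thesis by blast
qed

text \<open>The rotated basis vectors are periods of the moved tiling. Agreement on a large ball
  makes them look like periods of \<open>T\<close> near the origin, and \<open>local_periods\<close>
  makes them true periods of \<open>T\<close>. With a common spanning set of periods the tilings
  coincide.\<close>

lemma rigidity_at_origin: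
  fixes T :: "('n::finite, 'l) tile set"
  assumes T: "periodic_tiling T"
  obtains R where "\<And>g. \<lbrakk>g \<in> carrier SE; agree_on (ball 0 R) (move (act g) T) T\<rbrakk> \<Longrightarrow> move (act g) T = T"
proof -
  have til: "tiling T" using T by (simp add: periodic_tiling_def)
  obtain B where B: "finite B" "span B = UNIV" "B \<subseteq> periods T" using periodic_tiling_basis[OF T] by blast
  define M where "M = (\<Sum>b\<in>B. norm b)"
  have M0: "M \<ge> 0" by (simp add: M_def sum_nonneg)
  have bM: "norm b \<le> M" if "b \<in> B" for b
    unfolding M_def using member_le_sum[of b B norm] that B(1) by simp
  obtain R1 where R1: "\<And>v. \<lbrakk>norm v \<le> M; agree_on (ball 0 R1) (move (act (shift v)) T) T\<rbrakk> \<Longrightarrow> v \<in> periods T"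
    using local_periods[OF til, of M] by blast
  \<comment> \<open>The radius leaves room for tiles that meet the ball of radius \<open>R1\<close>
    and are then shifted by at most \<open>M\<close>, and it exceeds \<open>M\<close> as
    \<open>agree_periodic_eq\<close> requires.\<close>
  define R where "R = \<bar>R1\<bar> + M + 1"
  show thesis
  proof (rule that[of R])
    fix g :: "'n rigid" assume g: "g \<in> carrier SE" and ag: "agree_on (ball 0 R) (move (act g) T) T"
    have gR: "snd g \<in> SO" using g by (simp add: SE_simps)
    let ?Q = "\<lambda>b. snd g *v b"
    have per: "?Q b \<in> periods (move (act g) T)" if "b \<in> B" for b
      using periods_move[OF g] B(3) that by blast
    \<comment> \<open>A tile near the origin is transferred to the moved tiling, shifted there by
      its period, and transferred back.\<close>
    have perT: "?Q b \<in> periods T" if "b \<in> B" for b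
    proof (rule R1)
      let ?v = "?Q b"
      show nv: "norm ?v \<le> M" using bM[OF that] SO_norm[OF gR] by simp
      have sub: "ball 0 R1 \<subseteq> ball (0::real^'n) R" and sub': "ball 0 (R1 + M) \<subseteq> ball (0::real^'n) R"
        using M0 by (auto simp: R_def)
      have iff: "move_tile (act (shift (- ?v))) t \<in> move (act g) T \<longleftrightarrow> t \<in> move (act g) T" for t :: "('n, 'l) tile"
        using mem_move_iff[OF shift_in_SE, of t ?v "move (act g) T"] per[OF that] by (simp add: inv_shift periods_def)
      have iffT: "t \<in> move (act (shift ?v)) T \<longleftrightarrow> move_tile (act (shift (- ?v))) t \<in> T" for t :: "('n, 'l) tile"
        using mem_move_iff[OF shift_in_SE, of t ?v T] by (simp add: inv_shift)
      show "agree_on (ball 0 R1) (move (act (shift ?v)) T) T"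
      proof (rule agree_onI)
        fix t :: "('n, 'l) tile" assume t: "fst t \<inter> ball 0 R1 \<noteq> {}"
        have t': "fst (move_tile (act (shift (- ?v))) t) \<inter> ball 0 R \<noteq> {}"
          using meets_ball_shift[OF t, of "- ?v" M] nv sub' by auto
        have tR: "fst t \<inter> ball 0 R \<noteq> {}" using t sub by blast
        show "t \<in> T" if "t \<in> move (act (shift ?v)) T"
        proof -
          have "move_tile (act (shift (- ?v))) t \<in> move (act g) T"
            using agree_onD[OF agree_on_sym[OF ag] _ t'] that iffT by blast
          then have "t \<in> move (act g) T" using iff by blast
          then show ?thesis using agree_onD[OF ag _ tR] by blast
        qed
        show "t \<in> move (act (shift ?v)) T" if "t \<in> T"
        proof -
          have "t \<in> move (act g) T" using agree_onD[OF agree_on_sym[OF ag] that tR] .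
          then have "move_tile (act (shift (- ?v))) t \<in> move (act g) T" using iff by blast
          then show ?thesis using agree_onD[OF ag _ t'] iffT by blast
        qed
      qed
    qed
    have inj: "inj ?Q" using SO_inj[OF gR] .
    show "move (act g) T = T"
    proof (rule agree_periodic_eq[of "?Q ` B"])
      show "finite (?Q ` B)" using B by simp
      have "surj ?Q" using surj_act[OF g] by (metis act_diff inj linear_injective_imp_surjective matrix_vector_mul_linear)
      then show "span (?Q ` B) = UNIV"
        using B(2) by (simp add: linear_span_image[OF matrix_vector_mul_linear])
      show "(\<Sum>b\<in>?Q ` B. norm b) < R"
        using inj M0 by (simp add: sum.reindex[OF inj_on_subset[OF inj subset_UNIV]] SO_norm[OF gR] R_def M_def)
      show "?Q ` B \<subseteq> periods (move (act g) T)" "?Q ` B \<subseteq> periods T" using per perT by auto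
      show "tiling (move (act g) T)" by (rule tiling_move[OF g til])
    qed (rule til ag)+
  qed
qed

lemma act_image_ball:
  assumes g: "g \<in> carrier SE" shows "act g ` ball x r = ball (act g x) r"
proof -
  have "y \<in> act g ` ball x r" if "y \<in> ball (act g x) r" for y
    using that act_inv'[OF g, of y] dist_act[OF g, of x "act (inv\<^bsub>SE\<^esub> g) y"]
    by (intro image_eqI[of _ _ "act (inv\<^bsub>SE\<^esub> g) y"]) auto
  then show ?thesis using dist_act[OF g] by auto
qed

text \<open>The pair is moved back so that the second tiling becomes \<open>T\<close>. The ball
  follows to some distant centre, but a period of \<open>T\<close> returns this centre to within
  \<open>D\<close> of the origin, so one radius works for all \<open>g\<close> and
  \<open>h\<close>.\<close>

lemma rigidity:
  fixes T :: "('n::finite, 'l) tile set"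
  assumes T: "periodic_tiling T"
  obtains R where "R > 0" "\<And>g h. \<lbrakk>g \<in> carrier SE; h \<in> carrier SE;
      agree_on (ball 0 R) (move (act g) T) (move (act h) T)\<rbrakk> \<Longrightarrow> move (act g) T = move (act h) T"
proof -
  obtain R0 where R0: "\<And>g. \<lbrakk>g \<in> carrier SE; agree_on (ball 0 R0) (move (act g) T) T\<rbrakk> \<Longrightarrow> move (act g) T = T"
    using rigidity_at_origin[OF T] by blast
  obtain B where B: "finite B" "span B = UNIV" "B \<subseteq> periods T" using periodic_tiling_basis[OF T] by blast
  define D where "D = (\<Sum>b\<in>B. norm b)"
  have D0: "D \<ge> 0" by (simp add: D_def sum_nonneg)
  show thesis
  proof (rule that[of "\<bar>R0\<bar> + D + 1"])
    show "\<bar>R0\<bar> + D + 1 > 0" using D0 by simp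
    fix g h :: "'n rigid"
    assume g: "g \<in> carrier SE" and h: "h \<in> carrier SE"
      and ag: "agree_on (ball 0 (\<bar>R0\<bar> + D + 1)) (move (act g) T) (move (act h) T)"
    let ?ih = "inv\<^bsub>SE\<^esub> h"
    let ?p = "act ?ih 0"
    obtain c :: "_ \<Rightarrow> int" where c: "norm (?p - (\<Sum>b\<in>B. of_int (c b) *\<^sub>R b)) \<le> D"
      unfolding D_def by (rule lattice_reduce[OF B(1,2)])
    define l where "l = (\<Sum>b\<in>B. of_int (c b) *\<^sub>R b)"
    have l: "- l \<in> periods T" unfolding l_def using periods_sum[OF B(1,3)] periods_minus by blast
    \<comment> \<open>The inverse of \<open>h\<close> followed by the period that brings the image
      of the origin near the origin again.\<close>
    let ?k = "shift (- l) \<otimes>\<^bsub>SE\<^esub> ?ih"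
    have k: "?k \<in> carrier SE" using h by (simp add: shift_in_SE)
    have kh: "move (act ?k) (move (act h) T) = T"
      using l h by (simp add: move_act_mult move_act_inv periods_def)
    have "act ?k 0 = ?p - l" by (simp add: act_mult act_shift)
    then have "agree_on (ball (?p - l) (\<bar>R0\<bar> + D + 1)) (move (act ?k) (move (act g) T)) T"
      using agree_on_move[OF k ag] kh by (simp add: act_image_ball[OF k])
    moreover have "ball 0 R0 \<subseteq> ball (?p - l) (\<bar>R0\<bar> + D + 1)"
    proof
      fix y :: "real^'n" assume "y \<in> ball 0 R0"
      then have "norm y < R0" by simp
      moreover have "dist (?p - l) y \<le> norm (?p - l) + norm y" by (simp add: dist_norm norm_triangle_ineq4)
      moreover have "norm (?p - l) \<le> D" using c by (simp add: l_def)
      ultimately show "y \<in> ball (?p - l) (\<bar>R0\<bar> + D + 1)" by simp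
    qed
    ultimately have "agree_on (ball 0 R0) (move (act (?k \<otimes>\<^bsub>SE\<^esub> g)) T) T"
      using agree_on_subset by (simp add: move_act_mult)
    then have "move (act (?k \<otimes>\<^bsub>SE\<^esub> g)) T = T" using R0 k g by simp
    then have "move (act ?k) (move (act g) T) = move (act ?k) (move (act h) T)"
      using kh by (simp add: move_act_mult)
    then show "move (act g) T = move (act h) T" using move_act_cancel[OF k] by blast
  qed
qed

section \<open>The hull is an orbit\<close>

definition stabilizer :: "('n::finite, 'l) tile set \<Rightarrow> 'n rigid set" where
  "stabilizer T = {g \<in> carrier SE. move (act g) T = T}"

lemma subgroup_stabilizer: "subgroup (stabilizer T) SE"
proof (rule SE.subgroupI)
  have "\<one>\<^bsub>SE\<^esub> \<in> stabilizer T" using move_act_one by (simp add: stabilizer_def)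
  then show "stabilizer T \<noteq> {}" by blast
  show "inv\<^bsub>SE\<^esub> g \<in> stabilizer T" if "g \<in> stabilizer T" for g
    using that move_act_inv[of g T] by (simp add: stabilizer_def)
qed (auto simp: stabilizer_def move_act_mult)

text \<open>A period shorter than the radius of a ball inside a tile makes the tile overlap its
  translate, so it is zero. A symmetry close to the identity moves the basis periods by such short
  periods.\<close>

lemma stabilizer_discrete:
  fixes T :: "('n::finite, 'l) tile set"
  assumes T: "periodic_tiling T"
  obtains W where "open W" "W \<inter> stabilizer T = {\<one>\<^bsub>SE\<^esub>}"
proof -
  have til: "tiling T" using T by (simp add: periodic_tiling_def)
  obtain B where B: "finite B" "span B = UNIV" "B \<subseteq> periods T" using periodic_tiling_basis[OF T] by blast
  obtain t0 where t0: "t0 \<in> T" using tiling_covers[OF til] by blast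
  obtain c where "c \<in> interior (fst t0)" using tiling_tile(3)[OF til t0] by blast
  then obtain r where r: "r > 0" "ball c r \<subseteq> interior (fst t0)" by (meson open_contains_ball open_interior)
  have small: "v = 0" if "norm v < r" "v \<in> periods T" for v
  proof -
    let ?t = "move_tile (act (shift v)) t0"
    have "?t \<in> T" using that(2) t0 by (auto simp: periods_def move_def)
    moreover have "c + v \<in> interior (fst t0)" using r that(1) by (intro subsetD[OF r(2)]) (simp add: dist_norm)
    moreover have "c \<in> fst t0" using r interior_subset[of "fst t0"] centre_in_ball by blast
    then have "c + v \<in> fst ?t" by (simp add: move_tile_def act_shift)
    ultimately have "t0 = ?t" using tiling_overlap[OF til t0] by blast
    moreover have "move_tile (act (shift 0)) t0 = t0" by (simp add: move_tile_def act_shift)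
    ultimately show ?thesis using shift_tile_eq[OF til t0, of v 0] by simp
  qed
  let ?W = "{g :: 'n rigid. norm (fst g) < r} \<inter> (\<Inter>b\<in>B. {g. norm (snd g *v b - b) < r})"
  have "open ?W"
    using B(1) by (intro open_Int open_INT ballI open_Collect_less continuous_intros)
  have triv: "g = \<one>\<^bsub>SE\<^esub>" if g: "g \<in> ?W" "g \<in> stabilizer T" for g
  proof -
    have gc: "g \<in> carrier SE" "move (act g) T = T" using g by (auto simp: stabilizer_def)
    \<comment> \<open>Both \<open>b\<close> and its rotated image are periods, and their difference
      is too short to be nonzero.\<close>
    have fixed: "snd g *v b = b" if "b \<in> B" for b
    proof -
      have "snd g *v b \<in> periods T" using periods_move[OF gc(1), of b T] B(3) that gc(2) by auto
      then have "snd g *v b + - b \<in> periods T" using B(3) that by (intro periods_add periods_minus) auto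
      then have "snd g *v b - b = 0" using g that by (intro small) auto
      then show ?thesis by simp
    qed
    have "snd g *v x = x" for x
      using linear_eq_on_span[OF matrix_vector_mul_linear linear_ident fixed] B(2) by simp
    then have 1: "snd g = mat 1" by (simp add: matrix_eq)
    then have "g = shift (fst g)" by (simp add: prod_eq_iff)
    then have "fst g \<in> periods T" using gc by (simp add: periods_def)
    then have "fst g = 0" using g small by blast
    then show ?thesis using 1 by (simp add: SE_simps prod_eq_iff)
  qed
  have "\<one>\<^bsub>SE\<^esub> \<in> ?W \<inter> stabilizer T"
    using r(1) subgroup.one_closed[OF subgroup_stabilizer] by (simp add: SE_simps)
  then have "?W \<inter> stabilizer T = {\<one>\<^bsub>SE\<^esub>}"
    using triv by (intro subset_antisym subsetI) (simp_all only: Int_iff singleton_iff)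
  with \<open>open ?W\<close> show thesis by (rule that)
qed

text \<open>The patch of \<open>S\<close> in each ball is matched by a moved copy of
  \<open>T\<close>. By rigidity these copies are all equal once the radius exceeds \<open>R\<close>,
  and the common copy is \<open>S\<close>.\<close>

lemma rotational_hull_eq_orbit:
  fixes T :: "('n::finite, 'l) tile set"
  assumes T: "periodic_tiling T"
  shows "rotational_hull T = (\<lambda>g. move (act g) T) ` carrier SE"
proof (intro subset_antisym subsetI)
  have til: "tiling T" using T by (simp add: periodic_tiling_def)
  {
    fix S assume "S \<in> (\<lambda>g. move (act g) T) ` carrier SE"
    then obtain g where g: "g \<in> carrier SE" "S = move (act g) T" by blast
    have "\<exists>f. pos_isometry f \<and> move f P \<subseteq> T" if "P \<subseteq> S" for P
    proof (intro exI conjI)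
      show "pos_isometry (act (inv\<^bsub>SE\<^esub> g))" using g pos_isometry_iff by (metis SE.inv_closed)
      show "move (act (inv\<^bsub>SE\<^esub> g)) P \<subseteq> T"
        using move_mono[OF that, of "act (inv\<^bsub>SE\<^esub> g)"] g move_act_inv by metis
    qed
    then show "S \<in> rotational_hull T"
      using tiling_move[OF g(1) til] g by (simp add: rotational_hull_def)
  }
  fix S assume "S \<in> rotational_hull T"
  then have S: "tiling S" "\<And>P. \<lbrakk>finite P; P \<subseteq> S\<rbrakk> \<Longrightarrow> \<exists>f. pos_isometry f \<and> move f P \<subseteq> T"
    by (auto simp: rotational_hull_def)
  obtain R where R: "R > 0" "\<And>g h. \<lbrakk>g \<in> carrier SE; h \<in> carrier SE;
      agree_on (ball 0 R) (move (act g) T) (move (act h) T)\<rbrakk> \<Longrightarrow> move (act g) T = move (act h) T"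
    using rigidity[OF T] by blast
  have "\<exists>h\<in>carrier SE. agree_on (ball 0 (real n)) S (move (act h) T)" for n
  proof -
    let ?P = "{t \<in> S. fst t \<inter> ball 0 (real n) \<noteq> {}}"
    have "finite ?P" using tiling_locally_finite[OF S(1) bounded_ball] .
    then obtain f where f: "pos_isometry f" "move f ?P \<subseteq> T" using S(2)[of ?P] by auto
    then obtain g where g: "g \<in> carrier SE" "f = act g" using pos_isometry_iff by blast
    let ?h = "inv\<^bsub>SE\<^esub> g"
    have h: "?h \<in> carrier SE" using g by simp
    have P: "?P \<subseteq> move (act ?h) T"
      using move_mono[OF f(2), of "act ?h"] move_act_inv[OF g(1), of ?P] g(2) by simp
    have til': "tiling (move (act ?h) T)" using tiling_move[OF h til] .
    have "agree_on (ball 0 (real n)) S (move (act ?h) T)"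
    proof (rule agree_onI)
      show "t \<in> move (act ?h) T" if "t \<in> S" "fst t \<inter> ball 0 (real n) \<noteq> {}" for t using P that by blast
      \<comment> \<open>The patch gives only one inclusion. Conversely, a tile of the copy has an
        interior point in the ball; the tile of \<open>S\<close> covering this point also belongs to
        the copy and must coincide with it.\<close>
      show "t \<in> S" if t: "t \<in> move (act ?h) T" "fst t \<inter> ball 0 (real n) \<noteq> {}" for t
      proof -
        have "closure (interior (fst t)) \<inter> ball 0 (real n) \<noteq> {}"
          using t(2) tiling_tile(2)[OF til' t(1)] by blast
        then obtain y where y: "y \<in> interior (fst t)" "y \<in> ball 0 (real n)"
          using open_Int_closure_eq_empty[of "ball 0 (real n)" "interior (fst t)"] by auto
        obtain s where s: "s \<in> S" "y \<in> fst s" using tiling_covers[OF S(1)] by blast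
        then have "s \<in> move (act ?h) T" using P y(2) by blast
        then have "t = s" using tiling_overlap[OF til' t(1) _ y(1) s(2)] by blast
        then show ?thesis using s by simp
      qed
    qed
    then show ?thesis using h by blast
  qed
  then obtain h where h: "\<And>n. h n \<in> carrier SE" "\<And>n. agree_on (ball 0 (real n)) S (move (act (h n)) T)"
    by metis
  obtain N :: nat where N: "R < N" using reals_Archimedean2 by blast
  have eq: "move (act (h n)) T = move (act (h N)) T" if "n \<ge> N" for n
  proof (rule R(2)[OF h(1) h(1)])
    have "agree_on (ball 0 R) S (move (act (h m)) T)" if "m \<ge> N" for m
      using agree_on_subset[OF h(2)[of m]] N that by (simp add: subset_ball)
    then show "agree_on (ball 0 R) (move (act (h n)) T) (move (act (h N)) T)"
      using that agree_on_sym agree_on_trans by blast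
  qed
  have "S = move (act (h N)) T"
  proof (rule agree_on_all_balls_eq[OF S(1) tiling_move[OF h(1) til]])
    show "agree_on (ball 0 (real n)) S (move (act (h N)) T)" if "n \<ge> N" for n
      using h(2)[of n] eq[OF that] by simp
  qed
  then show "S \<in> (\<lambda>g. move (act g) T) ` carrier SE" using h(1) by blast
qed

section \<open>The hull topology is the quotient topology\<close>

lemma continuous_on_SE_mult [continuous_intros]:
  assumes "continuous_on S f" "continuous_on S g"
  shows "continuous_on S (\<lambda>x. f x \<otimes>\<^bsub>SE\<^esub> g x)"
  unfolding SE_simps using assms by (intro continuous_intros)

lemma continuous_on_SE_inv:
  assumes "continuous_on S f" "\<And>x. x \<in> S \<Longrightarrow> f x \<in> carrier SE"
  shows "continuous_on S (\<lambda>x. inv\<^bsub>SE\<^esub> (f x))"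
proof -
  have "continuous_on S (\<lambda>x. (- (transpose (snd (f x)) *v fst (f x)), transpose (snd (f x))))"
    using assms(1) by (intro continuous_intros)
  then show ?thesis
    by (rule continuous_on_eq) (use assms(2) in \<open>simp add: inv_SE\<close>)
qed

section \<open>Small motions and neighbourhoods of the identity\<close>

definition entry_dist :: "real^'n^'m \<Rightarrow> real^'n^'m \<Rightarrow> real" where
  "entry_dist A B = (\<Sum>i\<in>UNIV. \<Sum>j\<in>UNIV. \<bar>(A - B) $ i $ j\<bar>)"

lemma norm_diff_le_entry_dist: "norm (A - B) \<le> entry_dist A B"
proof -
  have "norm (A - B) \<le> (\<Sum>i\<in>UNIV. norm ((A - B) $ i))"
    unfolding norm_vec_def by (rule L2_set_le_sum) simp
  also have "\<dots> \<le> entry_dist A B"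
    unfolding entry_dist_def by (intro sum_mono norm_le_l1_cart)
  finally show ?thesis .
qed

lemma onorm_le_entry_dist: "onorm (\<lambda>x. A *v x - x) \<le> entry_dist A (mat 1)"
proof -
  have "(\<lambda>x. A *v x - x) = (*v) (A - mat 1)"
    by (simp add: matrix_vector_mult_diff_rdistrib fun_eq_iff)
  then show ?thesis
    unfolding entry_dist_def using onorm_le_matrix_component_sum[of "A - mat 1"] by simp
qed

lemma entry_dist_le_onorm:
  "entry_dist A (mat 1) \<le> real (CARD('n) * CARD('n)) * onorm (\<lambda>x. A *v x - x)" for A :: "real^'n^'n"
proof -
  have eq: "(\<lambda>x. A *v x - x) = (*v) (A - mat 1)"
    by (simp add: matrix_vector_mult_diff_rdistrib fun_eq_iff)
  have "entry_dist A (mat 1) \<le> (\<Sum>i\<in>(UNIV::'n set). \<Sum>j\<in>(UNIV::'n set). onorm ((*v) (A - mat 1)))"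
    unfolding entry_dist_def by (intro sum_mono matrix_component_le_onorm)
  then show ?thesis unfolding eq by simp
qed

text \<open>With its converse below, this says that small motions form a neighbourhood base of the
  identity among the rigid motions. \<open>entry_dist\<close> mediates, being continuous and
  comparable to the operator norm.\<close>

lemma small_motion_of_near_one:
  assumes "\<epsilon> > 0"
  obtains U :: "'n::finite rigid set" where "open U" "\<one>\<^bsub>SE\<^esub> \<in> U"
    "\<And>m. \<lbrakk>m \<in> U; m \<in> carrier SE\<rbrakk> \<Longrightarrow> small_motion \<epsilon> (act m)"
proof -
  let ?U = "{m :: 'n rigid. norm (fst m) < \<epsilon>} \<inter> {m. entry_dist (snd m) (mat 1) < \<epsilon>}"
  show thesis
  proof
    show "open ?U"
      unfolding entry_dist_def by (intro open_Int open_Collect_less continuous_intros)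
    show "\<one>\<^bsub>SE\<^esub> \<in> ?U" using assms by (simp add: SE_simps entry_dist_def)
    fix m :: "'n rigid" assume m: "m \<in> ?U" "m \<in> carrier SE"
    let ?R = "snd m"
    have R: "?R \<in> SO" using m by (simp add: SE_simps)
    \<comment> \<open>A small motion translates before it rotates, whereas \<open>act\<close>
      rotates first, so the vector is pulled back by the rotation.\<close>
    let ?v = "transpose ?R *v fst m"
    have v: "?R *v ?v = fst m" "norm ?v = norm (fst m)"
      using SO_mult_transpose[OF R] SO_norm[OF SO_transpose[OF R]]
      by (simp_all add: matrix_vector_mul_assoc del: transpose_matrix_vector)
    have "orthogonal_transformation ((*v) ?R)"
      using R by (simp add: orthogonal_transformation_matrix SO_iff)
    moreover have "onorm (\<lambda>x. ?R *v x - x) < \<epsilon>"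
      using onorm_le_entry_dist[of ?R] m by simp
    moreover have "act m = (\<lambda>x. ?R *v (x + ?v))"
      unfolding matrix_vector_right_distrib v(1) act_def by simp
    moreover have "norm ?v < \<epsilon>" using v(2) m(1) by simp
    ultimately show "small_motion \<epsilon> (act m)"
      unfolding small_motion_def using R
      by (intro exI[of _ ?v] exI[of _ "(*v) ?R"]) (simp add: SO_iff)
  qed
qed

lemma near_one_of_small_motion:
  fixes U :: "'n::finite rigid set"
  assumes "open U" "\<one>\<^bsub>SE\<^esub> \<in> U"
  obtains \<epsilon> where "\<epsilon> > 0" "\<And>f. small_motion \<epsilon> f \<Longrightarrow> \<exists>m\<in>U \<inter> carrier SE. f = act m"
proof -
  obtain \<delta> where \<delta>: "\<delta> > 0" "ball \<one>\<^bsub>SE\<^esub> \<delta> \<subseteq> U" using assms open_contains_ball by blast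
  let ?n = "real (CARD('n) * CARD('n))"
  \<comment> \<open>The denominator absorbs the translation part and the number of matrix entries in
    the comparison with the operator norm.\<close>
  define \<epsilon> where "\<epsilon> = \<delta> / (1 + ?n)"
  have pos: "1 + ?n > 0" by (simp add: add_pos_nonneg)
  show thesis
  proof
    show "\<epsilon> > 0" using \<delta>(1) pos by (simp add: \<epsilon>_def)
    fix f :: "real^'n \<Rightarrow> real^'n" assume "small_motion \<epsilon> f"
    then obtain v R where vR: "norm v < \<epsilon>" "orthogonal_transformation R" "det (matrix R) = 1"
      "onorm (\<lambda>x. R x - x) < \<epsilon>" "f = (\<lambda>x. R (x + v))"
      unfolding small_motion_def by blast
    have lin: "linear R" using vR(2) by (rule orthogonal_transformation_linear)
    have R: "R = (*v) (matrix R)" using matrix_vector_mul(2)[OF lin] by simp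
    let ?m = "(R v, matrix R)"
    have f: "f = act ?m"
    proof
      fix x show "f x = act ?m x" unfolding vR(5) act_def linear_add[OF lin] by (simp flip: R)
    qed
    have m: "?m \<in> carrier SE"
      using vR(2,3) orthogonal_transformation_matrix[of R] by (simp add: SE_simps SO_iff)
    have nv: "norm (R v) = norm v" using vR(2) by (simp add: orthogonal_transformation)
    have "dist ?m \<one>\<^bsub>SE\<^esub> \<le> norm (R v) + norm (matrix R - mat 1)"
      unfolding SE_simps dist_prod_def by (simp add: dist_norm sqrt_sum_squares_le_sum)
    also have "\<dots> < \<epsilon> + ?n * \<epsilon>"
    proof (rule add_less_le_mono)
      show "norm (R v) < \<epsilon>" using nv vR(1) by simp
      have "norm (matrix R - mat 1) \<le> ?n * onorm (\<lambda>x. R x - x)"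
        using order_trans[OF norm_diff_le_entry_dist entry_dist_le_onorm[of "matrix R"]] by (simp flip: R)
      also have "\<dots> \<le> ?n * \<epsilon>" using vR(4) by (intro mult_left_mono) auto
      finally show "norm (matrix R - mat 1) \<le> ?n * \<epsilon>" .
    qed
    also have "\<epsilon> + ?n * \<epsilon> = (1 + ?n) * \<epsilon>" by (simp add: distrib_right)
    also have "\<dots> = \<delta>" using pos by (simp add: \<epsilon>_def)
    finally have "?m \<in> U" using \<delta>(2) by (auto simp: dist_commute)
    then show "\<exists>m\<in>U \<inter> carrier SE. f = act m" using m f by blast
  qed
qed

lemma hull_openin_nhd:
  assumes "openin (hull_topology T) U" "S \<in> U"
  obtains \<epsilon> where "\<epsilon> > 0" "\<And>S'. \<lbrakk>S' \<in> rotational_hull T; close_tilings \<epsilon> S S'\<rbrakk> \<Longrightarrow> S' \<in> U"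
  using assms unfolding openin_hull_topology by metis

text \<open>The factor \<open>a\<close> places the base point at an arbitrary tiling of the hull.
  Continuity holds since nearby motions give close tilings; openness is the converse and rests on
  rigidity.\<close>

lemma discrete_quotient_hull:
  fixes T :: "('n::finite, 'l) tile set"
  assumes T: "periodic_tiling T" and a: "a \<in> carrier SE"
  shows "discrete_quotient SE (hull_topology T) (\<lambda>g. move (act (a \<otimes>\<^bsub>SE\<^esub> g)) T) (stabilizer T)"
proof (intro discrete_quotient.intro discrete_quotient_axioms.intro)
  let ?\<phi> = "\<lambda>g. move (act (a \<otimes>\<^bsub>SE\<^esub> g)) T"
  have hull: "rotational_hull T = (\<lambda>g. move (act g) T) ` carrier SE"
    by (rule rotational_hull_eq_orbit[OF T])
  have in_hull: "?\<phi> g \<in> rotational_hull T" if "g \<in> carrier SE" for g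
    unfolding hull using a that by (intro imageI) simp
  obtain R where R: "R > 0" "\<And>g h. \<lbrakk>g \<in> carrier SE; h \<in> carrier SE;
      agree_on (ball 0 R) (move (act g) T) (move (act h) T)\<rbrakk> \<Longrightarrow> move (act g) T = move (act h) T"
    using rigidity[OF T] by blast
  show "group (SE :: 'n rigid monoid)" by (rule SE.is_group)
  show "continuous_on (carrier SE \<times> carrier SE) (\<lambda>(x, y). x \<otimes>\<^bsub>SE\<^esub> (y :: 'n rigid))"
    unfolding split_beta by (intro continuous_intros)
  show "continuous_on (carrier SE) (\<lambda>x :: 'n rigid. inv\<^bsub>SE\<^esub> x)"
    by (intro continuous_on_SE_inv continuous_intros)
  show "subgroup (stabilizer T) SE" by (rule subgroup_stabilizer)
  show "\<exists>W. open W \<and> W \<inter> stabilizer T = {\<one>\<^bsub>SE\<^esub>}" using stabilizer_discrete[OF T] by metis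
  show "(?\<phi> g = ?\<phi> h) = (inv\<^bsub>SE\<^esub> g \<otimes>\<^bsub>SE\<^esub> h \<in> stabilizer T)"
    if g: "g \<in> carrier SE" and h: "h \<in> carrier SE" for g h
  proof -
    have "?\<phi> g = ?\<phi> h \<longleftrightarrow> move (act h) T = move (act g) T"
      using move_act_cancel[OF a] by (auto simp: move_act_mult)
    then show ?thesis using move_act_eq_iff[OF h g, of T T] g h by (simp add: stabilizer_def)
  qed
  show "?\<phi> ` carrier SE = topspace (hull_topology T)"
  proof
    show "topspace (hull_topology T) \<subseteq> ?\<phi> ` carrier SE"
    proof
      fix S assume "S \<in> topspace (hull_topology T)"
      then obtain g where g: "g \<in> carrier SE" "S = move (act g) T"
        by (auto simp: topspace_hull_topology hull)
      then have "S = ?\<phi> (inv\<^bsub>SE\<^esub> a \<otimes>\<^bsub>SE\<^esub> g)" using a by (simp add: SE.m_assoc[symmetric])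
      then show "S \<in> ?\<phi> ` carrier SE" using g a by (intro image_eqI[of _ _ "inv\<^bsub>SE\<^esub> a \<otimes>\<^bsub>SE\<^esub> g"]) simp_all
    qed
  qed (use in_hull in \<open>auto simp: topspace_hull_topology\<close>)
  show "continuous_map (top_of_set (carrier SE)) (hull_topology T) ?\<phi>"
    unfolding continuous_map_def topspace_hull_topology
  proof (intro conjI allI impI)
    show "?\<phi> \<in> topspace (top_of_set (carrier SE)) \<rightarrow> rotational_hull T" using in_hull by simp
    fix U assume U: "openin (hull_topology T) U"
    show "openin (top_of_set (carrier SE)) {g \<in> topspace (top_of_set (carrier SE)). ?\<phi> g \<in> U}"
    proof (subst openin_subopen, intro ballI)
      fix g assume "g \<in> {g \<in> topspace (top_of_set (carrier SE)). ?\<phi> g \<in> U}"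
      then have g: "g \<in> carrier SE" "?\<phi> g \<in> U" by auto
      obtain \<epsilon> where \<epsilon>: "\<epsilon> > 0" "\<And>S'. \<lbrakk>S' \<in> rotational_hull T; close_tilings \<epsilon> (?\<phi> g) S'\<rbrakk> \<Longrightarrow> S' \<in> U"
        using hull_openin_nhd[OF U g(2)] by blast
      obtain V :: "'n rigid set" where V: "open V" "\<one>\<^bsub>SE\<^esub> \<in> V"
        "\<And>m. \<lbrakk>m \<in> V; m \<in> carrier SE\<rbrakk> \<Longrightarrow> small_motion \<epsilon> (act m)"
        using small_motion_of_near_one[OF \<epsilon>(1)] by blast
      \<comment> \<open>The motion that carries the tiling of \<open>g\<close> to the tiling of
        \<open>g'\<close>; it is the identity at \<open>g' = g\<close>.\<close>
      let ?q = "\<lambda>g'. (a \<otimes>\<^bsub>SE\<^esub> g') \<otimes>\<^bsub>SE\<^esub> inv\<^bsub>SE\<^esub> (a \<otimes>\<^bsub>SE\<^esub> g)"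
      let ?N = "carrier SE \<inter> ?q -` V"
      have "openin (top_of_set (carrier SE)) ?N"
        by (rule continuous_openin_preimage_gen[OF _ V(1)]) (intro continuous_intros)
      moreover have "g \<in> ?N" using g a V(2) by simp
      moreover have "?N \<subseteq> {g \<in> topspace (top_of_set (carrier SE)). ?\<phi> g \<in> U}"
      proof
        fix g' assume g': "g' \<in> ?N"
        let ?m = "?q g'"
        have m: "?m \<in> carrier SE" "?m \<in> V" using g' g a by simp_all
        have "?m \<otimes>\<^bsub>SE\<^esub> (a \<otimes>\<^bsub>SE\<^esub> g) = a \<otimes>\<^bsub>SE\<^esub> g'" using g' g a by (simp add: SE.m_assoc)
        then have "move (act ?m) (?\<phi> g) = move (act \<one>\<^bsub>SE\<^esub>) (?\<phi> g')"
          unfolding move_act_one by (simp only: move_act_mult[symmetric])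
        then have "close_tilings \<epsilon> (?\<phi> g) (?\<phi> g')"
          unfolding close_tilings_def agree_on_def using V(2,3) m
          by (intro exI[of _ "act ?m"] exI[of _ "act \<one>\<^bsub>SE\<^esub>"]) simp
        then show "g' \<in> {g \<in> topspace (top_of_set (carrier SE)). ?\<phi> g \<in> U}"
          using \<epsilon>(2) in_hull g' by simp
      qed
      ultimately show "\<exists>N. openin (top_of_set (carrier SE)) N \<and> g \<in> N \<and>
          N \<subseteq> {g \<in> topspace (top_of_set (carrier SE)). ?\<phi> g \<in> U}" by blast
    qed
  qed
  show "open_map (top_of_set (carrier SE)) (hull_topology T) ?\<phi>"
    unfolding open_map_def openin_hull_topology
  proof (intro allI impI conjI ballI)
    fix V :: "'n rigid set" assume V: "openin (top_of_set (carrier SE)) V"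
    have VG: "V \<subseteq> carrier SE" using V openin_imp_subset by blast
    show "?\<phi> ` V \<subseteq> rotational_hull T" using VG in_hull by blast
    fix S assume "S \<in> ?\<phi> ` V"
    then obtain g where g: "g \<in> V" "S = ?\<phi> g" by blast
    have gG: "g \<in> carrier SE" using g VG by blast
    \<comment> \<open>If \<open>m\<close> and \<open>m'\<close> make the tiling of \<open>g\<close>
      and a close tiling agree, this element maps to the close tiling. At the identity pair it is
      \<open>g\<close>, so small motions keep it in \<open>V\<close>.\<close>
    let ?\<Psi> = "\<lambda>p. inv\<^bsub>SE\<^esub> a \<otimes>\<^bsub>SE\<^esub> (inv\<^bsub>SE\<^esub> (snd p) \<otimes>\<^bsub>SE\<^esub> fst p \<otimes>\<^bsub>SE\<^esub> (a \<otimes>\<^bsub>SE\<^esub> g))"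
    let ?C = "carrier SE \<times> carrier SE :: ('n rigid \<times> 'n rigid) set"
    have "continuous_on ?C ?\<Psi>"
      by (intro continuous_intros continuous_on_SE_inv) auto
    moreover have "?\<Psi> \<in> ?C \<rightarrow> carrier SE" using a gG by auto
    ultimately have "openin (top_of_set ?C) (?C \<inter> ?\<Psi> -` V)"
      using V by (rule continuous_openin_preimage)
    moreover have "(\<one>\<^bsub>SE\<^esub>, \<one>\<^bsub>SE\<^esub>) \<in> ?C \<inter> ?\<Psi> -` V"
      using a gG g by (simp add: SE.m_assoc[symmetric])
    ultimately obtain A B where AB: "openin (top_of_set (carrier SE)) A" "\<one>\<^bsub>SE\<^esub> \<in> A"
      "openin (top_of_set (carrier SE)) B" "\<one>\<^bsub>SE\<^esub> \<in> B" "A \<times> B \<subseteq> ?C \<inter> ?\<Psi> -` V"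
      using Times_in_interior_subtopology[of "\<one>\<^bsub>SE\<^esub>" "\<one>\<^bsub>SE\<^esub>" "?C \<inter> ?\<Psi> -` V" "carrier SE" "carrier SE"]
      by blast
    obtain O1 where O1: "open O1" "A = carrier SE \<inter> O1" using AB(1) by (auto simp: openin_open)
    obtain O2 where O2: "open O2" "B = carrier SE \<inter> O2" using AB(3) by (auto simp: openin_open)
    obtain \<epsilon> where \<epsilon>: "\<epsilon> > 0" "\<And>f. small_motion \<epsilon> f \<Longrightarrow> \<exists>m\<in>(O1 \<inter> O2) \<inter> carrier SE. f = act m"
      using near_one_of_small_motion[of "O1 \<inter> O2"] O1 O2 AB(2,4) by (metis IntE IntI open_Int)
    show "\<exists>\<epsilon>>0. \<forall>S'\<in>rotational_hull T. close_tilings \<epsilon> S S' \<longrightarrow> S' \<in> ?\<phi> ` V"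
    proof (intro exI[of _ "min \<epsilon> (1 / R)"] conjI ballI impI)
      show "0 < min \<epsilon> (1 / R)" using \<epsilon>(1) R(1) by simp
      fix S' assume S': "S' \<in> rotational_hull T" "close_tilings (min \<epsilon> (1 / R)) S S'"
      obtain b where b: "b \<in> carrier SE" "S' = move (act b) T" using S'(1) unfolding hull by blast
      obtain f f' where f: "small_motion (min \<epsilon> (1 / R)) f" "small_motion (min \<epsilon> (1 / R)) f'"
        "agree_on (ball 0 (1 / min \<epsilon> (1 / R))) (move f S) (move f' S')"
        using S'(2) unfolding close_tilings_def by blast
      obtain m where m: "m \<in> O1 \<inter> O2" "m \<in> carrier SE" "f = act m"
        using \<epsilon>(2)[OF small_motion_mono[OF f(1)]] by auto
      obtain m' where m': "m' \<in> O1 \<inter> O2" "m' \<in> carrier SE" "f' = act m'"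
        using \<epsilon>(2)[OF small_motion_mono[OF f(2)]] by auto
      \<comment> \<open>The bound \<open>1 / R\<close> was included so that the ball of agreement
        reaches the radius of rigidity.\<close>
      have "R \<le> 1 / min \<epsilon> (1 / R)"
        using \<epsilon>(1) R(1) by (simp add: le_divide_eq min_def field_simps)
      then have "agree_on (ball 0 R) (move f S) (move f' S')"
        using agree_on_subset[OF f(3)] by (simp add: subset_ball)
      then have "agree_on (ball 0 R) (move (act (m \<otimes>\<^bsub>SE\<^esub> (a \<otimes>\<^bsub>SE\<^esub> g))) T) (move (act (m' \<otimes>\<^bsub>SE\<^esub> b)) T)"
        unfolding g(2) b(2) m(3) m'(3) by (simp add: move_act_mult)
      then have "move (act (m \<otimes>\<^bsub>SE\<^esub> (a \<otimes>\<^bsub>SE\<^esub> g))) T = move (act (m' \<otimes>\<^bsub>SE\<^esub> b)) T"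
        using m m' a b gG by (intro R(2)) simp_all
      then have "move (act (inv\<^bsub>SE\<^esub> m')) (move (act (m \<otimes>\<^bsub>SE\<^esub> (a \<otimes>\<^bsub>SE\<^esub> g))) T) = S'"
        unfolding b(2) by (simp add: move_act_mult[of m'] move_act_inv[OF m'(2)])
      moreover have "a \<otimes>\<^bsub>SE\<^esub> ?\<Psi> (m, m') = inv\<^bsub>SE\<^esub> m' \<otimes>\<^bsub>SE\<^esub> (m \<otimes>\<^bsub>SE\<^esub> (a \<otimes>\<^bsub>SE\<^esub> g))"
      proof -
        have "a \<otimes>\<^bsub>SE\<^esub> ?\<Psi> (m, m') = (a \<otimes>\<^bsub>SE\<^esub> inv\<^bsub>SE\<^esub> a) \<otimes>\<^bsub>SE\<^esub> (inv\<^bsub>SE\<^esub> m' \<otimes>\<^bsub>SE\<^esub> m \<otimes>\<^bsub>SE\<^esub> (a \<otimes>\<^bsub>SE\<^esub> g))"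
          using m m' a gG by (simp only: SE.m_assoc SE.inv_closed SE.m_closed fst_conv snd_conv)
        then show ?thesis using m m' a gG by (simp add: SE.m_assoc)
      qed
      ultimately have "S' = ?\<phi> (?\<Psi> (m, m'))" by (simp only: move_act_mult)
      moreover have "?\<Psi> (m, m') \<in> V" using AB(5) O1 O2 m m' by blast
      ultimately show "S' \<in> ?\<phi> ` V" by blast
    qed
  qed
qed

section \<open>The fundamental group of the hull\<close>

lemma act_iso_positive_space_group:
  "act \<in> iso (SE\<lparr>carrier := stabilizer T\<rparr>) (positive_space_group T)"
proof (rule isoI)
  show "act \<in> hom (SE\<lparr>carrier := stabilizer T\<rparr>) (positive_space_group T)"
    by (rule homI) (auto simp: positive_space_group_def stabilizer_def pos_isometry_iff fun_eq_iff act_mult)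
  show "bij_betw act (carrier (SE\<lparr>carrier := stabilizer T\<rparr>)) (carrier (positive_space_group T))"
    unfolding bij_betw_def
  proof
    show "inj_on act (carrier (SE\<lparr>carrier := stabilizer T\<rparr>))" using act_eqI by (intro inj_onI)
    show "act ` carrier (SE\<lparr>carrier := stabilizer T\<rparr>) = carrier (positive_space_group T)"
      by (auto simp: positive_space_group_def stabilizer_def pos_isometry_iff)
  qed
qed

lemma group_positive_space_group: "group (positive_space_group T)"
proof -
  let ?H = "SE\<lparr>carrier := stabilizer T\<rparr>" and ?P = "positive_space_group T"
  interpret H: group ?H using SE.subgroup_imp_group[OF subgroup_stabilizer] .
  have P: "carrier ?P = act ` stabilizer T"
    using act_iso_positive_space_group[of T] by (auto simp: iso_def bij_betw_def)
  have one: "\<one>\<^bsub>?P\<^esub> = act \<one>\<^bsub>SE\<^esub>" by (simp add: positive_space_group_def fun_eq_iff act_one)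
  have mult: "act g \<otimes>\<^bsub>?P\<^esub> act h = act (g \<otimes>\<^bsub>SE\<^esub> h)" for g h
    by (simp add: positive_space_group_def fun_eq_iff act_mult)
  show ?thesis
  proof (rule groupI)
    show "\<exists>y\<in>carrier ?P. y \<otimes>\<^bsub>?P\<^esub> x = \<one>\<^bsub>?P\<^esub>" if "x \<in> carrier ?P" for x
      using that H.l_inv_ex unfolding P one by (auto simp: mult) (metis imageI mult)
  qed (use H.m_closed H.one_closed H.m_assoc H.l_one in \<open>auto simp: P one mult\<close>)
qed

section \<open>Loops of rigid motions\<close>

definition turn_loop :: "'n::finite \<Rightarrow> 'n \<Rightarrow> int \<Rightarrow> real \<Rightarrow> 'n rigid" where
  "turn_loop i j k t = (0, turns i j k t)"

lemma turn_loop_loop: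
  assumes "i \<noteq> j"
  shows "path (turn_loop i j k) \<and> path_image (turn_loop i j k) \<subseteq> carrier SE \<and>
    turn_loop i j k 0 = \<one>\<^bsub>SE\<^esub> \<and> turn_loop i j k 1 = \<one>\<^bsub>SE\<^esub>"
  using turns_loop[OF assms, of k]
  by (auto simp: turn_loop_def[abs_def] path_def path_image_def SE_simps intro!: continuous_intros)

lemma homotopic_SE_of_SO:
  assumes "homotopic_paths SO p q"
  shows "homotopic_paths (carrier SE) (\<lambda>t. (0, p t)) (\<lambda>t. (0, q t))"
proof -
  have "continuous_on SO (\<lambda>R. (0, R))" by (intro continuous_intros)
  from homotopic_paths_continuous_image[OF assms this, of "carrier SE"] show ?thesis
    by (simp add: o_def SE_simps)
qed

lemma homotopic_SO_of_SE:
  assumes "homotopic_paths (carrier SE) p q"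
  shows "homotopic_paths SO (snd \<circ> p) (snd \<circ> q)"
  by (rule homotopic_paths_continuous_image[OF assms]) (auto simp: SE_simps intro!: continuous_intros)

lemma turn_loop_join:
  assumes "i \<noteq> j"
  shows "homotopic_paths (carrier SE) (turn_loop i j k +++ turn_loop i j m) (turn_loop i j (k + m))"
proof -
  have "turn_loop i j k +++ turn_loop i j m = (\<lambda>t. (0, (turns i j k +++ turns i j m) t))"
    by (simp add: joinpaths_def turn_loop_def fun_eq_iff)
  then show ?thesis
    using homotopic_SE_of_SO[OF turns_join[OF assms, of k m]] by (simp add: turn_loop_def[abs_def])
qed

lemma SE_loop_homotopic_turn_loop:
  fixes c :: "real \<Rightarrow> 'n::finite rigid"
  assumes ij: "i \<noteq> j" and c: "path c" "path_image c \<subseteq> carrier SE" "c 0 = \<one>\<^bsub>SE\<^esub>" "c 1 = \<one>\<^bsub>SE\<^esub>"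
  obtains k where "homotopic_paths (carrier SE) c (turn_loop i j k)"
proof -
  have cc: "continuous_on {0..1} c" using c(1) by (simp add: path_def)
  have cSO: "snd (c t) \<in> SO" if "t \<in> {0..1}" for t
    using c(2) that by (auto simp: path_image_def image_subset_iff SE_simps)
  have "path (\<lambda>t. snd (c t))" "path_image (\<lambda>t. snd (c t)) \<subseteq> SO"
    using cc cSO by (auto simp: path_def path_image_def intro!: continuous_intros)
  then obtain k where k: "homotopic_paths SO (\<lambda>t. snd (c t)) (turns i j k)"
    using SO_loop_homotopic_turns[OF ij, of "\<lambda>t. snd (c t)"] c(3,4) by (auto simp: SE_simps)
  \<comment> \<open>Scaling the translation part to zero retracts the rigid motions onto the
    rotations.\<close>
  let ?h = "\<lambda>p. ((1 - fst p) *\<^sub>R fst (c (snd p)), snd (c (snd p)))"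
  have "continuous_on ({0..1} \<times> {0..1}) ?h"
    by (intro continuous_intros continuous_on_compose2[OF cc]) auto
  then have "homotopic_paths (carrier SE) c (\<lambda>t. (0, snd (c t)))"
    unfolding homotopic_paths using c(3,4) cSO
    by (intro exI[of _ ?h]) (auto simp: SE_simps pathstart_def pathfinish_def)
  from homotopic_paths_trans[OF this homotopic_SE_of_SO[OF k]]
  show thesis by (intro that) (simp add: turn_loop_def[abs_def])
qed

lemma path_connected_SE: "path_connected (carrier (SE :: 'n::finite rigid monoid))"
proof -
  have "carrier (SE :: 'n rigid monoid) = UNIV \<times> SO" by (auto simp: SE_simps)
  then show ?thesis by (simp only: path_connected_Times path_connected_UNIV path_connected_SO)
qed

theorem corollary5p14:
  fixes T :: "((real ^ 'n) set \<times> 'l) set"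
  assumes "periodic_tiling T"
  shows "(CARD('n) = 2 \<longrightarrow> (\<forall>S \<in> rotational_hull T.
            group_extension integer_group (fundamental_group (hull_topology T) S)
              (positive_space_group T)))
       \<and> (CARD('n) \<ge> 3 \<longrightarrow> (\<forall>S \<in> rotational_hull T.
            group_extension (integer_mod_group 2) (fundamental_group (hull_topology T) S)
              (positive_space_group T)))"
proof -
  \<comment> \<open>Both cases share this argument. The elements of \<open>A\<close> are integers
    naming numbers of turns, and the two cases differ only in which numbers give homotopic
    loops.\<close>
  have ext: "group_extension A (fundamental_group (hull_topology T) S) (positive_space_group T)"
    if S: "S \<in> rotational_hull T" and A: "group A" and ij: "i \<noteq> j"
      and mult: "\<And>a b. \<lbrakk>a \<in> carrier A; b \<in> carrier A\<rbrakk> \<Longrightarrow>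
        homotopic_paths (carrier SE) (turn_loop i j (a + b)) (turn_loop i j (a \<otimes>\<^bsub>A\<^esub> b))"
      and inj: "\<And>a b. \<lbrakk>a \<in> carrier A; b \<in> carrier A; homotopic_paths SO (turns i j a) (turns i j b)\<rbrakk> \<Longrightarrow> a = b"
      and surj: "\<And>k. \<exists>a\<in>carrier A. homotopic_paths (carrier SE) (turn_loop i j k) (turn_loop i j a)"
    for A :: "int monoid" and S and i j :: 'n
  proof -
    obtain a where a: "a \<in> carrier SE" "S = move (act a) T"
      using S unfolding rotational_hull_eq_orbit[OF assms] by blast
    interpret discrete_quotient SE "hull_topology T" "\<lambda>g. move (act (a \<otimes>\<^bsub>SE\<^esub> g)) T" "stabilizer T"
      using discrete_quotient_hull[OF assms a(1)] .
    have S': "S = move (act (a \<otimes>\<^bsub>SE\<^esub> \<one>\<^bsub>SE\<^esub>)) T" using a by simp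
    show ?thesis
      unfolding S'
    proof (rule group_extension_fundamental_group[where \<omega> = "turn_loop i j" and \<psi> = act])
      show "path_connected (carrier SE)" by (rule path_connected_SE)
      show "homotopic_paths (carrier SE) (turn_loop i j a +++ turn_loop i j b) (turn_loop i j (a \<otimes>\<^bsub>A\<^esub> b))"
        if "a \<in> carrier A" "b \<in> carrier A" for a b
        using homotopic_paths_trans[OF turn_loop_join[OF ij] mult[OF that]] .
      show "a = b" if "a \<in> carrier A" "b \<in> carrier A"
        "homotopic_paths (carrier SE) (turn_loop i j a) (turn_loop i j b)" for a b
        using inj[OF that(1,2)] homotopic_SO_of_SE[OF that(3)] by (simp add: o_def turn_loop_def)
      show "\<exists>a\<in>carrier A. homotopic_paths (carrier SE) c (turn_loop i j a)"
        if c: "path c" "path_image c \<subseteq> carrier SE" "c 0 = \<one>\<^bsub>SE\<^esub>" "c 1 = \<one>\<^bsub>SE\<^esub>" for c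
      proof -
        obtain k where k: "homotopic_paths (carrier SE) c (turn_loop i j k)"
          using SE_loop_homotopic_turn_loop[OF ij c] .
        obtain a where "a \<in> carrier A" "homotopic_paths (carrier SE) (turn_loop i j k) (turn_loop i j a)"
          using surj[of k] by blast
        then show ?thesis using homotopic_paths_trans[OF k] by blast
      qed
    qed (rule A group_positive_space_group act_iso_positive_space_group turn_loop_loop[OF ij])+
  qed
  have refl: "homotopic_paths (carrier SE) (turn_loop i j k) (turn_loop i j k)" if "i \<noteq> j" for i j :: 'n and k
    using turn_loop_loop[OF that, of k] by simp
  have "group_extension integer_group (fundamental_group (hull_topology T) S) (positive_space_group T)"
    if S: "S \<in> rotational_hull T" and card: "CARD('n) = 2" for S
  proof -
    from card obtain i j :: 'n where ij: "i \<noteq> j" by (metis card_2_iff)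
    show ?thesis
    proof (rule ext[OF S _ ij])
      show "a = b" if "homotopic_paths SO (turns i j a) (turns i j b)" for a b
        using turns_homotopic_imp_eq[OF card ij that] .
      show "homotopic_paths (carrier SE) (turn_loop i j (a + b)) (turn_loop i j (a \<otimes>\<^bsub>integer_group\<^esub> b))" for a b
        unfolding mult_integer_group by (rule refl[OF ij])
      show "\<exists>a\<in>carrier integer_group. homotopic_paths (carrier SE) (turn_loop i j k) (turn_loop i j a)" for k
        by (intro bexI[of _ k] refl[OF ij]) simp
    qed simp
  qed
  moreover have "group_extension (integer_mod_group 2) (fundamental_group (hull_topology T) S) (positive_space_group T)"
    if S: "S \<in> rotational_hull T" and card: "CARD('n) \<ge> 3" for S
  proof -
    obtain K :: "'n set" where "card K = 3" using obtain_subset_with_card_n[OF card] by auto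
    then obtain i j k :: 'n where ijk: "i \<noteq> j" "k \<noteq> i" "k \<noteq> j" unfolding card_3_iff by auto
    have mod: "homotopic_paths (carrier SE) (turn_loop i j m) (turn_loop i j (m mod 2))" for m
      using homotopic_SE_of_SO[OF turns_cong_mod_2[OF ijk, of m]] by (simp add: turn_loop_def[abs_def])
    have carr: "carrier (integer_mod_group 2) = {0, 1}" by (auto simp: carrier_integer_mod_group)
    show ?thesis
    proof (rule ext[OF S _ ijk(1)])
      show "homotopic_paths (carrier SE) (turn_loop i j (a + b)) (turn_loop i j (a \<otimes>\<^bsub>integer_mod_group 2\<^esub> b))"
        if "a \<in> carrier (integer_mod_group 2)" "b \<in> carrier (integer_mod_group 2)" for a b
        using mod[of "a + b"] by (simp add: mult_integer_mod_group)
      show "a = b" if "a \<in> carrier (integer_mod_group 2)" "b \<in> carrier (integer_mod_group 2)"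
        "homotopic_paths SO (turns i j a) (turns i j b)" for a b
      proof (rule ccontr)
        \<comment> \<open>Two different elements are \<open>0\<close> and \<open>1\<close>, so a
          single turn would be null-homotopic.\<close>
        assume "a \<noteq> b"
        then have "homotopic_paths SO (turns i j 1) (turns i j 0)"
          using that homotopic_paths_sym unfolding carr by auto
        then show False
          using full_turn_not_nullhomotopic[OF ijk(1)] by (simp add: turns_0[OF ijk(1)])
      qed
      show "\<exists>a\<in>carrier (integer_mod_group 2). homotopic_paths (carrier SE) (turn_loop i j k) (turn_loop i j a)" for k
        using mod[of k] by (intro bexI[of _ "k mod 2"]) (auto simp: carrier_integer_mod_group)
    qed simp
  qed
  ultimately show ?thesis by blast
qed

end
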